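(* Let $k$ be a fixed positive integer divisible by $4$. Then there exists a constant $C_k$ such that for all odd prime powers $q > C_k$ coprime to $k-4$, there exist two monic irreducible polynomials $\mathfrak{p}$ and $\mathfrak{p}'$ of degree $k$ in $\mathbf{F}_q[T]$ and non-squares $e, e'$ in $\mathbf{F}_q$ such that the class numbers of $\mathbf{F}_q[T,\sqrt{e\mathfrak{p}}]$ and $\mathbf{F}_q[T,\sqrt{e'\mathfrak{p}'}]$ are different modulo $8$.
   Context: $\mathbf{F}_q$ is the finite field with $q$ elements. For $e$ a non-square in $\mathbf{F}_q$ and $\mathfrak{p}$ monic irreducible in $\mathbf{F}_q[T]$, the ring $\mathbf{F}_q[T,\sqrt{e\mathfrak{p}}]$ is the integral closure of $\mathbf{F}_q[T]$ in the quadratic extension $\mathbf{F}_q(T)(\sqrt{e\mathfrak{p}})$ of $\mathbf{F}_q(T)$, which is a Dedekind ring. Its class number is the order of its (finite) ideal class group. "Coprime to $k-4$" means $\gcd(q,k-4)=1$ (with $\gcd(q,0)=q$). *)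

theory Defs
  imports "HOL-Number_Theory.Prime_Powers" "HOL-Algebra.Algebra"
begin

section \<open>The fraction field of a domain\<close>

definition frac_rel :: "('a, 'm) ring_scheme \<Rightarrow> (('a \<times> 'a) \<times> ('a \<times> 'a)) set" where
  "frac_rel A = {((a, s), (b, t)) | a s b t.
     a \<in> carrier A \<and> b \<in> carrier A \<and> s \<in> carrier A - {\<zero>\<^bsub>A\<^esub>} \<and> t \<in> carrier A - {\<zero>\<^bsub>A\<^esub>} \<and>
     a \<otimes>\<^bsub>A\<^esub> t = b \<otimes>\<^bsub>A\<^esub> s}"

definition fraction :: "('a, 'm) ring_scheme \<Rightarrow> 'a \<Rightarrow> 'a \<Rightarrow> ('a \<times> 'a) set" where
  "fraction A a s = frac_rel A `` {(a, s)}"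

definition fraction_field :: "('a, 'm) ring_scheme \<Rightarrow> ('a \<times> 'a) set ring" where
  "fraction_field A =
     \<lparr> carrier = (carrier A \<times> (carrier A - {\<zero>\<^bsub>A\<^esub>})) // frac_rel A,
       monoid.mult = (\<lambda>x y. \<Union>(a, s)\<in>x. \<Union>(b, t)\<in>y. fraction A (a \<otimes>\<^bsub>A\<^esub> b) (s \<otimes>\<^bsub>A\<^esub> t)),
       one = fraction A \<one>\<^bsub>A\<^esub> \<one>\<^bsub>A\<^esub>,
       ring.zero = fraction A \<zero>\<^bsub>A\<^esub> \<one>\<^bsub>A\<^esub>,
       ring.add = (\<lambda>x y. \<Union>(a, s)\<in>x. \<Union>(b, t)\<in>y.
                fraction A (a \<otimes>\<^bsub>A\<^esub> t \<oplus>\<^bsub>A\<^esub> b \<otimes>\<^bsub>A\<^esub> s) (s \<otimes>\<^bsub>A\<^esub> t)) \<rparr>"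

section \<open>Integral closure and ideal class group\<close>

definition integral_closure :: "('a, 'm) ring_scheme \<Rightarrow> 'a set \<Rightarrow> 'a set" where
  "integral_closure L B =
     {x \<in> carrier L. \<exists>f \<in> carrier (univ_poly L B).
        f \<noteq> [] \<and> lead_coeff f = \<one>\<^bsub>L\<^esub> \<and> ring.eval L f x = \<zero>\<^bsub>L\<^esub>}"

text \<open>Below, \<open>R\<close> is (the carrier of) a subring of the field \<open>L\<close> whose field of fractions is \<open>L\<close>.
  The operation \<^const>\<open>ideal_prod\<close> on subsets of \<open>L\<close> forms all finite sums of products,
  so it is also the product of fractional ideals. When \<open>R\<close> is a Dedekind ring,
  the monoid of nonzero fractional ideals is a group.\<close>

definition fractional_ideals :: "('a, 'm) ring_scheme \<Rightarrow> 'a set \<Rightarrow> 'a set monoid" where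
  "fractional_ideals L R =
     \<lparr> carrier = {I. additive_subgroup I L \<and> (\<forall>r\<in>R. \<forall>x\<in>I. r \<otimes>\<^bsub>L\<^esub> x \<in> I) \<and> I \<noteq> {\<zero>\<^bsub>L\<^esub>} \<and>
                    (\<exists>d \<in> R - {\<zero>\<^bsub>L\<^esub>}. \<forall>x\<in>I. d \<otimes>\<^bsub>L\<^esub> x \<in> R)},
       monoid.mult = ideal_prod L,
       one = R \<rparr>"

definition principal_fractional_ideals :: "('a, 'm) ring_scheme \<Rightarrow> 'a set \<Rightarrow> 'a set set" where
  "principal_fractional_ideals L R = {x <#\<^bsub>L\<^esub> R | x. x \<in> carrier L - {\<zero>\<^bsub>L\<^esub>}}"

definition ideal_class_group :: "('a, 'm) ring_scheme \<Rightarrow> 'a set \<Rightarrow> 'a set set monoid" where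
  "ideal_class_group L R = fractional_ideals L R Mod principal_fractional_ideals L R"

definition class_number :: "('a, 'm) ring_scheme \<Rightarrow> 'a set \<Rightarrow> nat" where
  "class_number L R = order (ideal_class_group L R)"

section \<open>Quadratic function fields\<close>

abbreviation rational_function_field :: "('a, 'm) ring_scheme \<Rightarrow> ('a list \<times> 'a list) set ring" where
  "rational_function_field F \<equiv> fraction_field (poly_ring F)"

text \<open>The polynomial $X^2 - D$ over $F(T)$; coefficient lists start with the leading coefficient.\<close>

definition sqrt_poly :: "('a, 'm) ring_scheme \<Rightarrow> 'a list \<Rightarrow> ('a list \<times> 'a list) set list" where
  "sqrt_poly F D =
     (let K = rational_function_field F
      in [\<one>\<^bsub>K\<^esub>, \<zero>\<^bsub>K\<^esub>, \<ominus>\<^bsub>K\<^esub> (fraction (poly_ring F) D \<one>\<^bsub>poly_ring F\<^esub>)])"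

text \<open>$F(T)(\sqrt{D}) = F(T)[X]/(X^2 - D)$, a field whenever $D$ is not a square in $F(T)$.\<close>

definition quadratic_field ::
    "('a, 'm) ring_scheme \<Rightarrow> 'a list \<Rightarrow> ('a list \<times> 'a list) set list set ring" where
  "quadratic_field F D =
     (let K = rational_function_field F in rupture K (carrier K) (sqrt_poly F D))"

definition poly_embed ::
    "('a, 'm) ring_scheme \<Rightarrow> 'a list \<Rightarrow> 'a list \<Rightarrow> ('a list \<times> 'a list) set list set" where
  "poly_embed F D a =
     (let K = rational_function_field F
      in ring.rupture_surj K (carrier K) (sqrt_poly F D)
           (ring.poly_of_const K (fraction (poly_ring F) a \<one>\<^bsub>poly_ring F\<^esub>)))"

text \<open>The ring $F[T, \sqrt{D}]$ is, by convention, the integral closure of $F[T]$ in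
  $F(T)(\sqrt{D})$.\<close>

definition quadratic_ring ::
    "('a, 'm) ring_scheme \<Rightarrow> 'a list \<Rightarrow> ('a list \<times> 'a list) set list set set" where
  "quadratic_ring F D =
     integral_closure (quadratic_field F D) (poly_embed F D ` carrier (poly_ring F))"

definition quadratic_class_number :: "('a, 'm) ring_scheme \<Rightarrow> 'a list \<Rightarrow> nat" where
  "quadratic_class_number F D = class_number (quadratic_field F D) (quadratic_ring F D)"

definition nonsquare :: "('a, 'm) ring_scheme \<Rightarrow> 'a \<Rightarrow> bool" where
  "nonsquare F e \<longleftrightarrow> e \<in> carrier F \<and> (\<forall>x \<in> carrier F. x \<otimes>\<^bsub>F\<^esub> x \<noteq> e)"

definition monic_irreducible :: "('a, 'm) ring_scheme \<Rightarrow> 'a list \<Rightarrow> bool" where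
  "monic_irreducible F p \<longleftrightarrow>
     p \<in> carrier (poly_ring F) \<and> ring_irreducible\<^bsub>poly_ring F\<^esub> p \<and> lead_coeff p = \<one>\<^bsub>F\<^esub>"

abbreviation scale_poly :: "('a, 'm) ring_scheme \<Rightarrow> 'a \<Rightarrow> 'a list \<Rightarrow> 'a list" where
  "scale_poly F e p \<equiv> ring.poly_of_const F e \<otimes>\<^bsub>poly_ring F\<^esub> p"

text \<open>Every finite field has an isomorphic copy with carrier in \<^typ>\<open>nat\<close>, so quantifying over
  fields of type \<^typ>\<open>nat ring\<close> covers all finite fields, with a bound on the order that does
  not depend on a type.\<close>

lemma finite_field_nat_copy:
  fixes F :: "'a ring"
  assumes "field F" "finite (carrier F)"
  shows "\<exists>F' :: nat ring. field F' \<and> order F' = order F \<and> F \<simeq> F'"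
proof -
  interpret field F by fact
  obtain f :: "'a \<Rightarrow> nat" where f: "inj_on f (carrier F)"
    using assms(2) finite_imp_inj_to_nat_seg by metis
  have iso: "f \<in> ring_iso F (image_ring f F)"
    using inj_imp_image_ring_iso[OF f] .
  then show ?thesis
    using inj_imp_image_ring_is_field[OF f] f
    by (intro exI[of _ "image_ring f F"])
      (auto simp: order_def image_ring_carrier card_image is_ring_iso_def)
qed

end

theory Submission
  imports Defs "HOL-Library.Product_Plus" "HOL-Algebra.Algebraic_Closure_Type"
begin

text \<open>Let \<open>D = e p\<close> with \<open>p\<close> monic irreducible of degree \<open>k\<close> and \<open>e\<close> a nonsquare. Let \<open>a\<^sub>n\<close> be the number of ideals of
  index \<open>q\<^sup>n\<close> in \<open>F[T, \<surd>D]\<close>. For large \<open>n\<close>, each ideal class contributes \<open>1 \<plusminus> q\<^bsup>n+1-k/2\<^esup>\<close> to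
  \<open>a\<^sub>n - (q - 1) (a\<^sub>0 + \<dots> + a\<^sub>n\<^sub>-\<^sub>1)\<close>, with a sign that alternates with \<open>n\<close>, so that these quantities determine the
  class number. Counting ideals by quadratic symbols \<open>(f/p)\<close> expresses it as the alternating sum over
  \<open>j < k\<close> of the sums of \<open>(f/p)\<close> over monic \<open>f\<close> of degree \<open>j\<close>. Without the signs the sum is zero, so the class number is
  \<open>2 \<Sum> q\<^sup>j - 4 N\<close>, summed over even \<open>j < k\<close>, where \<open>N\<close> is the number of monic nonresidues of even degree
  below \<open>k\<close>. It remains to vary the parity of \<open>N\<close>.

  By a product formula of Carlitz, \<open>(-1)\<^sup>N\<close> is the quadratic character, in the field with \<open>q\<^sup>k\<close> elements, of the
  product of \<open>\<theta>\<^sub>j - \<theta>\<^sub>i\<close> over \<open>i < j < k\<close> with \<open>j\<close> even, where \<open>\<theta>\<^sub>i\<close> are the conjugates of a root \<open>\<theta>\<close> of \<open>p\<close>.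
  For \<open>\<theta> = \<zeta>\<^sup>2 + t \<zeta>\<close> with \<open>t \<in> F\<close> one has \<open>\<theta>\<^sub>j - \<theta>\<^sub>i = (\<zeta>\<^sub>j - \<zeta>\<^sub>i) (\<zeta>\<^sub>j + \<zeta>\<^sub>i + t)\<close>, so that \<open>(-1)\<^sup>N\<close> is, up to a
  constant, the quadratic character of \<open>f(t)\<close> in \<open>F\<close> for a polynomial \<open>f\<close> whose degree depends only on \<open>k\<close>.
  If the sums \<open>\<zeta>\<^sub>i + \<zeta>\<^sub>j\<close> are distinct, the root \<open>-(\<zeta>\<^sub>0 + \<zeta>\<^sub>1)\<close> of \<open>f\<close> has multiplicity \<open>k/2 - 1\<close>, which is odd.
  So \<open>f\<close> is not a constant times a square, and by Stepanov's method \<open>f(t)\<close> takes both square and nonsquare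
  values once \<open>q\<close> is large.\<close>

hide_const (open) Divisibility.prime Divisibility.irreducible

section \<open>Transfer between type classes and ring records\<close>

text \<open>The place at infinity is inert: deg p is even and e is a nonsquare, so u^2 and D v^2
  never cancel in a norm and every nonzero norm has even degree. The number of lattice elements of
  bounded norm is therefore a pure power of q that grows only at every second degree, which is the
  source of the alternating sign; as the total over all classes is eventually constant in n, the
  signs cancel there. The unsigned sum of symbols vanishes because the nonzero residues modulo p are
  constants times monic polynomials of lower degree, and constants are squares modulo p since k is
  even. The multiplicity k/2 - 1 arises as follows: the pairs i < j with j even that are cyclic
  translates of {0, 1} are those with i = j - 1, because the wrap-around pair {0, k - 1} has k - 1
  odd. Both class numbers use the same e and the same \<zeta>, so they differ by 4 times a
  difference of two values of N. An obstacle of form is that the definitions live in ring records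
  while polynomial arithmetic lives in type classes; the two are linked by isomorphisms of the kind
  defined here.\<close>

definition ring_rep :: "('r::comm_ring_1 \<Rightarrow> 'x) \<Rightarrow> ('x,'m) ring_scheme \<Rightarrow> bool" where
  "ring_rep \<phi> R \<longleftrightarrow> bij_betw \<phi> UNIV (carrier R) \<and> \<phi> 0 = \<zero>\<^bsub>R\<^esub> \<and> \<phi> 1 = \<one>\<^bsub>R\<^esub> \<and>
     (\<forall>x y. \<phi> (x + y) = \<phi> x \<oplus>\<^bsub>R\<^esub> \<phi> y \<and> \<phi> (x * y) = \<phi> x \<otimes>\<^bsub>R\<^esub> \<phi> y)"

lemma ring_repD:
  assumes "ring_rep \<phi> R"
  shows "\<phi> x \<in> carrier R" "\<phi> 0 = \<zero>\<^bsub>R\<^esub>" "\<phi> 1 = \<one>\<^bsub>R\<^esub>" "\<phi> (x + y) = \<phi> x \<oplus>\<^bsub>R\<^esub> \<phi> y"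
    "\<phi> (x * y) = \<phi> x \<otimes>\<^bsub>R\<^esub> \<phi> y" "\<phi> x = \<phi> y \<longleftrightarrow> x = y"
    "\<phi> x = \<zero>\<^bsub>R\<^esub> \<longleftrightarrow> x = 0" "c \<in> carrier R \<longleftrightarrow> (\<exists>x. c = \<phi> x)" "inj \<phi>" "range \<phi> = carrier R"
proof -
  have b: "bij_betw \<phi> UNIV (carrier R)" using assms by (simp add: ring_rep_def)
  show i: "inj \<phi>" "range \<phi> = carrier R" using b by (auto simp: bij_betw_def)
  then show "\<phi> x \<in> carrier R" "\<phi> x = \<phi> y \<longleftrightarrow> x = y" by (auto simp: inj_def)
  show z: "\<phi> 0 = \<zero>\<^bsub>R\<^esub>" "\<phi> 1 = \<one>\<^bsub>R\<^esub>" "\<phi> (x + y) = \<phi> x \<oplus>\<^bsub>R\<^esub> \<phi> y" "\<phi> (x * y) = \<phi> x \<otimes>\<^bsub>R\<^esub> \<phi> y"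
    using assms by (auto simp: ring_rep_def)
  show "\<phi> x = \<zero>\<^bsub>R\<^esub> \<longleftrightarrow> x = 0" using i unfolding z(1)[symmetric] by (auto simp: inj_def)
  show "c \<in> carrier R \<longleftrightarrow> (\<exists>x. c = \<phi> x)" using i by auto
qed

lemma ring_rep_cring:
  fixes \<phi> :: "'r::comm_ring_1 \<Rightarrow> 'x"
  assumes "ring_rep \<phi> R"
  shows "cring R"
proof -
  note r = ring_repD[OF assms]
  have "abelian_group R"
  proof (rule abelian_groupI)
    fix x assume "x \<in> carrier R"
    then obtain a where a: "x = \<phi> a" using r(8) by auto
    have "\<phi> (- a) \<oplus>\<^bsub>R\<^esub> x = \<zero>\<^bsub>R\<^esub>" unfolding a r(4)[symmetric] by (simp add: r)
    then show "\<exists>y\<in>carrier R. y \<oplus>\<^bsub>R\<^esub> x = \<zero>\<^bsub>R\<^esub>" using r(1) by blast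
  qed (auto simp: r(8) r(2-5)[symmetric] add_ac intro: arg_cong[of _ _ \<phi>])
  moreover have "Group.comm_monoid R"
    by (rule comm_monoidI) (auto simp: r(8) r(2-5)[symmetric] mult_ac intro: arg_cong[of _ _ \<phi>])
  moreover have "(x \<oplus>\<^bsub>R\<^esub> y) \<otimes>\<^bsub>R\<^esub> z = x \<otimes>\<^bsub>R\<^esub> z \<oplus>\<^bsub>R\<^esub> y \<otimes>\<^bsub>R\<^esub> z"
    if "x \<in> carrier R" "y \<in> carrier R" "z \<in> carrier R" for x y z
    using that by (auto simp: r(8) r(2-5)[symmetric] algebra_simps intro: arg_cong[of _ _ \<phi>])
  ultimately show ?thesis by (rule cringI)
qed

lemma ring_rep_field:
  fixes \<phi> :: "'r::{Fields.field} \<Rightarrow> 'x"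
  assumes "ring_rep \<phi> R"
  shows "field R"
proof -
  note r = ring_repD[OF assms]
  interpret cring R by (rule ring_rep_cring[OF assms])
  have "Units R = carrier R - {\<zero>\<^bsub>R\<^esub>}"
  proof (rule equalityI; rule subsetI)
    fix x assume x: "x \<in> carrier R - {\<zero>\<^bsub>R\<^esub>}"
    then obtain a where a: "x = \<phi> a" "a \<noteq> 0" using r(8,2) by auto
    then have "\<phi> (inverse a) \<otimes>\<^bsub>R\<^esub> x = \<one>\<^bsub>R\<^esub>" "x \<otimes>\<^bsub>R\<^esub> \<phi> (inverse a) = \<one>\<^bsub>R\<^esub>"
      by (simp_all add: r(3,5)[symmetric])
    then show "x \<in> Units R" using x r(1) by (auto simp: Units_def)
  next
    fix x assume x: "x \<in> Units R"
    have "\<one>\<^bsub>R\<^esub> \<noteq> \<zero>\<^bsub>R\<^esub>" using r(2,3) r(6)[of 0 1] by simp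
    then show "x \<in> carrier R - {\<zero>\<^bsub>R\<^esub>}" using x by (auto simp: Units_def)
  qed
  then show ?thesis by (rule cring_fieldI)
qed

lemma ring_rep_uminus:
  assumes "ring_rep \<phi> R"
  shows "\<phi> (- x) = \<ominus>\<^bsub>R\<^esub> \<phi> x"
proof -
  note r = ring_repD[OF assms]
  interpret cring R by (rule ring_rep_cring[OF assms])
  have "\<phi> (- x) \<oplus>\<^bsub>R\<^esub> \<phi> x = \<zero>\<^bsub>R\<^esub>" unfolding r(4)[symmetric] by (simp add: r)
  then show ?thesis using r(1) by (simp add: minus_equality)
qed

lemma ring_rep_sum:
  assumes "ring_rep \<phi> R" "finite A"
  shows "\<phi> (\<Sum>x\<in>A. f x) = (\<Oplus>\<^bsub>R\<^esub>x\<in>A. \<phi> (f x))"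
proof -
  note r = ring_repD[OF assms(1)]
  interpret cring R by (rule ring_rep_cring[OF assms(1)])
  show ?thesis using assms(2) by (induction A rule: finite_induct) (auto simp: r)
qed

text \<open>Record polynomials list the leading coefficient first, whereas \<open>coeffs\<close>
  starts with the constant term, hence \<open>rev\<close>; zero becomes the empty list on both
  sides.\<close>

definition list_rep :: "('r::comm_ring_1 \<Rightarrow> 'x) \<Rightarrow> 'r poly \<Rightarrow> 'x list" where
  "list_rep \<phi> p = map \<phi> (rev (coeffs p))"

lemma list_rep_length: "length (list_rep \<phi> p) = (if p = 0 then 0 else Suc (Polynomial.degree p))"
  by (simp add: list_rep_def length_coeffs)

lemma list_rep_coeff:
  assumes "ring_rep \<phi> R"
  shows "ring.coeff R (list_rep \<phi> p) i = \<phi> (poly.coeff p i)"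
proof -
  note r = ring_repD[OF assms]
  interpret cring R by (rule ring_rep_cring[OF assms])
  show ?thesis
  proof (cases "i < length (coeffs p)")
    case True
    have "ring.coeff R (list_rep \<phi> p) i = list_rep \<phi> p ! (length (list_rep \<phi> p) - 1 - i)"
      using True by (intro coeff_nth) (simp add: list_rep_def)
    also have "\<dots> = \<phi> (coeffs p ! i)"
      using True by (simp add: list_rep_def rev_nth)
    also have "coeffs p ! i = poly.coeff p i" using True by (simp add: nth_default_coeffs_eq[symmetric] nth_default_def)
    finally show ?thesis .
  next
    case False
    then have "ring.coeff R (list_rep \<phi> p) i = \<zero>\<^bsub>R\<^esub>"
      by (intro coeff_length) (simp add: list_rep_def)
    moreover have "poly.coeff p i = 0" using False by (simp add: nth_default_coeffs_eq[symmetric] nth_default_def)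
    ultimately show ?thesis by (simp add: r)
  qed
qed

lemma list_rep_carrier:
  assumes "ring_rep \<phi> R"
  shows "list_rep \<phi> p \<in> carrier (poly_ring R)" "set (list_rep \<phi> p) \<subseteq> carrier R"
    "polynomial\<^bsub>R\<^esub> (carrier R) (list_rep \<phi> p)"
proof -
  note r = ring_repD[OF assms]
  show s: "set (list_rep \<phi> p) \<subseteq> carrier R" by (auto simp: list_rep_def r)
  have "hd (list_rep \<phi> p) \<noteq> \<zero>\<^bsub>R\<^esub>" if "p \<noteq> 0"
  proof -
    have "hd (list_rep \<phi> p) = \<phi> (Polynomial.lead_coeff p)"
      using that by (simp add: list_rep_def hd_map hd_rev last_coeffs_eq_coeff_degree)
    then show ?thesis using that by (simp add: r)
  qed
  then show "polynomial\<^bsub>R\<^esub> (carrier R) (list_rep \<phi> p)"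
    using s by (cases "p = 0") (auto simp: polynomial_def list_rep_def)
  then show "list_rep \<phi> p \<in> carrier (poly_ring R)" by (simp add: univ_poly_carrier)
qed

text \<open>Normalized coefficient lists are determined by their coefficient functions
  (\<open>eqI\<close>), so each ring operation is compared coefficient by coefficient.\<close>

lemma ring_rep_poly:
  fixes \<phi> :: "'r::comm_ring_1 \<Rightarrow> 'x"
  assumes "ring_rep \<phi> R"
  shows "ring_rep (list_rep \<phi>) (poly_ring R)"
proof -
  note r = ring_repD[OF assms] and c = list_rep_carrier[OF assms] and k = list_rep_coeff[OF assms]
  interpret cring R by (rule ring_rep_cring[OF assms])
  have eqI: "p1 = list_rep \<phi> p" if "polynomial\<^bsub>R\<^esub> (carrier R) p1"
    "\<And>i. ring.coeff R p1 i = \<phi> (poly.coeff p i)" for p1 p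
    using coeff_iff_polynomial_cond[OF that(1) c(3)] that(2) k by (auto simp: fun_eq_iff)
  have "inj (list_rep \<phi>)"
  proof (rule injI)
    fix p q assume "list_rep \<phi> p = list_rep \<phi> q"
    then have "\<phi> (poly.coeff p i) = \<phi> (poly.coeff q i)" for i using k by metis
    then show "p = q" using r(6) by (auto simp: poly_eq_iff)
  qed
  moreover have "carrier (poly_ring R) \<subseteq> range (list_rep \<phi>)"
  proof
    fix xs assume "xs \<in> carrier (poly_ring R)"
    then have xs: "polynomial\<^bsub>R\<^esub> (carrier R) xs" by (simp add: univ_poly_carrier)
    define p where "p = Poly (map (inv_into UNIV \<phi>) (rev xs))"
    have sx: "set xs \<subseteq> carrier R" using polynomial_incl[OF xs] .
    have "xs = list_rep \<phi> p"
    proof (rule eqI[OF xs])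
      fix i
      show "ring.coeff R xs i = \<phi> (poly.coeff p i)"
      proof (cases "i < length xs")
        case True
        then have "poly.coeff p i = inv_into UNIV \<phi> (rev xs ! i)" by (simp add: p_def nth_default_def)
        moreover have "rev xs ! i \<in> carrier R" using True sx nth_mem[of i "rev xs"] by auto
        ultimately have "\<phi> (poly.coeff p i) = rev xs ! i" using r(10) f_inv_into_f[of "rev xs ! i" \<phi> UNIV] by simp
        then show ?thesis using True coeff_nth[OF True] by (simp add: rev_nth)
      next
        case False
        then show ?thesis using coeff_length[of xs i] by (simp add: p_def nth_default_def r)
      qed
    qed
    then show "xs \<in> range (list_rep \<phi>)" by blast
  qed
  moreover have "list_rep \<phi> (p + q) = list_rep \<phi> p \<oplus>\<^bsub>poly_ring R\<^esub> list_rep \<phi> q" for p q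
  proof (rule eqI[symmetric])
    have "list_rep \<phi> p \<oplus>\<^bsub>poly_ring R\<^esub> list_rep \<phi> q = poly_add (list_rep \<phi> p) (list_rep \<phi> q)"
      by (simp add: univ_poly_add)
    then show "polynomial\<^bsub>R\<^esub> (carrier R) (list_rep \<phi> p \<oplus>\<^bsub>poly_ring R\<^esub> list_rep \<phi> q)"
      using poly_add_is_polynomial[OF carrier_is_subring c(2) c(2)] by simp
    show "coeff (list_rep \<phi> p \<oplus>\<^bsub>poly_ring R\<^esub> list_rep \<phi> q) i = \<phi> (poly.coeff (p + q) i)" for i
      by (simp add: univ_poly_add poly_add_coeff[OF c(2) c(2)] k r del: poly_add.simps)
  qed
  moreover have "list_rep \<phi> (p * q) = list_rep \<phi> p \<otimes>\<^bsub>poly_ring R\<^esub> list_rep \<phi> q" for p q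
  proof (rule eqI[symmetric])
    have "list_rep \<phi> p \<otimes>\<^bsub>poly_ring R\<^esub> list_rep \<phi> q = poly_mult (list_rep \<phi> p) (list_rep \<phi> q)"
      by (simp add: univ_poly_mult)
    then show "polynomial\<^bsub>R\<^esub> (carrier R) (list_rep \<phi> p \<otimes>\<^bsub>poly_ring R\<^esub> list_rep \<phi> q)"
      using poly_mult_is_polynomial[OF carrier_is_subring c(2) c(2)] by simp
    show "coeff (list_rep \<phi> p \<otimes>\<^bsub>poly_ring R\<^esub> list_rep \<phi> q) i = \<phi> (poly.coeff (p * q) i)" for i
      by (simp add: univ_poly_mult poly_mult_coeff[OF c(2) c(2)] k r(5)[symmetric] coeff_mult
          ring_rep_sum[OF assms])
  qed
  moreover have "list_rep \<phi> 1 = \<one>\<^bsub>poly_ring R\<^esub>"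
    by (simp add: list_rep_def univ_poly_one r)
  moreover have "list_rep \<phi> 0 = \<zero>\<^bsub>poly_ring R\<^esub>"
    by (simp add: list_rep_def univ_poly_zero)
  ultimately show ?thesis
    using c(1) by (auto simp: ring_rep_def bij_betw_def)
qed

lemma list_rep_const:
  assumes "ring_rep \<phi> R"
  shows "list_rep \<phi> [:c:] = ring.poly_of_const R (\<phi> c)"
proof -
  note r = ring_repD[OF assms]
  interpret cring R by (rule ring_rep_cring[OF assms])
  show ?thesis using r by (auto simp: list_rep_def poly_of_const_def)
qed

lemma fraction_rep:
  fixes \<phi> :: "'r::idom \<Rightarrow> 'x"
  assumes "ring_rep \<phi> A" "s \<noteq> 0"
  shows "fraction A (\<phi> a) (\<phi> s) = {(\<phi> b, \<phi> t) | b t. t \<noteq> 0 \<and> a * t = b * s}"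
proof -
  note r = ring_repD[OF assms(1)]
  have "(((\<phi> a, \<phi> s), z) \<in> frac_rel A) \<longleftrightarrow> (\<exists>b t. z = (\<phi> b, \<phi> t) \<and> t \<noteq> 0 \<and> a * t = b * s)" for z
  proof -
    have "(((\<phi> a, \<phi> s), z) \<in> frac_rel A) \<longleftrightarrow>
        (\<exists>b t. z = (b, t) \<and> b \<in> carrier A \<and> t \<in> carrier A - {\<zero>\<^bsub>A\<^esub>} \<and> \<phi> a \<otimes>\<^bsub>A\<^esub> t = b \<otimes>\<^bsub>A\<^esub> \<phi> s)"
      using r(1) r(7) assms(2) by (auto simp: frac_rel_def)
    also have "\<dots> \<longleftrightarrow> (\<exists>b t. z = (\<phi> b, \<phi> t) \<and> t \<noteq> 0 \<and> a * t = b * s)"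
      by (auto simp: r(8) r(7) r(5)[symmetric] r(6))
    finally show ?thesis .
  qed
  then show ?thesis unfolding fraction_def by auto
qed

lemma fraction_eq_iff:
  fixes \<phi> :: "'r::idom \<Rightarrow> 'x"
  assumes "ring_rep \<phi> A" "s \<noteq> 0" "t \<noteq> 0"
  shows "fraction A (\<phi> a) (\<phi> s) = fraction A (\<phi> b) (\<phi> t) \<longleftrightarrow> a * t = b * s"
proof
  note r = ring_repD[OF assms(1)]
  assume "fraction A (\<phi> a) (\<phi> s) = fraction A (\<phi> b) (\<phi> t)"
  moreover have "(\<phi> b, \<phi> t) \<in> fraction A (\<phi> b) (\<phi> t)"
    using fraction_rep[OF assms(1,3)] assms(3) by auto
  ultimately have "(\<phi> b, \<phi> t) \<in> {(\<phi> b, \<phi> t) | b t. t \<noteq> 0 \<and> a * t = b * s}"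
    unfolding fraction_rep[OF assms(1,2)] by simp
  then show "a * t = b * s" by (auto simp: r(6))
next
  assume e: "a * t = b * s"
  have "a * u = c * s \<longleftrightarrow> b * u = c * t" for c u
  proof -
    have "t * (a * u) = (a * t) * u" by (simp only: mult_ac)
    also have "\<dots> = (b * s) * u" by (simp only: e)
    also have "\<dots> = s * (b * u)" by (simp only: mult_ac)
    finally have "t * (a * u) = s * (b * u)" .
    moreover have "t * (c * s) = s * (c * t)" by (simp only: mult_ac)
    ultimately have "t * (a * u) = t * (c * s) \<longleftrightarrow> s * (b * u) = s * (c * t)" by (simp only:)
    then show ?thesis using mult_left_cancel[OF assms(3)] mult_left_cancel[OF assms(2)] by metis
  qed
  then show "fraction A (\<phi> a) (\<phi> s) = fraction A (\<phi> b) (\<phi> t)"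
    unfolding fraction_rep[OF assms(1,2)] fraction_rep[OF assms(1,3)] by simp
qed

text \<open>A representing pair is picked by \<open>SOME\<close>; \<open>fract_rep_Fract\<close>
  shows that the choice does not matter.\<close>

definition fract_rep :: "('r::idom \<Rightarrow> 'x) \<Rightarrow> ('x,'m) ring_scheme \<Rightarrow> 'r fract \<Rightarrow> ('x \<times> 'x) set" where
  "fract_rep \<phi> A x = fraction A (\<phi> (fst (SOME z. snd z \<noteq> 0 \<and> x = Fract (fst z) (snd z))))
      (\<phi> (snd (SOME z. snd z \<noteq> 0 \<and> x = Fract (fst z) (snd z))))"

lemma fract_rep_Fract:
  fixes \<phi> :: "'r::idom \<Rightarrow> 'x"
  assumes "ring_rep \<phi> A" "b \<noteq> 0"
  shows "fract_rep \<phi> A (Fract a b) = fraction A (\<phi> a) (\<phi> b)"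
proof -
  define z where "z = (SOME z. snd z \<noteq> 0 \<and> Fract a b = Fract (fst z) (snd z))"
  have "snd z \<noteq> 0 \<and> Fract a b = Fract (fst z) (snd z)"
    unfolding z_def by (rule someI[of _ "(a, b)"]) (simp add: assms)
  then have "snd z \<noteq> 0" "a * snd z = fst z * b" using assms(2) by (auto simp: eq_fract)
  then show ?thesis
    unfolding fract_rep_def z_def[symmetric] using assms by (simp add: fraction_eq_iff)
qed

lemma ring_rep_fract:
  fixes \<phi> :: "'r::idom \<Rightarrow> 'x"
  assumes "ring_rep \<phi> A"
  shows "ring_rep (fract_rep \<phi> A) (fraction_field A)"
proof -
  note r = ring_repD[OF assms] and F = fract_rep_Fract[OF assms] and e = fraction_eq_iff[OF assms]
    and fr = fraction_rep[OF assms]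
  let ?\<Phi> = "fract_rep \<phi> A"
  have inj: "inj ?\<Phi>"
  proof (rule injI)
    fix x y assume "?\<Phi> x = ?\<Phi> y"
    then show "x = y" by (cases x; cases y) (auto simp: F e eq_fract)
  qed
  have rng: "range ?\<Phi> = carrier (fraction_field A)"
  proof (rule equalityI; rule subsetI)
    fix z assume "z \<in> range ?\<Phi>"
    then obtain x where x: "z = ?\<Phi> x" by blast
    obtain a b where "x = Fract a b" "b \<noteq> 0" by (cases x)
    then have ab: "b \<noteq> 0" "z = fraction A (\<phi> a) (\<phi> b)" using F x by auto
    then show "z \<in> carrier (fraction_field A)"
      using r(1) r(7) by (auto simp: fraction_field_def fraction_def intro!: quotientI)
  next
    fix z assume "z \<in> carrier (fraction_field A)"
    then obtain a b where "a \<in> carrier A" "b \<in> carrier A" "b \<noteq> \<zero>\<^bsub>A\<^esub>" "z = fraction A a b"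
      by (auto simp: fraction_field_def fraction_def elim!: quotientE)
    moreover obtain a' b' where "a = \<phi> a'" "b = \<phi> b'" using calculation r(8) by metis
    ultimately have "b' \<noteq> 0" "z = fraction A (\<phi> a') (\<phi> b')" using r(7) by auto
    then have "z = ?\<Phi> (Fract a' b')" using F by simp
    then show "z \<in> range ?\<Phi>" by blast
  qed
  have mem: "(\<phi> a, \<phi> s) \<in> fraction A (\<phi> a) (\<phi> s)" if "s \<noteq> 0" for a s
    using that fr by auto
  have add: "?\<Phi> (x + y) = ?\<Phi> x \<oplus>\<^bsub>fraction_field A\<^esub> ?\<Phi> y" for x y
  proof -
    obtain a s where x: "x = Fract a s" "s \<noteq> 0" by (cases x) auto
    obtain b t where y: "y = Fract b t" "t \<noteq> 0" by (cases y) auto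
    \<comment> \<open>Addition in the record is a union over all pairs of representatives. Every
      pair yields the same class, and by \<open>mem\<close> there is at least one pair, so the union
      is that class.\<close>
    have "fraction A (a' \<otimes>\<^bsub>A\<^esub> t' \<oplus>\<^bsub>A\<^esub> b' \<otimes>\<^bsub>A\<^esub> s') (s' \<otimes>\<^bsub>A\<^esub> t') = fraction A (\<phi> (a * t + b * s)) (\<phi> (s * t))"
      if h: "(a', s') \<in> fraction A (\<phi> a) (\<phi> s)" "(b', t') \<in> fraction A (\<phi> b) (\<phi> t)" for a' s' b' t'
    proof -
      obtain a1 s1 where 1: "a' = \<phi> a1" "s' = \<phi> s1" "s1 \<noteq> 0" "a * s1 = a1 * s" using h(1) unfolding fr[OF x(2)] by auto
      obtain b1 t1 where 2: "b' = \<phi> b1" "t' = \<phi> t1" "t1 \<noteq> 0" "b * t1 = b1 * t" using h(2) unfolding fr[OF y(2)] by auto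
      have "(a1 * t1 + b1 * s1) * (s * t) = (a1 * s) * (t * t1) + (b1 * t) * (s * s1)"
        by (simp only: algebra_simps)
      also have "\<dots> = (a * t + b * s) * (s1 * t1)"
        unfolding 1(4)[symmetric] 2(4)[symmetric] by (simp only: algebra_simps)
      finally have "(a1 * t1 + b1 * s1) * (s * t) = (a * t + b * s) * (s1 * t1)" .
      then show ?thesis unfolding 1 2 r(4,5)[symmetric] using 1 2 x y by (simp add: e)
    qed
    then have "?\<Phi> x \<oplus>\<^bsub>fraction_field A\<^esub> ?\<Phi> y = fraction A (\<phi> (a * t + b * s)) (\<phi> (s * t))"
      unfolding x(1) y(1) F[OF x(2)] F[OF y(2)] using mem[OF x(2), of a] mem[OF y(2), of b]
      by (fastforce simp: fraction_field_def)
    then show ?thesis using x y by (simp add: F)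
  qed
  have mult: "?\<Phi> (x * y) = ?\<Phi> x \<otimes>\<^bsub>fraction_field A\<^esub> ?\<Phi> y" for x y
  proof -
    obtain a s where x: "x = Fract a s" "s \<noteq> 0" by (cases x) auto
    obtain b t where y: "y = Fract b t" "t \<noteq> 0" by (cases y) auto
    have "fraction A (a' \<otimes>\<^bsub>A\<^esub> b') (s' \<otimes>\<^bsub>A\<^esub> t') = fraction A (\<phi> (a * b)) (\<phi> (s * t))"
      if h: "(a', s') \<in> fraction A (\<phi> a) (\<phi> s)" "(b', t') \<in> fraction A (\<phi> b) (\<phi> t)" for a' s' b' t'
    proof -
      obtain a1 s1 where 1: "a' = \<phi> a1" "s' = \<phi> s1" "s1 \<noteq> 0" "a * s1 = a1 * s" using h(1) unfolding fr[OF x(2)] by auto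
      obtain b1 t1 where 2: "b' = \<phi> b1" "t' = \<phi> t1" "t1 \<noteq> 0" "b * t1 = b1 * t" using h(2) unfolding fr[OF y(2)] by auto
      have "(a1 * b1) * (s * t) = (a1 * s) * (b1 * t)" by (simp only: mult_ac)
      also have "\<dots> = (a * b) * (s1 * t1)"
        unfolding 1(4)[symmetric] 2(4)[symmetric] by (simp only: mult_ac)
      finally have "(a1 * b1) * (s * t) = (a * b) * (s1 * t1)" .
      then show ?thesis unfolding 1 2 r(4,5)[symmetric] using 1 2 x y by (simp add: e)
    qed
    then have "?\<Phi> x \<otimes>\<^bsub>fraction_field A\<^esub> ?\<Phi> y = fraction A (\<phi> (a * b)) (\<phi> (s * t))"
      unfolding x(1) y(1) F[OF x(2)] F[OF y(2)] using mem[OF x(2), of a] mem[OF y(2), of b]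
      by (fastforce simp: fraction_field_def)
    then show ?thesis using x y by (simp add: F)
  qed
  have "?\<Phi> 0 = \<zero>\<^bsub>fraction_field A\<^esub>" "?\<Phi> 1 = \<one>\<^bsub>fraction_field A\<^esub>"
    using F[of 1 0] F[of 1 1] by (simp_all add: fraction_field_def r Zero_fract_def One_fract_def)
  then show ?thesis using inj rng add mult by (simp add: ring_rep_def bij_betw_def)
qed

text \<open>The rupture ring consists of cosets of the principal ideal of m. Composing with
  \<open>list_rep\<close> replaces them by residues of type class polynomials, with divisibility by
  m as the only relation.\<close>

lemma rupture_rep:
  fixes \<kappa> :: "'k::Fields.field \<Rightarrow> 'x" and m :: "'k poly"
  assumes "ring_rep \<kappa> K"
  defines "L \<equiv> rupture K (carrier K) (list_rep \<kappa> m)"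
    and "\<psi> \<equiv> (\<lambda>f. ring.rupture_surj K (carrier K) (list_rep \<kappa> m) (list_rep \<kappa> f))"
  shows "cring L" "carrier L = range \<psi>" "\<psi> 0 = \<zero>\<^bsub>L\<^esub>" "\<psi> 1 = \<one>\<^bsub>L\<^esub>"
    "\<psi> (f + g) = \<psi> f \<oplus>\<^bsub>L\<^esub> \<psi> g" "\<psi> (f * g) = \<psi> f \<otimes>\<^bsub>L\<^esub> \<psi> g" "\<psi> f = \<psi> g \<longleftrightarrow> m dvd f - g"
proof -
  let ?U = "poly_ring K"
  interpret K: field K by (rule ring_rep_field[OF assms(1)])
  note P = ring_repD[OF ring_rep_poly[OF assms(1)]]
  interpret U: cring ?U by (rule ring_rep_cring[OF ring_rep_poly[OF assms(1)]])
  let ?I = "PIdl\<^bsub>?U\<^esub> (list_rep \<kappa> m)"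
  interpret I: ideal ?I ?U by (rule U.cgenideal_ideal[OF P(1)])
  have hom: "ring_hom_ring ?U L (\<lambda>q. ?I +>\<^bsub>?U\<^esub> q)"
    unfolding L_def by (rule K.rupture_surj_hom(2)[OF K.carrier_is_subring P(1)])
  interpret h: ring_hom_ring ?U L "\<lambda>q. ?I +>\<^bsub>?U\<^esub> q" by (rule hom)
  show cr: "cring L"
    unfolding L_def rupture_def by (rule I.quotient_is_cring[OF U.cring_axioms])
  show "carrier L = range \<psi>"
    unfolding L_def \<psi>_def rupture_def FactRing_def A_RCOSETS_def' using P(8) by auto
  show "\<psi> 0 = \<zero>\<^bsub>L\<^esub>" unfolding \<psi>_def P(2) by (rule h.hom_zero)
  show "\<psi> 1 = \<one>\<^bsub>L\<^esub>" unfolding \<psi>_def P(3) by (rule h.hom_one)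
  show "\<psi> (f + g) = \<psi> f \<oplus>\<^bsub>L\<^esub> \<psi> g" for f g
    unfolding \<psi>_def P(4) by (rule h.hom_add[OF P(1) P(1)])
  show "\<psi> (f * g) = \<psi> f \<otimes>\<^bsub>L\<^esub> \<psi> g" for f g
    unfolding \<psi>_def P(5) by (rule h.hom_mult[OF P(1) P(1)])
  have z: "\<psi> f = \<zero>\<^bsub>L\<^esub> \<longleftrightarrow> m dvd f" for f
  proof -
    have "\<psi> f = \<zero>\<^bsub>L\<^esub> \<longleftrightarrow> ?I +>\<^bsub>?U\<^esub> list_rep \<kappa> f = ?I"
      unfolding \<psi>_def L_def rupture_def FactRing_def by simp
    also have "\<dots> \<longleftrightarrow> list_rep \<kappa> f \<in> ?I"
      using I.a_rcos_self[OF P(1)] I.a_rcos_const by metis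
    also have "\<dots> \<longleftrightarrow> (\<exists>g. list_rep \<kappa> f = list_rep \<kappa> g \<otimes>\<^bsub>?U\<^esub> list_rep \<kappa> m)"
      unfolding cgenideal_def using P(8) by auto
    also have "\<dots> \<longleftrightarrow> m dvd f" unfolding P(5)[symmetric] P(6) dvd_def by (auto simp: mult.commute)
    finally show ?thesis .
  qed
  interpret L: cring L by (rule cr)
  have c: "\<psi> f \<in> carrier L" for f unfolding \<psi>_def by (rule h.hom_closed[OF P(1)])
  have "\<psi> (f - g) \<oplus>\<^bsub>L\<^esub> \<psi> g = \<psi> f" for f g
    unfolding \<psi>_def using h.hom_add[OF P(1) P(1)] P(4)[of "f - g" g] by simp
  then have "\<psi> f = \<psi> g \<longleftrightarrow> \<psi> (f - g) = \<zero>\<^bsub>L\<^esub>" for f g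
    using c by (metis h.S.add.right_cancel h.S.l_zero h.S.zero_closed)
  then show "\<psi> f = \<psi> g \<longleftrightarrow> m dvd f - g" for f g using z by simp
qed

text \<open>An embedding \<open>\<Psi>\<close> of the order \<open>A[\<surd>D]\<close>, with \<open>A\<close> the polynomial ring,
  written as pairs \<open>u + v \<surd>D\<close>, into its fraction field \<open>L\<close>.\<close>

locale quadratic_embedding = L: cring L
  for L :: "('x, 'm) ring_scheme" (structure) +
  fixes \<Psi> :: "'a::{finite_field,field_gcd} poly \<times> 'a poly \<Rightarrow> 'x" and D :: "'a poly"
  assumes closed: "\<Psi> z \<in> carrier L"
    and inj: "\<Psi> z = \<Psi> w \<longleftrightarrow> z = w"
    and add: "\<Psi> (u1 + u2, v1 + v2) = \<Psi> (u1, v1) \<oplus> \<Psi> (u2, v2)"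
    and mult: "\<Psi> (u1 * u2 + D * (v1 * v2), u1 * v2 + v1 * u2) = \<Psi> (u1, v1) \<otimes> \<Psi> (u2, v2)"
    and one: "\<Psi> (1, 0) = \<one>"
    and unit: "c \<noteq> 0 \<Longrightarrow> \<Psi> (c, 0) \<in> Units L"
    and frac: "x \<in> carrier L \<Longrightarrow> \<exists>u v w. w \<noteq> 0 \<and> \<Psi> (w, 0) \<otimes> x = \<Psi> (u, v)"

text \<open>A multiple of X^2 - D of degree below 2 is zero (\<open>lin\<close>), which gives
  injectivity on the pairs; reducing an arbitrary residue to degree below 2 and clearing the two
  denominators gives the fraction property.\<close>

lemma quadratic_field_embedding:
  fixes \<phi> :: "'a::{finite_field,field_gcd} \<Rightarrow> 'x" and D :: "'a poly"
  assumes "ring_rep \<phi> F"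
  defines "D' \<equiv> list_rep \<phi> D"
  shows "\<exists>\<Psi>. quadratic_embedding (quadratic_field F D') \<Psi> D \<and>
    (\<forall>a. poly_embed F D' (list_rep \<phi> a) = \<Psi> (a, 0))"
proof -
  let ?\<kappa> = "fract_rep (list_rep \<phi>) (poly_ring F)"
  let ?K = "fraction_field (poly_ring F)"
  let ?m = "[:- Fract D 1, 0, 1:]"
  note pr = ring_rep_poly[OF assms(1)]
  note kr = ring_rep_fract[OF pr]
  note P = ring_repD[OF pr] and K = ring_repD[OF kr]
  have emb: "?\<kappa> (Fract a 1) = fraction (poly_ring F) (list_rep \<phi> a) \<one>\<^bsub>poly_ring F\<^esub>" for a
    using fract_rep_Fract[OF pr, of 1 a] P(3) by simp
  have sq: "sqrt_poly F D' = list_rep ?\<kappa> ?m"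
    unfolding sqrt_poly_def Let_def D'_def emb[symmetric] ring_rep_uminus[OF kr, symmetric]
    by (simp add: list_rep_def K)
  define L where "L = quadratic_field F D'"
  define \<psi> where "\<psi> = (\<lambda>f. ring.rupture_surj ?K (carrier ?K) (sqrt_poly F D') (list_rep ?\<kappa> f))"
  have \<psi>f: "\<psi> f = ring.rupture_surj ?K (carrier ?K) (sqrt_poly F D') (list_rep ?\<kappa> f)" for f
    by (simp add: \<psi>_def)
  note R = rupture_rep[OF kr, where m = ?m, folded sq, folded \<psi>f]
  have L: "L = rupture ?K (carrier ?K) (sqrt_poly F D')"
    by (simp add: L_def quadratic_field_def Let_def)
  note R = R[folded L]
  interpret L: cring L by (rule R(1))
  define \<Psi> where "\<Psi> = (\<lambda>(u, v). \<psi> [:Fract u 1, Fract v 1:])"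
  have cl: "\<psi> f \<in> carrier L" for f using R(2) by auto
  have frac0: "Fract x 1 = 0 \<longleftrightarrow> x = 0" for x :: "'a poly" by (simp add: Zero_fract_def eq_fract)
  have lin: "?m dvd [:x, y:] \<longleftrightarrow> x = 0 \<and> y = 0" for x y
  proof
    assume d: "?m dvd [:x, y:]"
    show "x = 0 \<and> y = 0"
    proof (rule ccontr)
      assume "\<not> (x = 0 \<and> y = 0)"
      then have "Polynomial.degree ?m \<le> Polynomial.degree [:x, y:]" using d by (intro dvd_imp_degree_le) auto
      then show False by (auto split: if_splits)
    qed
  qed simp
  have minj: "\<psi> [:x, y:] = \<psi> [:x', y':] \<longleftrightarrow> x = x' \<and> y = y'" for x y x' y'
    using R(7)[of "[:x, y:]" "[:x', y':]"] lin[of "x - x'" "y - y'"] by simp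
  have mul: "\<psi> ([:x, y:] * [:x', y':]) = \<psi> [:x * x' + Fract D 1 * (y * y'), x * y' + y * x':]" for x y x' y'
  proof -
    have "[:x, y:] * [:x', y':] - [:x * x' + Fract D 1 * (y * y'), x * y' + y * x':] = ?m * [:y * y':]"
      by (simp add: algebra_simps del: minus_fract)
    then show ?thesis using R(7) by (metis dvd_triv_left)
  qed
  have "quadratic_embedding L \<Psi> D"
  proof
    show "\<Psi> z \<in> carrier L" for z by (cases z) (simp add: \<Psi>_def cl)
    show "\<Psi> z = \<Psi> w \<longleftrightarrow> z = w" for z w by (cases z; cases w) (simp add: \<Psi>_def minj eq_fract)
    show "\<Psi> (u1 + u2, v1 + v2) = \<Psi> (u1, v1) \<oplus>\<^bsub>L\<^esub> \<Psi> (u2, v2)" for u1 u2 v1 v2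
      by (simp add: \<Psi>_def R(5)[symmetric])
    show "\<Psi> (u1 * u2 + D * (v1 * v2), u1 * v2 + v1 * u2) = \<Psi> (u1, v1) \<otimes>\<^bsub>L\<^esub> \<Psi> (u2, v2)" for u1 u2 v1 v2
      by (simp add: \<Psi>_def R(6)[symmetric] mul del: mult_pCons_left mult_pCons_right)
    show "\<Psi> (1, 0) = \<one>\<^bsub>L\<^esub>"
      unfolding \<Psi>_def R(4)[symmetric] One_fract_def[symmetric] Zero_fract_def[symmetric]
      by (simp add: One_fract_def[symmetric] Zero_fract_def[symmetric] flip: one_pCons)
    have prod: "\<Psi> (w, 0) \<otimes>\<^bsub>L\<^esub> \<psi> [:x, y:] = \<psi> [:Fract w 1 * x, Fract w 1 * y:]" for w x y
      by (simp add: \<Psi>_def R(6)[symmetric] Zero_fract_def[symmetric] mult.commute)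
    show "\<Psi> (w, 0) \<in> Units L" if "w \<noteq> 0" for w
    proof -
      have "\<Psi> (w, 0) \<otimes>\<^bsub>L\<^esub> \<psi> [:Fract 1 w, 0:] = \<one>\<^bsub>L\<^esub>"
      proof -
        have "Fract w 1 * Fract 1 w = 1" using that by (simp add: One_fract_def eq_fract)
        then show ?thesis unfolding prod R(4)[symmetric] by (simp add: one_pCons)
      qed
      then show ?thesis using cl by (auto simp: Units_def \<Psi>_def L.m_comm intro!: exI[of _ "\<psi> [:Fract 1 w, 0:]"])
    qed
    show "\<exists>u v w. w \<noteq> 0 \<and> \<Psi> (w, 0) \<otimes>\<^bsub>L\<^esub> x = \<Psi> (u, v)" if "x \<in> carrier L" for x
    proof -
      obtain f where f: "x = \<psi> f" using \<open>x \<in> carrier L\<close> R(2) by auto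
      define r where "r = f mod ?m"
      have "x = \<psi> r" unfolding f r_def R(7) minus_mod_eq_mult_div by (rule dvd_triv_left)
      have "r = 0 \<or> Polynomial.degree r < 2"
        using degree_mod_less[of ?m f] by (auto simp: r_def)
      then have "r = [:poly.coeff r 0, poly.coeff r 1:]"
        by (intro poly_eqI) (auto simp: coeff_pCons coeff_eq_0 split: nat.splits)
      then obtain y z where r: "r = [:y, z:]" by blast
      obtain a s where y: "y = Fract a s" "s \<noteq> 0" by (cases y) auto
      obtain b t where z: "z = Fract b t" "t \<noteq> 0" by (cases z) auto
      have "\<Psi> (s * t, 0) \<otimes>\<^bsub>L\<^esub> x = \<Psi> (a * t, b * s)"
        unfolding \<open>x = \<psi> r\<close> r prod using y z by (simp add: \<Psi>_def minj eq_fract)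
      then show ?thesis using y z by (metis mult_eq_0_iff)
    qed
  qed
  moreover have "poly_embed F D' (list_rep \<phi> a) = \<Psi> (a, 0)" for a
    unfolding poly_embed_def Let_def emb[symmetric] list_rep_const[OF kr, symmetric]
    by (simp add: \<Psi>_def \<psi>_def Zero_fract_def[symmetric])
  ultimately show ?thesis unfolding L_def by blast
qed

section \<open>Orders in quadratic fields\<close>

text \<open>A pair \<open>(u, v)\<close> stands for \<open>u + v \<surd>D\<close>.\<close>

definition qmul :: "'a::comm_ring_1 \<Rightarrow> 'a \<times> 'a \<Rightarrow> 'a \<times> 'a \<Rightarrow> 'a \<times> 'a" where
  "qmul D z w = (fst z * fst w + D * (snd z * snd w), fst z * snd w + snd z * fst w)"

definition qconj :: "'a::comm_ring_1 \<times> 'a \<Rightarrow> 'a \<times> 'a" where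
  "qconj z = (fst z, - snd z)"

definition qnorm :: "'a::comm_ring_1 \<Rightarrow> 'a \<times> 'a \<Rightarrow> 'a" where
  "qnorm D z = fst z ^ 2 - D * snd z ^ 2"

definition qpow :: "'a::comm_ring_1 \<Rightarrow> 'a \<times> 'a \<Rightarrow> nat \<Rightarrow> 'a \<times> 'a" where
  "qpow D z n = (qmul D z ^^ n) (1, 0)"

lemma qmul_comm: "qmul D z w = qmul D w z"
  by (simp add: qmul_def algebra_simps)

lemma qmul_assoc: "qmul D (qmul D x y) z = qmul D x (qmul D y z)"
  by (simp add: qmul_def algebra_simps)

lemma qmul_left_comm: "qmul D x (qmul D y z) = qmul D y (qmul D x z)"
  by (simp add: qmul_def algebra_simps)

lemmas qmul_ac = qmul_assoc qmul_comm qmul_left_comm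

lemma qmul_add: "qmul D x (y + z) = qmul D x y + qmul D x z" "qmul D (x + y) z = qmul D x z + qmul D y z"
  by (simp_all add: qmul_def algebra_simps)

lemma qmul_simps [simp]: "qmul D (1, 0) z = z" "qmul D z (1, 0) = z" "qmul D 0 z = 0" "qmul D z 0 = 0"
  "qmul D (a, 0) (b, 0) = (a * b, 0)" "qmul D (a, 0) (b, c) = (a * b, a * c)"
  by (simp_all add: qmul_def zero_prod_def)

lemma qconj_mult: "qconj (qmul D z w) = qmul D (qconj z) (qconj w)"
  by (simp add: qmul_def qconj_def)

lemma qnorm_conj: "qmul D z (qconj z) = (qnorm D z, 0)"
  by (simp add: qmul_def qconj_def qnorm_def power2_eq_square algebra_simps)

lemma qnorm_mult: "qnorm D (qmul D z w) = qnorm D z * qnorm D w"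
  by (simp add: qmul_def qnorm_def power2_eq_square algebra_simps)

lemma qnorm_const [simp]: "qnorm D (a, 0) = a ^ 2"
  by (simp add: qnorm_def)

lemma qpow_simps [simp]: "qpow D z 0 = (1, 0)" "qpow D z (Suc n) = qmul D z (qpow D z n)"
  by (simp_all add: qpow_def)

lemma qnorm_pow: "qnorm D (qpow D z n) = qnorm D z ^ n"
  by (induction n) (simp_all add: qnorm_mult)

lemma qconj_pow: "qconj (qpow D z n) = qpow D (qconj z) n"
  by (induction n) (simp_all add: qconj_mult, simp add: qconj_def)

definition qideal :: "'a::comm_ring_1 \<Rightarrow> ('a \<times> 'a) set \<Rightarrow> bool" where
  "qideal D J \<longleftrightarrow> 0 \<in> J \<and> J \<noteq> {0} \<and> (\<forall>z\<in>J. \<forall>w\<in>J. z + w \<in> J) \<and> (\<forall>z. \<forall>w\<in>J. qmul D z w \<in> J)"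

definition qequiv :: "'a::comm_ring_1 \<Rightarrow> ('a \<times> 'a) set \<Rightarrow> ('a \<times> 'a) set \<Rightarrow> bool" where
  "qequiv D J J' \<longleftrightarrow> (\<exists>x y. x \<noteq> 0 \<and> y \<noteq> 0 \<and> qmul D x ` J = qmul D y ` J')"

text \<open>The polynomial ring is completely integrally closed: once the gcd is removed, every
  power of c' divides the fixed polynomial C, so c' is constant by degrees.\<close>

lemma dvd_of_power_dvd:
  fixes c a C :: "'a::field_gcd poly"
  assumes "c \<noteq> 0" "C \<noteq> 0" "\<And>n. c ^ n dvd C * a ^ n"
  shows "c dvd a"
proof -
  define g where "g = gcd c a"
  have g: "g \<noteq> 0" using assms(1) by (simp add: g_def)
  obtain c' a' where ca: "c = g * c'" "a = g * a'" "coprime c' a'"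
    using gcd_coprime_exists[of c a] g unfolding g_def by (metis mult.commute)
  have d: "c' ^ n dvd C" for n
  proof -
    have "g ^ n * c' ^ n dvd g ^ n * (C * a' ^ n)"
      using assms(3)[of n] by (simp add: ca power_mult_distrib mult_ac)
    then have "c' ^ n dvd C * a' ^ n" using g by simp
    then show ?thesis using ca(3) by (simp add: coprime_dvd_mult_left_iff)
  qed
  have c': "c' \<noteq> 0" using ca assms by auto
  have "Polynomial.degree c' * Suc (Polynomial.degree C) \<le> Polynomial.degree C"
    using dvd_imp_degree_le[OF d[of "Suc (Polynomial.degree C)"] assms(2)] c'
    by (simp add: degree_power_eq mult.commute del: power_Suc)
  then have "Polynomial.degree c' = 0" by (cases "Polynomial.degree c'") auto
  then have "is_unit c'" using c' by (simp add: is_unit_iff_degree)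
  then show ?thesis unfolding ca(1,2) by (rule mult_dvd_mono[OF dvd_refl unit_imp_dvd])
qed

text \<open>\<open>aniso\<close> says that D is not a square of a rational function, so that the
  norm has no nontrivial zero; \<open>sqfree\<close> is squarefreeness of D in the form in which the
  integral closure needs it.\<close>

locale quadratic_order =
  fixes D :: "'a::{finite_field,field_gcd} poly"
  assumes two: "(2::'a) \<noteq> 0"
    and aniso: "u\<^sup>2 = D * v\<^sup>2 \<Longrightarrow> v = 0"
    and sqfree: "c\<^sup>2 dvd D * v\<^sup>2 \<Longrightarrow> c dvd v"
begin

lemma qnorm_eq_0: "qnorm D z = 0 \<longleftrightarrow> z = 0"
proof
  assume "qnorm D z = 0"
  then have "fst z ^ 2 = D * snd z ^ 2" by (simp add: qnorm_def)
  then have "snd z = 0" "fst z ^ 2 = D * snd z ^ 2" using aniso by auto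
  then show "z = 0" by (simp add: prod_eq_iff)
qed (simp add: qnorm_def)

lemma qmul_eq_0: "qmul D z w = 0 \<longleftrightarrow> z = 0 \<or> w = 0"
  using qnorm_mult[of D z w] qnorm_eq_0 by (metis mult_eq_0_iff)

lemma qmul_cancel: "z \<noteq> 0 \<Longrightarrow> qmul D z x = qmul D z y \<longleftrightarrow> x = y"
proof -
  assume z: "z \<noteq> 0"
  have "qmul D z (x - y) + qmul D z y = qmul D z x" by (simp add: qmul_add(1)[symmetric])
  then have "qmul D z x = qmul D z y \<longleftrightarrow> qmul D z (x - y) = 0" by (metis add_cancel_left_left)
  then show ?thesis using z by (simp add: qmul_eq_0)
qed

text \<open>The hypothesis says that all powers of z/c have the common denominator C. Then the
  powers of its trace and of its norm have denominator C^2, and the polynomial case gives c | 2 u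
  and c^2 | u^2 - D v^2 for z = (u, v), whence c^2 | D v^2.\<close>

lemma integrally_closed:
  assumes c: "c \<noteq> 0" and C: "C \<noteq> 0"
    and pw: "\<And>n. \<exists>w. qmul D (C, 0) (qpow D z n) = qmul D (c ^ n, 0) w"
  shows "\<exists>z'. z = qmul D (c, 0) z'"
proof -
  let ?M = "\<lambda>n y. \<exists>w. qmul D (C ^ 2, 0) y = qmul D (c ^ n, 0) w"
  have M0: "?M (i + j) (qmul D (qpow D z i) (qpow D (qconj z) j))" for i j
  proof -
    obtain w where w: "qmul D (C, 0) (qpow D z i) = qmul D (c ^ i, 0) w" using pw by blast
    obtain w' where "qmul D (C, 0) (qpow D z j) = qmul D (c ^ j, 0) w'" using pw by blast
    then have "qconj (qmul D (C, 0) (qpow D z j)) = qconj (qmul D (c ^ j, 0) w')" by simp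
    then have w': "qmul D (C, 0) (qpow D (qconj z) j) = qmul D (c ^ j, 0) (qconj w')"
      by (simp add: qconj_mult qconj_pow) (simp add: qconj_def)
    have "qmul D (C ^ 2, 0) (qmul D (qpow D z i) (qpow D (qconj z) j)) =
        qmul D (qmul D (C, 0) (qpow D z i)) (qmul D (C, 0) (qpow D (qconj z) j))"
    proof -
      have "(C ^ 2, 0) = qmul D (C, 0) (C, 0)" by (simp add: power2_eq_square)
      then show ?thesis by (simp only: qmul_ac)
    qed
    also have "\<dots> = qmul D (c ^ (i + j), 0) (qmul D w (qconj w'))"
    proof -
      have "(c ^ (i + j), 0) = qmul D (c ^ i, 0) (c ^ j, 0)" by (simp add: power_add)
      then show ?thesis unfolding w w' by (simp only: qmul_ac)
    qed
    finally show ?thesis by blast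
  qed
  define t where "t = 2 * fst z"
  have t: "z + qconj z = (t, 0)" by (simp add: t_def qconj_def prod_eq_iff)
  \<comment> \<open>Binomial expansion of the powers of the trace, by induction: each factor t = z +
    conj z raises one of the exponents i, j.\<close>
  have M1: "?M (i + j + n) (qmul D (qmul D (qpow D z i) (qpow D (qconj z) j)) (t ^ n, 0))" for i j n
  proof (induction n arbitrary: i j)
    case 0
    then show ?case using M0 by simp
  next
    case (Suc n)
    have e: "Suc i + j + n = i + j + Suc n" "i + Suc j + n = i + j + Suc n" by simp_all
    obtain w1 where w1: "qmul D (C ^ 2, 0) (qmul D (qmul D (qpow D z (Suc i)) (qpow D (qconj z) j)) (t ^ n, 0))
        = qmul D (c ^ (i + j + Suc n), 0) w1" using Suc.IH[of "Suc i" j] unfolding e by blast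
    obtain w2 where w2: "qmul D (C ^ 2, 0) (qmul D (qmul D (qpow D z i) (qpow D (qconj z) (Suc j))) (t ^ n, 0))
        = qmul D (c ^ (i + j + Suc n), 0) w2" using Suc.IH[of i "Suc j"] unfolding e by blast
    have "(t ^ Suc n, 0) = qmul D (z + qconj z) (t ^ n, 0)" unfolding t by simp
    then have "qmul D (qmul D (qpow D z i) (qpow D (qconj z) j)) (t ^ Suc n, 0) =
      qmul D (qmul D (qpow D z (Suc i)) (qpow D (qconj z) j)) (t ^ n, 0) +
      qmul D (qmul D (qpow D z i) (qpow D (qconj z) (Suc j))) (t ^ n, 0)"
      by (simp only: qmul_add qpow_simps qmul_ac)
    then have "qmul D (C ^ 2, 0) (qmul D (qmul D (qpow D z i) (qpow D (qconj z) j)) (t ^ Suc n, 0)) =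
        qmul D (c ^ (i + j + Suc n), 0) (w1 + w2)"
      by (simp only: qmul_add w1 w2)
    then show ?case by blast
  qed
  have "c ^ n dvd C ^ 2 * t ^ n" for n
  proof -
    obtain w where "qmul D (C ^ 2, 0) (t ^ n, 0) = qmul D (c ^ n, 0) w" using M1[of 0 0 n] unfolding add_0 qpow_simps(1) qmul_simps(1) by blast
    then have "C ^ 2 * t ^ n = c ^ n * fst w" by (simp add: qmul_def)
    then show ?thesis by simp
  qed
  then have "c dvd t" using c C by (intro dvd_of_power_dvd[of c "C ^ 2" t]) auto
  then have "c dvd [:1/2:] * t" by (rule dvd_mult)
  moreover have "[:1/2:] * t = fst z"
  proof -
    have "[:1/2:] * (2 :: 'a poly) = 1"
      using two by (simp add: numeral_poly one_pCons)
    then have "([:1/2:] * 2) * fst z = fst z" by simp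
    then show ?thesis by (simp only: t_def mult.assoc)
  qed
  ultimately have u: "c dvd fst z" by simp
  have "(c ^ 2) ^ n dvd C ^ 2 * qnorm D z ^ n" for n
  proof -
    obtain w where "qmul D (C, 0) (qpow D z n) = qmul D (c ^ n, 0) w" using pw by blast
    then have "qnorm D (qmul D (C, 0) (qpow D z n)) = qnorm D (qmul D (c ^ n, 0) w)" by simp
    then have "C ^ 2 * qnorm D z ^ n = (c ^ 2) ^ n * qnorm D w"
      by (simp add: qnorm_mult qnorm_pow power_mult[symmetric] mult.commute)
    then show ?thesis by simp
  qed
  then have "c ^ 2 dvd qnorm D z" using c C by (intro dvd_of_power_dvd[of "c ^ 2" "C ^ 2"]) auto
  moreover have "c ^ 2 dvd fst z ^ 2" using u by (simp add: dvd_power_same)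
  ultimately have "c ^ 2 dvd fst z ^ 2 - qnorm D z" by (rule dvd_diff[rotated])
  then have "c ^ 2 dvd D * snd z ^ 2" by (simp add: qnorm_def)
  then have "c dvd snd z" by (rule sqfree)
  then show ?thesis using u by (cases z) (auto elim!: dvdE)
qed

end

section \<open>The order as an integral closure, and its fractional ideals\<close>

locale quadratic_order_embedding = quadratic_embedding L \<Psi> D + quadratic_order D
  for L :: "('x, 'm) ring_scheme" (structure) and \<Psi> :: "'a::{finite_field,field_gcd} poly \<times> 'a poly \<Rightarrow> 'x"
    and D :: "'a poly"
begin

lemma Psi_add: "\<Psi> (z + w) = \<Psi> z \<oplus> \<Psi> w"
  by (cases z; cases w) (simp add: add)

lemma Psi_mult: "\<Psi> (qmul D z w) = \<Psi> z \<otimes> \<Psi> w"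
  by (cases z; cases w) (simp add: mult qmul_def)

lemma Psi_zero: "\<Psi> 0 = \<zero>"
proof -
  have "\<Psi> 0 \<oplus> \<Psi> 0 = \<Psi> 0" using Psi_add[of 0 0] by simp
  then show ?thesis using closed L.add.l_cancel_one by metis
qed

lemma Psi_eq_zero: "\<Psi> z = \<zero> \<longleftrightarrow> z = 0"
  using inj[of z 0] Psi_zero by simp

lemma Psi_minus: "\<Psi> (- z) = \<ominus> \<Psi> z"
proof -
  have "\<Psi> (- z) \<oplus> \<Psi> z = \<zero>" using Psi_add[of "- z" z] Psi_zero by simp
  then show ?thesis using closed by (simp add: L.minus_equality)
qed

lemma Psi_unit: "z \<noteq> 0 \<Longrightarrow> \<Psi> z \<in> Units L"
proof -
  assume "z \<noteq> 0"
  then have "\<Psi> (qnorm D z, 0) \<in> Units L" using unit qnorm_eq_0 by blast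
  then have "\<Psi> z \<otimes> \<Psi> (qconj z) \<in> Units L" by (simp add: Psi_mult[symmetric] qnorm_conj)
  then show ?thesis using closed L.prod_unit_l L.unit_factor by blast
qed

lemma nonzero_unit: "x \<in> carrier L \<Longrightarrow> x \<noteq> \<zero> \<Longrightarrow> x \<in> Units L"
proof -
  assume x: "x \<in> carrier L" "x \<noteq> \<zero>"
  obtain u v c where c: "c \<noteq> 0" "\<Psi> (c, 0) \<otimes> x = \<Psi> (u, v)" using frac[OF x(1)] by blast
  have cu: "\<Psi> (c, 0) \<in> Units L" using c unit by blast
  have "\<Psi> (u, v) \<noteq> \<zero>"
  proof
    assume "\<Psi> (u, v) = \<zero>"
    then have "\<Psi> (c, 0) \<otimes> x = \<Psi> (c, 0) \<otimes> \<zero>" using c closed by simp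
    then show False using x cu L.Units_l_cancel by blast
  qed
  then have "\<Psi> (u, v) \<in> Units L" using Psi_eq_zero Psi_unit by blast
  then have "x \<otimes> \<Psi> (c, 0) \<in> Units L" using c(2) x closed by (simp add: L.m_comm)
  then show ?thesis using x closed L.unit_factor by blast
qed

lemma L_field: "field L"
proof (rule L.cring_fieldI)
  have "\<one> \<noteq> \<zero>" using Psi_eq_zero[of "(1, 0)"] one by (metis prod.inject zero_neq_one zero_prod_def)
  then have "\<zero> \<notin> Units L" using L.Units_closed by (auto simp: Units_def)
  then show "Units L = carrier L - {\<zero>}" using nonzero_unit by auto
qed

text \<open>An element of the order satisfies its characteristic equation with trace and norm.
  Conversely, an integral x = z/c has powers with bounded denominators, so
  \<open>integrally_closed\<close> applies to it.\<close>

lemma quadratic_integral_closure: "integral_closure L (range (\<lambda>a. \<Psi> (a, 0))) = range \<Psi>"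
proof (rule equalityI; rule subsetI)
  interpret field L by (rule L_field)
  let ?B = "range (\<lambda>a. \<Psi> (a, 0))"
  fix x assume "x \<in> range \<Psi>"
  then obtain z where x: "x = \<Psi> z" by blast
  have "\<one> \<noteq> \<zero>" by simp
  let ?f = "[\<one>, \<Psi> (- 2 * fst z, 0), \<Psi> (qnorm D z, 0)]"
  have "?f \<in> carrier (univ_poly L ?B)"
  proof -
    have "\<one> \<in> ?B" using one by (metis rangeI)
    then show ?thesis by (auto simp: univ_poly_def polynomial_def)
  qed
  moreover have "L.eval ?f x = \<zero>"
  proof -
    have "L.eval ?f x = \<Psi> (qmul D z z + (qmul D (- 2 * fst z, 0) z + ((qnorm D z, 0) + 0)))"
      unfolding Psi_add Psi_mult Psi_zero using closed x by (simp add: nat_pow_def numeral_2_eq_2)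
    also have "qmul D z z + (qmul D (- 2 * fst z, 0) z + ((qnorm D z, 0) + 0)) = 0"
      by (simp add: qmul_def qnorm_def prod_eq_iff power2_eq_square)
    finally show ?thesis by (simp add: Psi_zero)
  qed
  ultimately show "x \<in> integral_closure L ?B"
    unfolding integral_closure_def using closed[of z] x
    by (simp del: L.eval.simps) (rule bexI[of _ ?f], simp_all del: L.eval.simps)
next
  interpret field L by (rule L_field)
  let ?B = "range (\<lambda>a. \<Psi> (a, 0))"
  fix x assume "x \<in> integral_closure L ?B"
  then obtain f where x: "x \<in> carrier L" and f: "f \<in> carrier (univ_poly L ?B)" "f \<noteq> []" "hd f = \<one>" "L.eval f x = \<zero>"
    unfolding integral_closure_def by auto
  obtain u v c where c: "c \<noteq> 0" "\<Psi> (c, 0) \<otimes> x = \<Psi> (u, v)" using frac[OF x] by blast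
  define z where "z = (u, v)"
  obtain p where p: "f = \<one> # p" using f(2,3) by (cases f) auto
  have pB: "set p \<subseteq> ?B" using f(1) unfolding p by (auto simp: univ_poly_def polynomial_def)
  then have pc: "set p \<subseteq> carrier L" using closed by auto
  define m where "m = length p"
  have xm: "x [^] m = \<ominus> L.eval p x"
  proof -
    have "x [^] m \<oplus> L.eval p x = \<zero>" using f(4) x by (simp add: p m_def)
    then show ?thesis using x L.eval_in_carrier[OF pc x] by (simp add: L.minus_equality)
  qed
  have small: "\<exists>w. \<Psi> (c ^ m, 0) \<otimes> x [^] n = \<Psi> w" if "n \<le> m" for n :: nat
    using that
  proof (induction n arbitrary: m)
    case 0
    then show ?case using closed by auto
  next
    case (Suc n)
    then obtain m' where m': "m = Suc m'" by (cases m) auto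
    have "n \<le> m'" using Suc.prems m' by simp
    then obtain w where w: "\<Psi> (c ^ m', 0) \<otimes> x [^] n = \<Psi> w" using Suc.IH by blast
    have "\<Psi> (c ^ m, 0) \<otimes> x [^] Suc n = (\<Psi> (c ^ m', 0) \<otimes> x [^] n) \<otimes> (\<Psi> (c, 0) \<otimes> x)"
      using Psi_mult[of "(c ^ m', 0)" "(c, 0)"] x closed by (simp add: m' L.m_ac mult.commute)
    also have "\<dots> = \<Psi> (qmul D w (u, v))" by (simp add: w c Psi_mult)
    finally show ?case by blast
  qed
  \<comment> \<open>This one denominator serves all powers of x: below m each factor x is cleared by
    a factor c, and from m on the monic relation f expresses a power through the m preceding ones
    (\<open>ev\<close>).\<close>
  define C where "C = c ^ m"
  have ev: "\<exists>w. \<Psi> (C, 0) \<otimes> (x [^] k \<otimes> L.eval q x) = \<Psi> w"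
    if "set q \<subseteq> ?B" "\<And>i. i < length q \<Longrightarrow> \<exists>w. \<Psi> (C, 0) \<otimes> x [^] (k + i) = \<Psi> w" for q and k :: nat
    using that
  proof (induction q)
    case Nil
    have "\<Psi> (C, 0) \<otimes> (x [^] k \<otimes> L.eval [] x) = \<Psi> 0" using x closed by (simp add: Psi_zero)
    then show ?case by blast
  next
    case (Cons a q)
    then obtain w1 where w1: "\<Psi> (C, 0) \<otimes> (x [^] k \<otimes> L.eval q x) = \<Psi> w1" by fastforce
    obtain w2 where w2: "\<Psi> (C, 0) \<otimes> x [^] (k + length q) = \<Psi> w2" using Cons.prems(2)[of "length q"] by auto
    obtain b where b: "a = \<Psi> (b, 0)" using Cons.prems by auto
    have qc: "L.eval q x \<in> carrier L" using Cons.prems closed x by (intro L.eval_in_carrier) auto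
    have "\<Psi> (C, 0) \<otimes> (x [^] k \<otimes> L.eval (a # q) x) =
        \<Psi> (b, 0) \<otimes> (\<Psi> (C, 0) \<otimes> x [^] (k + length q)) \<oplus> \<Psi> (C, 0) \<otimes> (x [^] k \<otimes> L.eval q x)"
      using x closed qc by (simp add: b L.nat_pow_mult[symmetric] L.r_distr L.m_ac)
    also have "\<dots> = \<Psi> (qmul D (b, 0) w2 + w1)" unfolding w1 w2 Psi_add Psi_mult by simp
    finally show ?case by blast
  qed
  have all: "\<exists>w. \<Psi> (C, 0) \<otimes> x [^] n = \<Psi> w" for n :: nat
  proof (induction n rule: less_induct)
    case (less n)
    show ?case
    proof (cases "n < m")
      case True
      then show ?thesis using small[of n] by (simp add: C_def)
    next
      case False
      have "\<exists>w. \<Psi> (C, 0) \<otimes> (x [^] (n - m) \<otimes> L.eval p x) = \<Psi> w"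
        using False by (intro ev[OF pB] less) (auto simp: m_def)
      then obtain w where w: "\<Psi> (C, 0) \<otimes> (x [^] (n - m) \<otimes> L.eval p x) = \<Psi> w" by blast
      have "x [^] n = x [^] (n - m) \<otimes> x [^] m" using False x by (simp add: L.nat_pow_mult)
      then have "\<Psi> (C, 0) \<otimes> x [^] n = \<ominus> (\<Psi> (C, 0) \<otimes> (x [^] (n - m) \<otimes> L.eval p x))"
        using x closed L.eval_in_carrier[OF pc x] by (simp add: xm L.r_minus)
      then show ?thesis unfolding w Psi_minus[symmetric] by blast
    qed
  qed
  have pow: "\<Psi> (c ^ n, 0) \<otimes> x [^] n = \<Psi> (qpow D z n)" for n :: nat
  proof (induction n)
    case 0
    then show ?case using closed by (simp add: one)
  next
    case (Suc n)
    have "\<Psi> (c ^ Suc n, 0) \<otimes> x [^] Suc n = (\<Psi> (c, 0) \<otimes> x) \<otimes> (\<Psi> (c ^ n, 0) \<otimes> x [^] n)"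
      using Psi_mult[of "(c, 0)" "(c ^ n, 0)"] x closed by (simp add: L.m_ac)
    then show ?case unfolding Suc c(2) by (simp add: z_def Psi_mult)
  qed
  have "\<exists>z'. z = qmul D (c, 0) z'"
  proof (rule integrally_closed[OF c(1)])
    show "C \<noteq> 0" using c by (simp add: C_def)
    fix n :: nat
    obtain w where w: "\<Psi> (C, 0) \<otimes> x [^] n = \<Psi> w" using all by blast
    have "\<Psi> (qmul D (C, 0) (qpow D z n)) = \<Psi> (c ^ n, 0) \<otimes> (\<Psi> (C, 0) \<otimes> x [^] n)"
      using x closed by (simp add: Psi_mult pow[symmetric] L.m_lcomm)
    also have "\<dots> = \<Psi> (qmul D (c ^ n, 0) w)" by (simp add: w Psi_mult)
    finally have "qmul D (C, 0) (qpow D z n) = qmul D (c ^ n, 0) w" by (simp only: inj)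
    then show "\<exists>w. qmul D (C, 0) (qpow D z n) = qmul D (c ^ n, 0) w" by blast
  qed
  then obtain z' where "z = qmul D (c, 0) z'" by blast
  then have "\<Psi> (c, 0) \<otimes> x = \<Psi> (c, 0) \<otimes> \<Psi> z'" using c by (simp add: z_def[symmetric] Psi_mult)
  then have "x = \<Psi> z'" using L.Units_l_cancel[OF unit[OF c(1)] x closed] by blast
  then show "x \<in> range \<Psi>" by blast
qed

text \<open>The ideal class of I, that is, its coset modulo the principal fractional ideals; see
  \<open>class_number_orbits\<close>.\<close>

definition orbit :: "'x set \<Rightarrow> 'x set set" where
  "orbit I = {(\<lambda>i. x \<otimes> i) ` I | x. x \<in> carrier L - {\<zero>}}"

lemma ideal_prod_principal:
  assumes x: "x \<in> carrier L" and I: "additive_subgroup I L" "\<forall>r\<in>range \<Psi>. \<forall>i\<in>I. r \<otimes> i \<in> I"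
  shows "ideal_prod L (x <#\<^bsub>L\<^esub> range \<Psi>) I = (\<lambda>i. x \<otimes> i) ` I"
proof (rule equalityI; rule subsetI)
  interpret I: additive_subgroup I L by (rule I(1))
  fix s assume "s \<in> ideal_prod L (x <#\<^bsub>L\<^esub> range \<Psi>) I"
  then show "s \<in> (\<lambda>i. x \<otimes> i) ` I"
  proof (induction rule: ideal_prod.induct)
    case (prod i j)
    then obtain z where i: "i = x \<otimes> \<Psi> z" by (auto simp: l_coset_def)
    have "i \<otimes> j = x \<otimes> (\<Psi> z \<otimes> j)" using i x closed prod(2) I.a_Hcarr by (simp add: L.m_assoc)
    then show ?case using I(2) prod(2) by blast
  next
    case (sum s1 s2)
    then obtain i1 i2 where i: "i1 \<in> I" "s1 = x \<otimes> i1" "i2 \<in> I" "s2 = x \<otimes> i2" by blast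
    then have "s1 \<oplus> s2 = x \<otimes> (i1 \<oplus> i2)" using x I.a_Hcarr by (simp add: L.r_distr)
    then show ?case using I.a_closed[OF i(1,3)] by blast
  qed
next
  interpret I: additive_subgroup I L by (rule I(1))
  fix s assume "s \<in> (\<lambda>i. x \<otimes> i) ` I"
  then obtain i where i: "i \<in> I" "s = x \<otimes> i" by blast
  have "x \<otimes> \<Psi> (1, 0) \<in> x <#\<^bsub>L\<^esub> range \<Psi>" by (auto simp: l_coset_def)
  then have "x \<otimes> \<Psi> (1, 0) \<otimes> i \<in> ideal_prod L (x <#\<^bsub>L\<^esub> range \<Psi>) I" using i(1) by (rule ideal_prod.prod)
  then show "s \<in> ideal_prod L (x <#\<^bsub>L\<^esub> range \<Psi>) I" using i x by (simp add: one)
qed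

lemma orbit_self: "I \<subseteq> carrier L \<Longrightarrow> I \<in> orbit I"
proof -
  interpret field L by (rule L_field)
  assume "I \<subseteq> carrier L"
  then have "(\<lambda>i. \<one> \<otimes> i) ` I = (\<lambda>i. i) ` I" by (intro image_cong refl L.l_one) auto
  then have "(\<lambda>i. \<one> \<otimes> i) ` I = I" by simp
  moreover have "\<one> \<in> carrier L - {\<zero>}" by simp
  ultimately show ?thesis unfolding orbit_def by (metis (mono_tags, lifting) mem_Collect_eq)
qed

lemma orbit_mult:
  assumes "x \<in> carrier L" "x \<noteq> \<zero>" "I \<subseteq> carrier L"
  shows "orbit ((\<lambda>i. x \<otimes> i) ` I) = orbit I"
proof -
  interpret field L by (rule L_field)
  have xu: "x \<in> Units L" using assms nonzero_unit by blast
  have comp: "(\<lambda>i. y \<otimes> i) ` (\<lambda>i. x \<otimes> i) ` I = (\<lambda>i. (y \<otimes> x) \<otimes> i) ` I" if "y \<in> carrier L" for y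
    unfolding image_image using assms that by (intro image_cong refl L.m_assoc[symmetric]) auto
  show ?thesis
  proof (rule equalityI; rule subsetI)
    fix J assume "J \<in> orbit ((\<lambda>i. x \<otimes> i) ` I)"
    then obtain y where y: "y \<in> carrier L" "y \<noteq> \<zero>" "J = (\<lambda>i. y \<otimes> i) ` (\<lambda>i. x \<otimes> i) ` I" by (auto simp: orbit_def)
    then have "J = (\<lambda>i. (y \<otimes> x) \<otimes> i) ` I" "y \<otimes> x \<in> carrier L - {\<zero>}"
      using comp assms by (auto simp: integral_iff)
    then show "J \<in> orbit I" by (auto simp: orbit_def)
  next
    fix J assume "J \<in> orbit I"
    then obtain y where y: "y \<in> carrier L" "y \<noteq> \<zero>" "J = (\<lambda>i. y \<otimes> i) ` I" by (auto simp: orbit_def)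
    have ix: "inv x \<in> carrier L" "inv x \<otimes> x = \<one>" using xu by auto
    then have yx: "y \<otimes> inv x \<in> carrier L" "y \<otimes> inv x \<otimes> x = y" using y assms by (auto simp: L.m_assoc)
    moreover have "y \<otimes> inv x \<noteq> \<zero>" using yx y assms by auto
    ultimately have "J = (\<lambda>i. (y \<otimes> inv x) \<otimes> i) ` (\<lambda>i. x \<otimes> i) ` I" using comp y by simp
    then show "J \<in> orbit ((\<lambda>i. x \<otimes> i) ` I)" using yx \<open>y \<otimes> inv x \<noteq> \<zero>\<close> unfolding orbit_def by blast
  qed
qed

text \<open>The carrier of the quotient is the set of cosets, so the class number counts cosets;
  \<open>ideal_prod_principal\<close> turns each product with a principal ideal into a
  scaling.\<close>

lemma class_number_orbits:
  "class_number L (range \<Psi>) = card (orbit ` carrier (fractional_ideals L (range \<Psi>)))"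
proof -
  let ?G = "fractional_ideals L (range \<Psi>)" and ?P = "principal_fractional_ideals L (range \<Psi>)"
  have "?P #>\<^bsub>?G\<^esub> I = orbit I" if "I \<in> carrier ?G" for I
  proof -
    have I: "additive_subgroup I L" "\<forall>r\<in>range \<Psi>. \<forall>i\<in>I. r \<otimes> i \<in> I"
      using that by (auto simp: fractional_ideals_def)
    have "?P #>\<^bsub>?G\<^esub> I = (\<lambda>x. ideal_prod L (x <#\<^bsub>L\<^esub> range \<Psi>) I) ` (carrier L - {\<zero>})"
      by (auto simp: r_coset_def principal_fractional_ideals_def fractional_ideals_def)
    also have "\<dots> = (\<lambda>x. (\<lambda>i. x \<otimes> i) ` I) ` (carrier L - {\<zero>})"
      using ideal_prod_principal[OF _ I] by (intro image_cong) auto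
    finally show ?thesis by (auto simp: orbit_def)
  qed
  then have "(\<lambda>I. ?P #>\<^bsub>?G\<^esub> I) ` carrier ?G = orbit ` carrier ?G" by (rule image_cong[OF refl])
  then show ?thesis unfolding class_number_def Coset.order_def ideal_class_group_def carrier_FactGroup by simp
qed

lemma qideal_fractional:
  assumes "qideal D J"
  shows "\<Psi> ` J \<in> carrier (fractional_ideals L (range \<Psi>))"
proof -
  interpret field L by (rule L_field)
  have neg: "- z \<in> J" if "z \<in> J" for z
  proof -
    have "qmul D (- 1, 0) z \<in> J" using assms that unfolding qideal_def by blast
    moreover have "qmul D (- 1, 0) z = - z" by (simp add: qmul_def prod_eq_iff)
    ultimately show ?thesis by simp
  qed
  have "subgroup (\<Psi> ` J) (add_monoid L)"
  proof (rule group.subgroupI[OF L.a_group])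
    show "\<Psi> ` J \<subseteq> carrier (add_monoid L)" using closed by auto
    show "\<Psi> ` J \<noteq> {}" using assms by (auto simp: qideal_def)
    show "inv\<^bsub>add_monoid L\<^esub> a \<in> \<Psi> ` J" if "a \<in> \<Psi> ` J" for a
      using that neg by (auto simp: a_inv_def[symmetric] Psi_minus[symmetric])
    show "a \<otimes>\<^bsub>add_monoid L\<^esub> b \<in> \<Psi> ` J" if ab: "a \<in> \<Psi> ` J" "b \<in> \<Psi> ` J" for a b
    proof -
      obtain z w where "z \<in> J" "w \<in> J" "a = \<Psi> z" "b = \<Psi> w" using ab by blast
      moreover from this have "z + w \<in> J" using assms unfolding qideal_def by blast
      ultimately show ?thesis by (simp add: Psi_add[symmetric])
    qed
  qed
  then have "additive_subgroup (\<Psi> ` J) L" by (rule additive_subgroupI)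
  moreover have "\<forall>r\<in>range \<Psi>. \<forall>x\<in>\<Psi> ` J. r \<otimes> x \<in> \<Psi> ` J"
    using assms by (auto simp: qideal_def Psi_mult[symmetric])
  moreover have "\<Psi> ` J \<noteq> {\<zero>}"
  proof
    assume "\<Psi> ` J = {\<zero>}"
    then have "\<forall>z\<in>J. z = 0" using Psi_eq_zero by auto
    then show False using assms by (auto simp: qideal_def)
  qed
  moreover have "\<exists>d\<in>range \<Psi> - {\<zero>}. \<forall>x\<in>\<Psi> ` J. d \<otimes> x \<in> range \<Psi>"
    using closed one by (intro bexI[of _ \<one>]) (auto simp: image_iff, metis)
  ultimately show ?thesis by (simp add: fractional_ideals_def)
qed

text \<open>Multiplication by a common denominator d moves I into the order without leaving its
  orbit.\<close>

lemma fractional_qideal: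
  assumes "I \<in> carrier (fractional_ideals L (range \<Psi>))"
  shows "\<exists>J. qideal D J \<and> orbit (\<Psi> ` J) = orbit I"
proof -
  interpret field L by (rule L_field)
  have I: "additive_subgroup I L" "\<forall>r\<in>range \<Psi>. \<forall>i\<in>I. r \<otimes> i \<in> I" "I \<noteq> {\<zero>}"
    using assms by (auto simp: fractional_ideals_def)
  interpret I: additive_subgroup I L by (rule I(1))
  obtain d where d: "d \<in> range \<Psi>" "d \<noteq> \<zero>" "\<forall>x\<in>I. d \<otimes> x \<in> range \<Psi>"
    using assms by (auto simp: fractional_ideals_def)
  have dc: "d \<in> carrier L" using d closed by auto
  define J where "J = {z. \<Psi> z \<in> (\<lambda>i. d \<otimes> i) ` I}"
  have im: "\<Psi> ` J = (\<lambda>i. d \<otimes> i) ` I" 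
  proof (rule equalityI; rule subsetI)
    fix s assume s: "s \<in> (\<lambda>i. d \<otimes> i) ` I"
    then obtain z where "s = \<Psi> z" using d(3) by blast
    then show "s \<in> \<Psi> ` J" using s by (simp add: J_def)
  qed (auto simp: J_def)
  have "qideal D J"
    unfolding qideal_def
  proof (intro conjI ballI allI)
    show "0 \<in> J" using I.zero_closed dc by (auto simp: J_def Psi_zero intro!: image_eqI[of _ _ \<zero>])
    show "z + w \<in> J" if zw: "z \<in> J" "w \<in> J" for z w
    proof -
      obtain i j where "i \<in> I" "\<Psi> z = d \<otimes> i" "j \<in> I" "\<Psi> w = d \<otimes> j" using zw by (auto simp: J_def)
      then have "\<Psi> (z + w) = d \<otimes> (i \<oplus> j)" "i \<oplus> j \<in> I" using dc I.a_Hcarr by (simp_all add: Psi_add L.r_distr)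
      then show ?thesis by (auto simp: J_def)
    qed
    show "qmul D z w \<in> J" if zw: "w \<in> J" for z w
    proof -
      obtain i where "i \<in> I" "\<Psi> w = d \<otimes> i" using zw by (auto simp: J_def)
      then have "\<Psi> (qmul D z w) = d \<otimes> (\<Psi> z \<otimes> i)" "\<Psi> z \<otimes> i \<in> I"
        using dc I.a_Hcarr closed[of z] by (simp add: Psi_mult L.m_lcomm, use I(2) \<open>i \<in> I\<close> in blast)
      then show ?thesis by (auto simp: J_def)
    qed
    obtain i where i: "i \<in> I" "i \<noteq> \<zero>" using I(3) I.zero_closed by blast
    then obtain z where z: "\<Psi> z = d \<otimes> i" using d by fastforce
    then have "z \<in> J" using i(1) by (auto simp: J_def)
    moreover have "z \<noteq> 0" using z i d(2) integral[OF _ dc I.a_Hcarr[OF i(1)]] Psi_zero by metis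
    ultimately have "z \<in> J" "z \<noteq> 0" .
    then show "J \<noteq> {0}" by blast
  qed
  moreover have "orbit (\<Psi> ` J) = orbit I" unfolding im using dc d(2) I.a_subset by (rule orbit_mult)
  ultimately show ?thesis by blast
qed

text \<open>A multiplier in L is a quotient of elements of the order; \<open>qequiv\<close> has a
  factor on either side so that the denominator is cleared and the relation no longer mentions
  L.\<close>

lemma orbit_eq_iff:
  assumes "qideal D J" "qideal D J'"
  shows "orbit (\<Psi> ` J) = orbit (\<Psi> ` J') \<longleftrightarrow> qequiv D J J'"
proof
  interpret field L by (rule L_field)
  have cl: "\<Psi> ` A \<subseteq> carrier L" for A using closed by auto
  have im: "(\<lambda>i. \<Psi> x \<otimes> i) ` \<Psi> ` A = \<Psi> ` qmul D x ` A" for x A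
    by (auto simp: image_image Psi_mult)
  have injP: "inj \<Psi>" using inj by (auto intro: injI)
  {
    assume "orbit (\<Psi> ` J) = orbit (\<Psi> ` J')"
    then have "\<Psi> ` J \<in> orbit (\<Psi> ` J')" using orbit_self[OF cl] by metis
    then obtain x where x: "x \<in> carrier L" "x \<noteq> \<zero>" "\<Psi> ` J = (\<lambda>i. x \<otimes> i) ` \<Psi> ` J'" by (auto simp: orbit_def)
    obtain u v c where c: "c \<noteq> 0" "\<Psi> (c, 0) \<otimes> x = \<Psi> (u, v)" using frac[OF x(1)] by blast
    have "\<Psi> (c, 0) \<noteq> \<zero>" using c by (simp add: Psi_eq_zero zero_prod_def)
    then have nz: "(u, v) \<noteq> 0" using c x closed integral Psi_eq_zero by metis
    have "\<Psi> ` qmul D (c, 0) ` J = (\<lambda>i. \<Psi> (c, 0) \<otimes> i) ` (\<lambda>i. x \<otimes> i) ` \<Psi> ` J'"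
      unfolding im[symmetric] x(3) ..
    also have "\<dots> = (\<lambda>i. \<Psi> (u, v) \<otimes> i) ` \<Psi> ` J'"
      unfolding c(2)[symmetric] image_image using x closed by (intro image_cong refl L.m_assoc[symmetric]) auto
    also have "\<dots> = \<Psi> ` qmul D (u, v) ` J'" by (rule im)
    finally have "qmul D (c, 0) ` J = qmul D (u, v) ` J'" by (rule inj_image_eq_iff[THEN iffD1, OF injP])
    moreover have "(c, 0) \<noteq> 0" using c by (simp add: zero_prod_def)
    ultimately show "qequiv D J J'" unfolding qequiv_def using nz by blast
  }
  assume "qequiv D J J'"
  then obtain x y where xy: "x \<noteq> 0" "y \<noteq> 0" "qmul D x ` J = qmul D y ` J'" by (auto simp: qequiv_def)
  have "orbit (\<Psi> ` J) = orbit ((\<lambda>i. \<Psi> x \<otimes> i) ` \<Psi> ` J)"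
    using orbit_mult[OF closed _ cl] xy Psi_eq_zero by metis
  also have "\<dots> = orbit ((\<lambda>i. \<Psi> y \<otimes> i) ` \<Psi> ` J')" unfolding im xy(3) ..
  also have "\<dots> = orbit (\<Psi> ` J')" using orbit_mult[OF closed _ cl] xy Psi_eq_zero by metis
  finally show "orbit (\<Psi> ` J) = orbit (\<Psi> ` J')" .
qed

text \<open>This is all that the count needs to know about L; the counting itself works with pairs
  of polynomials.\<close>

lemma class_number_qideals:
  "\<exists>f :: _ \<Rightarrow> 'x set set. class_number L (range \<Psi>) = card (f ` {J. qideal D J}) \<and>
    (\<forall>J J'. qideal D J \<longrightarrow> qideal D J' \<longrightarrow> (f J = f J' \<longleftrightarrow> qequiv D J J'))"
proof (rule exI[of _ "\<lambda>J. orbit (\<Psi> ` J)"], intro conjI allI impI)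
  have "orbit ` carrier (fractional_ideals L (range \<Psi>)) = (\<lambda>J. orbit (\<Psi> ` J)) ` {J. qideal D J}"
  proof (rule equalityI; rule subsetI)
    fix S assume "S \<in> orbit ` carrier (fractional_ideals L (range \<Psi>))"
    then obtain I where I: "S = orbit I" "I \<in> carrier (fractional_ideals L (range \<Psi>))" by blast
    obtain J where "qideal D J" "orbit (\<Psi> ` J) = orbit I" using fractional_qideal[OF I(2)] by blast
    then show "S \<in> (\<lambda>J. orbit (\<Psi> ` J)) ` {J. qideal D J}" using I(1) by blast
  next
    fix S assume "S \<in> (\<lambda>J. orbit (\<Psi> ` J)) ` {J. qideal D J}"
    then obtain J where "S = orbit (\<Psi> ` J)" "qideal D J" by blast
    then show "S \<in> orbit ` carrier (fractional_ideals L (range \<Psi>))" using qideal_fractional by blast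
  qed
  then show "class_number L (range \<Psi>) = card ((\<lambda>J. orbit (\<Psi> ` J)) ` {J. qideal D J})"
    by (simp add: class_number_orbits)
qed (rule orbit_eq_iff)

end

section \<open>Ideals of large index in an ideal class\<close>

abbreviation deg :: "'a::zero poly \<Rightarrow> nat" where "deg \<equiv> Polynomial.degree"

text \<open>The module over the polynomial ring with basis g a and g (b + sqrt D).\<close>

definition qlattice :: "'a::comm_ring_1 \<Rightarrow> 'a \<Rightarrow> 'a \<Rightarrow> ('a \<times> 'a) set" where
  "qlattice g a b = {(g * (a * s + b * v), g * v) | s v. True}"

definition qdet :: "'a::comm_ring_1 \<times> 'a \<Rightarrow> 'a \<times> 'a \<Rightarrow> 'a" where
  "qdet z w = fst z * snd w - fst w * snd z"

text \<open>The index of a sublattice is measured by the least degree of a determinant of two of its elements.\<close>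

definition index_degree :: "('a::comm_ring_1 poly \<times> 'a poly) set \<Rightarrow> nat" where
  "index_degree J = (LEAST n. \<exists>z\<in>J. \<exists>w\<in>J. qdet z w \<noteq> 0 \<and> deg (qdet z w) = n)"

text \<open>Normal form data of an ideal: the divisibility makes the lattice stable under sqrt D,
  and the normalization makes the triple unique (\<open>lattice_eqD\<close>).\<close>

definition ideal_triple :: "'a::field poly \<Rightarrow> 'a poly \<Rightarrow> 'a poly \<Rightarrow> 'a poly \<Rightarrow> bool" where
  "ideal_triple D g a b \<longleftrightarrow> Polynomial.lead_coeff g = 1 \<and> Polynomial.lead_coeff a = 1 \<and>
     (b = 0 \<or> deg b < deg a) \<and> a dvd b\<^sup>2 - D"

lemma lattice_mem: "(x, y) \<in> qlattice 1 a b \<longleftrightarrow> a dvd x - b * y"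
proof
  assume "(x, y) \<in> qlattice 1 a b"
  then show "a dvd x - b * y" by (auto simp: qlattice_def)
next
  assume "a dvd x - b * y"
  then obtain s where "x - b * y = a * s" by (auto simp: dvd_def)
  then have "x = 1 * (a * s + b * y)" by (simp add: algebra_simps)
  then show "(x, y) \<in> qlattice 1 a b" unfolding qlattice_def by auto
qed

lemma lattice_scale: "qlattice g a b = qmul D (g, 0) ` qlattice 1 a b"
  by (auto simp: qlattice_def image_iff) metis+

lemma lattice_gens: "(g * a, 0) \<in> qlattice g a b" "(g * b, g) \<in> qlattice g a b"
  unfolding qlattice_def by (simp, intro exI[of _ 1] exI[of _ 0], simp) (simp, intro exI[of _ 1] exI[of _ 0], simp)

lemma qdet_qmul: "qdet (qmul D x z) (qmul D x w) = qnorm D x * qdet z w"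
  by (simp add: qdet_def qmul_def qnorm_def algebra_simps power2_eq_square)

context quadratic_order
begin

lemma lattice_qideal:
  assumes "g \<noteq> 0" "a \<noteq> 0" "a dvd b\<^sup>2 - D"
  shows "qideal D (qlattice g a b)"
  unfolding qideal_def
proof (intro conjI ballI allI)
  show "0 \<in> qlattice g a b" by (auto simp: qlattice_def zero_prod_def intro!: exI[of _ 0])
  show "qlattice g a b \<noteq> {0}" using lattice_gens(2)[of g b a] assms by (auto simp: zero_prod_def)
  show "z + w \<in> qlattice g a b" if zw: "z \<in> qlattice g a b" "w \<in> qlattice g a b" for z w
  proof -
    obtain s v s' v' where "z = (g * (a * s + b * v), g * v)" "w = (g * (a * s' + b * v'), g * v')"
      using zw by (auto simp: qlattice_def)
    then have "z + w = (g * (a * (s + s') + b * (v + v')), g * (v + v'))" by (simp add: algebra_simps)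
    then show ?thesis unfolding qlattice_def by blast
  qed
  show "qmul D z w \<in> qlattice g a b" if w: "w \<in> qlattice g a b" for z w
  proof -
    obtain s v where w: "w = (g * (a * s + b * v), g * v)" using w by (auto simp: qlattice_def)
    obtain c where c: "b\<^sup>2 - D = a * c" using assms(3) by (auto simp: dvd_def)
    obtain x y where z: "z = (x, y)" by (cases z)
    have D: "D = b * b - a * c" using c by (simp add: algebra_simps power2_eq_square)
    have "qmul D z w = (g * (a * (x * s - y * c * v - b * y * s) + b * (x * v + y * (a * s + b * v))), g * (x * v + y * (a * s + b * v)))"
      unfolding w z qmul_def D by (simp add: algebra_simps)
    then show ?thesis unfolding qlattice_def by blast
  qed
qed

text \<open>Every determinant of two lattice elements is a multiple of the determinant g^2 a of the
  basis.\<close>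

lemma index_degree_lattice:
  fixes g a b :: "'a poly"
  assumes "g \<noteq> 0" "a \<noteq> 0"
  shows "index_degree (qlattice g a b) = 2 * deg g + deg a"
    "z \<in> qlattice g a b \<Longrightarrow> w \<in> qlattice g a b \<Longrightarrow> qdet z w \<noteq> 0 \<Longrightarrow> 2 * deg g + deg a \<le> deg (qdet z w)"
    "\<exists>z\<in>qlattice g a b. \<exists>w\<in>qlattice g a b. qdet z w \<noteq> 0 \<and> deg (qdet z w) = 2 * deg g + deg a"
proof -
  have d: "deg (g\<^sup>2 * a) = 2 * deg g + deg a" using assms by (simp add: degree_mult_eq degree_power_eq)
  show 1: "2 * deg g + deg a \<le> deg (qdet z w)" if zw: "z \<in> qlattice g a b" "w \<in> qlattice g a b" "qdet z w \<noteq> 0" for z w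
  proof -
    obtain s v s' v' where "z = (g * (a * s + b * v), g * v)" "w = (g * (a * s' + b * v'), g * v')"
      using zw by (auto simp: qlattice_def)
    then have "qdet z w = (g\<^sup>2 * a) * (s * v' - s' * v)" by (simp add: qdet_def algebra_simps power2_eq_square)
    then have "g\<^sup>2 * a dvd qdet z w" by simp
    then show ?thesis using dvd_imp_degree_le[OF _ zw(3)] d by metis
  qed
  have "qdet (g * a, 0) (g * b, g) = g\<^sup>2 * a" by (simp add: qdet_def power2_eq_square)
  then show 2: "\<exists>z\<in>qlattice g a b. \<exists>w\<in>qlattice g a b. qdet z w \<noteq> 0 \<and> deg (qdet z w) = 2 * deg g + deg a"
    using lattice_gens d assms by (metis mult_eq_0_iff power_eq_0_iff)
  show "index_degree (qlattice g a b) = 2 * deg g + deg a"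
    unfolding index_degree_def using 1 2 by (intro Least_equality) auto
qed

text \<open>Hermite normal form: g generates the second coordinates, g a generates the elements with
  second coordinate 0, and b is reduced modulo a.\<close>

lemma qideal_lattice:
  assumes "qideal D J"
  shows "\<exists>g a b. ideal_triple D g a b \<and> J = qlattice g a b"
proof -
  have J0: "0 \<in> J" "J \<noteq> {0}" and Jp: "\<And>z w. z \<in> J \<Longrightarrow> w \<in> J \<Longrightarrow> z + w \<in> J" and Jm: "\<And>z w. w \<in> J \<Longrightarrow> qmul D z w \<in> J"
    using assms unfolding qideal_def by blast+
  have Js: "(c * x, c * y) \<in> J" if "(x, y) \<in> J" for c x y
    using Jm[OF that, of "(c, 0)"] by simp
  have gen: "\<exists>g\<in>I. Polynomial.lead_coeff g = 1 \<and> (\<forall>x\<in>I. g dvd x)"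
    if I: "\<And>x y. x \<in> I \<Longrightarrow> y \<in> I \<Longrightarrow> x + y \<in> I" "\<And>c x. x \<in> I \<Longrightarrow> c * x \<in> I" "\<exists>x\<in>I. x \<noteq> 0" for I :: "'a poly set"
  proof -
    obtain g where g: "g \<in> I" "g \<noteq> 0" "\<And>x. x \<in> I \<Longrightarrow> x \<noteq> 0 \<Longrightarrow> deg g \<le> deg x"
      using ex_has_least_nat[of "\<lambda>x. x \<in> I \<and> x \<noteq> 0" _ deg] I(3) by blast
    define g' where "g' = [:inverse (Polynomial.lead_coeff g):] * g"
    have "g' \<in> I" unfolding g'_def by (rule I(2)[OF g(1)])
    then have g': "g' \<in> I" "Polynomial.lead_coeff g' = 1" "deg g' = deg g" using g by (simp_all add: g'_def)
    have "g' dvd x" if x: "x \<in> I" for x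
    proof (rule ccontr)
      assume "\<not> g' dvd x"
      then have r: "x mod g' \<noteq> 0" by (simp add: dvd_eq_mod_eq_0)
      have "x mod g' = x + (- (x div g')) * g'" by (simp add: minus_div_mult_eq_mod[symmetric])
      then have "x mod g' \<in> I" using I(1)[OF x I(2)[OF g'(1), of "- (x div g')"]] by (simp only:)
      then have "deg g' \<le> deg (x mod g')" using g(3) r g'(3) by simp
      moreover have "deg (x mod g') < deg g'" using r degree_mod_less'[of g' x] g'(2) by fastforce
      ultimately show False by simp
    qed
    then show ?thesis using g' by blast
  qed
  obtain z where z: "z \<in> J" "z \<noteq> 0" using J0 by blast
  obtain z1 z2 where zz: "z = (z1, z2)" by (cases z)
  \<comment> \<open>Multiplication by sqrt D makes every first coordinate a second coordinate, so g
    divides the first coordinates as well.\<close>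
  have sw: "(D * y, x) \<in> J" if "(x, y) \<in> J" for x y
    using Jm[OF that, of "(0, 1)"] by (simp add: qmul_def)
  have "\<exists>g\<in>snd ` J. Polynomial.lead_coeff g = 1 \<and> (\<forall>x\<in>snd ` J. g dvd x)"
  proof (rule gen)
    show "x + y \<in> snd ` J" if "x \<in> snd ` J" "y \<in> snd ` J" for x y
    proof -
      obtain x' y' where "(x', x) \<in> J" "(y', y) \<in> J" using \<open>x \<in> snd ` J\<close> \<open>y \<in> snd ` J\<close> by force
      then have "snd ((x', x) + (y', y)) \<in> snd ` J" using Jp by (intro imageI)
      then show ?thesis by simp
    qed
    show "c * x \<in> snd ` J" if "x \<in> snd ` J" for c x
    proof -
      obtain x' where "(x', x) \<in> J" using \<open>x \<in> snd ` J\<close> by force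
      then have "snd (c * x', c * x) \<in> snd ` J" using Js by (intro imageI)
      then show ?thesis by simp
    qed
    show "\<exists>x\<in>snd ` J. x \<noteq> 0"
    proof (cases "z2 = 0")
      case True
      then have "z1 \<noteq> 0" using z zz by (simp add: zero_prod_def)
      then show ?thesis using sw[of z1 z2] z zz by force
    qed (use z zz in force)
  qed
  then obtain g b0 where g: "(b0, g) \<in> J" "Polynomial.lead_coeff g = 1" "\<And>x y. (x, y) \<in> J \<Longrightarrow> g dvd y" by force
  have g0: "g \<noteq> 0" using g(2) by auto
  have gx: "g dvd x" if "(x, y) \<in> J" for x y using g(3)[OF sw[OF that]] .
  define I where "I = {x. (g * x, 0) \<in> J}"
  have "\<exists>a\<in>I. Polynomial.lead_coeff a = 1 \<and> (\<forall>x\<in>I. a dvd x)"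
  proof (rule gen)
    show "x + y \<in> I" if "x \<in> I" "y \<in> I" for x y using that Jp[of "(g * x, 0)" "(g * y, 0)"] by (simp add: I_def algebra_simps)
    show "c * x \<in> I" if "x \<in> I" for c x using that Js[of "g * x" 0 c] by (simp add: I_def mult_ac)
    have "qmul D (qconj z) z \<in> J" using Jm[OF z(1)] .
    then have n: "(qnorm D z, 0) \<in> J" by (simp add: qmul_comm qnorm_conj)
    then have "(g * qnorm D z, 0) \<in> J" using Js[of "qnorm D z" 0 g] by simp
    then show "\<exists>x\<in>I. x \<noteq> 0" using z(2) by (intro bexI[of _ "qnorm D z"]) (simp_all add: I_def qnorm_eq_0)
  qed
  then obtain a where a: "a \<in> I" "Polynomial.lead_coeff a = 1" "\<And>x. x \<in> I \<Longrightarrow> a dvd x" by blast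
  have a0: "a \<noteq> 0" using a(2) by auto
  have aJ: "(g * a, 0) \<in> J" using a by (simp add: I_def)
  obtain b1 where b1: "b0 = g * b1" using gx[OF g(1)] by (auto simp: dvd_def)
  define b where "b = b1 mod a"
  have bJ: "(g * b, g) \<in> J"
  proof -
    have "b = b1 + (- (b1 div a)) * a" by (simp add: b_def minus_div_mult_eq_mod[symmetric])
    then have "g * b = g * (b1 + (- (b1 div a)) * a)" by (rule arg_cong)
    also have "\<dots> = b0 + - (b1 div a) * (g * a)" by (simp add: b1 algebra_simps)
    finally have "(g * b, g) = (b0, g) + (- (b1 div a) * (g * a), - (b1 div a) * 0)" by simp
    then show ?thesis using Jp[OF g(1) Js[OF aJ]] by metis
  qed
  have "J = qlattice g a b"
  proof (rule equalityI; rule subsetI)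
    fix w assume w: "w \<in> J"
    obtain x y where xy: "w = (x, y)" by (cases w)
    obtain v where v: "y = g * v" using g(3) w xy by (auto simp: dvd_def)
    obtain u where u: "x = g * u" using gx w xy by (auto simp: dvd_def)
    have "(g * (u - b * v), 0) = w + (- v * (g * b), - v * g)" by (simp add: xy u v algebra_simps)
    then have "(g * (u - b * v), 0) \<in> J" using Jp[OF w Js[OF bJ]] by metis
    then have "a dvd u - b * v" using a(3) by (simp add: I_def)
    then obtain s where "u - b * v = a * s" by (auto simp: dvd_def)
    then have "u = a * s + b * v" by (simp add: algebra_simps)
    then show "w \<in> qlattice g a b" unfolding qlattice_def xy u v by blast
  next
    fix w assume "w \<in> qlattice g a b"
    then obtain s v where "w = (g * (a * s + b * v), g * v)" by (auto simp: qlattice_def)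
    then have "w = (s * (g * a), s * 0) + (v * (g * b), v * g)" by (simp add: algebra_simps)
    then show "w \<in> J" using Jp[OF Js[OF aJ] Js[OF bJ]] by metis
  qed
  moreover have "a dvd b\<^sup>2 - D"
  proof -
    \<comment> \<open>Multiplying g (b + sqrt D) by b - sqrt D leaves the polynomial g (b^2 - D),
      which a generates up to g.\<close>
    have "qmul D (b, - 1) (g * b, g) \<in> J" using Jm[OF bJ] .
    moreover have "qmul D (b, - 1) (g * b, g) = (g * (b\<^sup>2 - D), 0)" by (simp add: qmul_def algebra_simps power2_eq_square)
    ultimately show ?thesis using a(3) by (simp add: I_def)
  qed
  moreover have "b = 0 \<or> deg b < deg a" using degree_mod_less[OF a0] by (simp add: b_def)
  ultimately show ?thesis using g(2) a(2) unfolding ideal_triple_def by blast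
qed

lemma monic_dvd_antisym:
  fixes a b :: "'a poly"
  assumes "a dvd b" "b dvd a" "Polynomial.lead_coeff a = 1" "Polynomial.lead_coeff b = 1"
  shows "a = b"
proof -
  have "normalize a = a" "normalize b = b" using assms(3,4) by (simp_all add: normalize_poly_eq_map_poly map_poly_idI)
  then show ?thesis using assms associated_eqI by blast
qed

lemma lattice_eqD:
  assumes "ideal_triple D g a b" "ideal_triple D g' a' b'" "qlattice g a b = qlattice g' a' b'"
  shows "g = g' \<and> a = a' \<and> b = b'"
proof -
  have key: "g' dvd g \<and> (g = g' \<longrightarrow> a' dvd a \<and> a' dvd b - b')"
    if t: "ideal_triple D g a b" "ideal_triple D g' a' b'" "qlattice g a b \<subseteq> qlattice g' a' b'" for g a b g' a' b'
  proof -
    have nz: "g \<noteq> 0" "g' \<noteq> 0" using t by (auto simp: ideal_triple_def)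
    have "(g * b, g) \<in> qlattice g' a' b'" "(g * a, 0) \<in> qlattice g' a' b'" using lattice_gens t(3) by blast+
    then obtain s v s' v' where "(g * b, g) = (g' * (a' * s + b' * v), g' * v)" "(g * a, 0) = (g' * (a' * s' + b' * v'), g' * v')"
      unfolding qlattice_def by blast
    then have 1: "g * b = g' * (a' * s + b' * v)" "g = g' * v" "g * a = g' * (a' * s')" using nz by auto
    have "v = 1" "b = a' * s + b'" "a = a' * s'" if "g = g'" using 1 nz that by auto
    then show ?thesis using 1(2) by auto
  qed
  have g: "g = g'" using key[OF assms(1,2)] key[OF assms(2,1)] assms by (auto simp: ideal_triple_def intro: monic_dvd_antisym)
  then have a: "a = a'" using key[OF assms(1,2)] key[OF assms(2,1)] assms by (auto simp: ideal_triple_def intro: monic_dvd_antisym)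
  have "a dvd b - b'" using key[OF assms(1,2)] assms(3) g a by simp
  moreover have "b - b' = 0 \<or> deg (b - b') < deg a"
    using assms(1,2) a degree_diff_le_max[of b b'] by (auto simp: ideal_triple_def)
  ultimately have "b - b' = 0" using dvd_imp_degree_le[of a "b - b'"] by fastforce
  then show ?thesis using g a by simp
qed

lemma index_degree_qmul:
  assumes "qideal D J" "x \<noteq> 0"
  shows "index_degree (qmul D x ` J) = deg (qnorm D x) + index_degree J"
proof -
  obtain g a b where t: "ideal_triple D g a b" "J = qlattice g a b" using qideal_lattice[OF assms(1)] by blast
  then have nz: "g \<noteq> 0" "a \<noteq> 0" by (auto simp: ideal_triple_def)
  note l = index_degree_lattice[OF nz, where b = b, folded t(2)]
  have n: "qnorm D x \<noteq> 0" using assms qnorm_eq_0 by blast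
  show ?thesis
    unfolding index_degree_def[of "qmul D x ` J"]
  proof (rule Least_equality)
    obtain z w where "z \<in> J" "w \<in> J" "qdet z w \<noteq> 0" "deg (qdet z w) = 2 * deg g + deg a" using l(3) by blast
    then show "\<exists>z\<in>qmul D x ` J. \<exists>w\<in>qmul D x ` J. qdet z w \<noteq> 0 \<and> deg (qdet z w) = deg (qnorm D x) + index_degree J"
      using n l(1) by (intro bexI[of _ "qmul D x z"] bexI[of _ "qmul D x w"]) (auto simp: qdet_qmul degree_mult_eq)
    fix m assume "\<exists>z\<in>qmul D x ` J. \<exists>w\<in>qmul D x ` J. qdet z w \<noteq> 0 \<and> deg (qdet z w) = m"
    then obtain z w where h: "z \<in> J" "w \<in> J" "qdet z w \<noteq> 0" "deg (qnorm D x * qdet z w) = m"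
      by (auto simp: qdet_qmul)
    then show "deg (qnorm D x) + index_degree J \<le> m" using l(2)[OF h(1-3)] l(1) n by (simp add: degree_mult_eq)
  qed
qed

lemma qequiv_trans:
  assumes "qequiv D J J'" "qequiv D J' J''"
  shows "qequiv D J J''"
proof -
  obtain x y where 1: "x \<noteq> 0" "y \<noteq> 0" "qmul D x ` J = qmul D y ` J'" using assms by (auto simp: qequiv_def)
  obtain x' y' where 2: "x' \<noteq> 0" "y' \<noteq> 0" "qmul D x' ` J' = qmul D y' ` J''" using assms by (auto simp: qequiv_def)
  have i: "qmul D (qmul D u v) ` A = qmul D u ` qmul D v ` A" for u v A by (simp add: image_image qmul_assoc)
  have "qmul D (qmul D x' x) ` J = qmul D (qmul D y x') ` J'"
    unfolding i[of x' x] 1(3) i[of x' y, symmetric] qmul_comm[of D x' y] ..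
  also have "\<dots> = qmul D (qmul D y y') ` J''" unfolding i 2(3) ..
  finally show ?thesis unfolding qequiv_def using 1 2
    by (intro exI[of _ "qmul D x' x"] exI[of _ "qmul D y y'"]) (simp add: qmul_eq_0)
qed

end

section \<open>Counting lattice elements by the degree of the norm\<close>

definition polys_below :: "nat \<Rightarrow> 'a::zero poly set" where
  "polys_below n = {f. f = 0 \<or> deg f < n}"

lemma polys_below_iff: "f \<in> polys_below n \<longleftrightarrow> (\<forall>i\<ge>n. poly.coeff f i = 0)"
proof (cases "f = 0")
  case False
  have "deg f < n" if "\<forall>i\<ge>n. poly.coeff f i = 0"
    using that False leading_coeff_0_iff not_le by blast
  then show ?thesis using False by (auto simp: polys_below_def coeff_eq_0)
qed (simp add: polys_below_def)

lemma polys_below_Suc: "polys_below (Suc n) = (\<lambda>(c, f). pCons c f) ` (UNIV \<times> polys_below n)"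
proof (rule equalityI; rule subsetI)
  fix f :: "'a poly" assume f: "f \<in> polys_below (Suc n)"
  obtain c g where fg: "f = pCons c g" by (rule pCons_cases)
  have "poly.coeff g i = 0" if "n \<le> i" for i
    using f that unfolding polys_below_iff fg by (metis Suc_le_mono coeff_pCons_Suc)
  then have "g \<in> polys_below n" unfolding polys_below_iff by blast
  then show "f \<in> (\<lambda>(c, f). pCons c f) ` (UNIV \<times> polys_below n)" using fg by auto
qed (auto simp: polys_below_iff coeff_pCons split: nat.splits)

lemma finite_polys_below [simp]: "finite (polys_below n :: 'a::{zero,finite} poly set)"
  by (induction n) (auto simp: polys_below_Suc polys_below_def[of 0])

lemma card_polys_below: "card (polys_below n :: 'a::{zero,finite} poly set) = card (UNIV :: 'a set) ^ n"
proof (induction n)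
  case (Suc n)
  have "inj_on (\<lambda>(c, f). pCons c f) (UNIV \<times> (polys_below n :: 'a poly set))" by (auto simp: inj_on_def)
  then show ?case by (simp add: polys_below_Suc card_image card_cartesian_product Suc)
qed (simp add: polys_below_def)

text \<open>The last two conditions say that the place at infinity is inert.\<close>

locale imaginary_order = quadratic_order D for D :: "'a::{finite_field,field_gcd} poly" +
  fixes q :: nat
  assumes q_card: "q = card (UNIV :: 'a set)" and deg_pos: "deg D > 0" and deg_even: "even (deg D)"
    and lead_nonsquare: "x\<^sup>2 \<noteq> Polynomial.lead_coeff D"
begin

lemma q_ge_2: "q \<ge> 2"
proof -
  have "card {0, 1 :: 'a} \<le> q" unfolding q_card by (intro card_mono) auto
  then show ?thesis by simp
qed

text \<open>The leading terms of u^2 and D v^2 could cancel only if the leading coefficient of D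
  were a square, so the degree of the norm is the maximum of the two degrees.\<close>

lemma degree_qnorm_less:
  assumes "(u, v) \<noteq> 0"
  shows "deg (qnorm D (u, v)) < m \<longleftrightarrow> (u = 0 \<or> 2 * deg u < m) \<and> (v = 0 \<or> 2 * deg v + deg D < m)"
proof -
  have D0: "D \<noteq> 0" using deg_pos by auto
  have du: "u \<noteq> 0 \<Longrightarrow> deg (u\<^sup>2) = 2 * deg u" by (simp add: degree_power_eq)
  have dv: "v \<noteq> 0 \<Longrightarrow> deg (D * v\<^sup>2) = 2 * deg v + deg D" using D0 by (simp add: degree_mult_eq degree_power_eq)
  consider "u = 0" "v \<noteq> 0" | "v = 0" "u \<noteq> 0" | "u \<noteq> 0" "v \<noteq> 0" using assms by (auto simp: zero_prod_def)
  then show ?thesis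
  proof cases
    case 3
    have "deg (u\<^sup>2 - D * v\<^sup>2) = max (2 * deg u) (2 * deg v + deg D)"
    proof (cases "2 * deg u" "2 * deg v + deg D" rule: linorder_cases)
      case less
      then show ?thesis using degree_add_eq_right[of "u\<^sup>2" "- (D * v\<^sup>2)"] du dv 3 by simp
    next
      case greater
      then show ?thesis using degree_add_eq_left[of "- (D * v\<^sup>2)" "u\<^sup>2"] du dv 3 by simp
    next
      case equal
      have 1: "poly.coeff (u\<^sup>2) (2 * deg u) = (Polynomial.lead_coeff u)\<^sup>2"
        using du 3 lead_coeff_power[of u 2] by simp
      have 2: "poly.coeff (D * v\<^sup>2) (2 * deg u) = Polynomial.lead_coeff D * (Polynomial.lead_coeff v)\<^sup>2"
        using dv[OF 3(2)] equal lead_coeff_mult[of D "v\<^sup>2"] lead_coeff_power[of v 2] by metis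
      have "poly.coeff (u\<^sup>2 - D * v\<^sup>2) (2 * deg u) \<noteq> 0"
      proof
        assume "poly.coeff (u\<^sup>2 - D * v\<^sup>2) (2 * deg u) = 0"
        then have "(Polynomial.lead_coeff u / Polynomial.lead_coeff v)\<^sup>2 = Polynomial.lead_coeff D"
          using 1 2 3 by (simp add: power_divide)
        then show False using lead_nonsquare by blast
      qed
      then have "2 * deg u \<le> deg (u\<^sup>2 - D * v\<^sup>2)" by (rule le_degree)
      moreover have "deg (u\<^sup>2 - D * v\<^sup>2) \<le> 2 * deg u"
        using degree_diff_le[of "u\<^sup>2" "2 * deg u" "D * v\<^sup>2"] du dv 3 equal by simp
      ultimately show ?thesis using equal by simp
    qed
    then show ?thesis using 3 by (simp add: qnorm_def)
  qed (auto simp: qnorm_def du dv)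
qed

text \<open>The number (m + 1) div 2 counts the n with 2 n < m. For given v, the first coordinates
  form the residue class of b v modulo a, so they are (b v mod a) + a s with s free below the
  remaining degree.\<close>

lemma card_lattice_below:
  assumes a: "Polynomial.lead_coeff a = 1" and m: "(m + 1) div 2 \<ge> deg a" "(m + 1) div 2 \<ge> deg D div 2"
  shows "finite {y \<in> qlattice 1 a b. y = 0 \<or> deg (qnorm D y) < m}"
    "card {y \<in> qlattice 1 a b. y = 0 \<or> deg (qnorm D y) < m} =
      q ^ ((m + 1) div 2 - deg a) * q ^ ((m + 1) div 2 - deg D div 2)"
proof -
  let ?B = "(m + 1) div 2"
  have a0: "a \<noteq> 0" using a by auto
  let ?F = "\<lambda>(s, v). ((b * v) mod a + a * s, v)"
  have less: "y = 0 \<or> deg (qnorm D y) < m \<longleftrightarrow> fst y \<in> polys_below ?B \<and> snd y \<in> polys_below (?B - deg D div 2)" for y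
  proof (cases "y = 0")
    case False
    have "2 * n < m \<longleftrightarrow> n < ?B" "2 * n + deg D < m \<longleftrightarrow> n < ?B - deg D div 2" for n
      using deg_even m(2) by (auto elim!: evenE)
    then show ?thesis using degree_qnorm_less[of "fst y" "snd y" m] False by (simp add: polys_below_def)
  qed (simp add: polys_below_def)
  have r: "(b * v) mod a \<in> polys_below (deg a)" for v
    using degree_mod_less[OF a0, of "b * v"] by (auto simp: polys_below_def)
  have sum: "r + a * s \<in> polys_below ?B \<longleftrightarrow> s \<in> polys_below (?B - deg a)" if "r \<in> polys_below (deg a)" for r s
  proof (cases "s = 0")
    case True
    then show ?thesis using that m by (auto simp: polys_below_def)
  next
    case False
    then have d: "deg (a * s) = deg a + deg s" using a0 by (simp add: degree_mult_eq)
    have "deg (r + a * s) = deg a + deg s"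
      using that d degree_add_eq_right[of r "a * s"] by (cases "r = 0") (auto simp: polys_below_def)
    moreover have "r + a * s \<noteq> 0"
    proof
      assume "r + a * s = 0"
      then have "a dvd r" by (metis add_eq_0_iff dvd_minus_iff dvd_triv_left)
      moreover have "r \<noteq> 0" using \<open>r + a * s = 0\<close> False a0 by auto
      ultimately show False using that dvd_imp_degree_le[of a r] by (auto simp: polys_below_def)
    qed
    ultimately show ?thesis using False by (auto simp: polys_below_def)
  qed
  have eq: "{y \<in> qlattice 1 a b. y = 0 \<or> deg (qnorm D y) < m} =
      ?F ` (polys_below (?B - deg a) \<times> polys_below (?B - deg D div 2))"
  proof (rule equalityI; rule subsetI)
    fix y assume y: "y \<in> {y \<in> qlattice 1 a b. y = 0 \<or> deg (qnorm D y) < m}"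
    obtain u v where uv: "y = (u, v)" by (cases y)
    have 1: "u \<in> polys_below ?B" "v \<in> polys_below (?B - deg D div 2)" "a dvd u - b * v"
      using y less[of y] by (auto simp: uv lattice_mem)
    have "a dvd u - (b * v) mod a"
      using 1(3) by (metis mod_eq_dvd_iff mod_mod_trivial)
    then obtain s where "u - (b * v) mod a = a * s" by (auto simp: dvd_def)
    then have u: "u = (b * v) mod a + a * s" by (simp add: algebra_simps)
    then have "s \<in> polys_below (?B - deg a)" using sum[OF r] 1 by simp
    then show "y \<in> ?F ` (polys_below (?B - deg a) \<times> polys_below (?B - deg D div 2))" using 1 uv u by auto
  next
    fix y assume "y \<in> ?F ` (polys_below (?B - deg a) \<times> polys_below (?B - deg D div 2))"
    then obtain s v where sv: "s \<in> polys_below (?B - deg a)" "v \<in> polys_below (?B - deg D div 2)" "y = ((b * v) mod a + a * s, v)"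
      by auto
    have "a dvd (b * v) mod a + a * s - b * v"
    proof -
      have "(b * v) mod a + a * s - b * v = a * (s - (b * v) div a)"
        by (simp add: algebra_simps minus_div_mult_eq_mod[symmetric])
      then show ?thesis by simp
    qed
    then have "y \<in> qlattice 1 a b" by (simp add: sv lattice_mem)
    then show "y \<in> {y \<in> qlattice 1 a b. y = 0 \<or> deg (qnorm D y) < m}"
      using less[of y] sum[OF r, of v s] sv by simp
  qed
  show "finite {y \<in> qlattice 1 a b. y = 0 \<or> deg (qnorm D y) < m}" unfolding eq by simp
  have "inj_on ?F (polys_below (?B - deg a) \<times> polys_below (?B - deg D div 2))"
    using a0 by (auto simp: inj_on_def)
  then show "card {y \<in> qlattice 1 a b. y = 0 \<or> deg (qnorm D y) < m} =
      q ^ (?B - deg a) * q ^ (?B - deg D div 2)"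
    unfolding eq by (simp add: card_image card_cartesian_product card_polys_below q_card)
qed

text \<open>Gauss reduction: as long as 2 deg a > deg D, the complementary divisor c in b^2 - D = a
  c has smaller degree than a. The bound makes the set of classes finite and lets one threshold
  serve all classes in \<open>class_count_sum\<close>.\<close>

lemma qequiv_small_rep:
  assumes "qideal D J"
  shows "\<exists>a b. ideal_triple D 1 a b \<and> 2 * deg a \<le> deg D \<and> qequiv D J (qlattice 1 a b)"
proof -
  have prim: "\<exists>a b. ideal_triple D 1 a b \<and> deg a \<le> index_degree I \<and> qequiv D I (qlattice 1 a b)" if I: "qideal D I" for I
  proof -
    obtain g a b where t: "ideal_triple D g a b" "I = qlattice g a b" using qideal_lattice[OF I] by blast
    then have nz: "g \<noteq> 0" "a \<noteq> 0" by (auto simp: ideal_triple_def)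
    have "qmul D (1, 0) ` I = qmul D (g, 0) ` qlattice 1 a b" unfolding t(2) lattice_scale[of g a b D] by simp
    then have "qequiv D I (qlattice 1 a b)" unfolding qequiv_def using nz
      by (intro exI[of _ "(1, 0)"] exI[of _ "(g, 0)"]) (simp add: zero_prod_def)
    moreover have "deg a \<le> index_degree I" using index_degree_lattice(1)[OF nz] t(2) by simp
    ultimately show ?thesis using t(1) by (auto simp: ideal_triple_def)
  qed
  have "\<exists>a b. ideal_triple D 1 a b \<and> 2 * deg a \<le> deg D \<and> qequiv D J (qlattice 1 a b)"
    if "ideal_triple D 1 a b" "qequiv D J (qlattice 1 a b)" for a b
    using that
  proof (induction "deg a" arbitrary: a b rule: less_induct)
    case less
    show ?case
    proof (cases "2 * deg a \<le> deg D")
      case False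
      have t: "Polynomial.lead_coeff a = 1" "b = 0 \<or> deg b < deg a" "a dvd b\<^sup>2 - D" using less.prems by (auto simp: ideal_triple_def)
      then have a0: "a \<noteq> 0" by auto
      obtain c where c: "b\<^sup>2 - D = a * c" using t(3) by (auto simp: dvd_def)
      have nz: "b\<^sup>2 - D \<noteq> 0" using aniso[of b 1] by auto
      then have c0: "c \<noteq> 0" using c by auto
      have "deg (b\<^sup>2 - D) < 2 * deg a"
        using t(2) False degree_diff_less[of "b\<^sup>2" "2 * deg a" D] by (cases "b = 0") (auto simp: degree_power_eq)
      then have dc: "deg c < deg a" unfolding c using a0 c0 by (simp add: degree_mult_eq)
      have cd: "c dvd (- b)\<^sup>2 - D" using c by simp
      \<comment> \<open>The reduction step: since (b - sqrt D) (b + sqrt D) = a c, multiplication by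
        b - sqrt D turns the basis a, b + sqrt D into a times the basis of the lattice of c and -b.
        As c need not be monic, \<open>prim\<close> renormalizes afterwards.\<close>
      have "qmul D (b, - 1) ` qlattice 1 a b = qmul D (a, 0) ` qlattice 1 c (- b)"
      proof (rule equalityI; rule subsetI)
        fix y assume "y \<in> qmul D (b, - 1) ` qlattice 1 a b"
        then obtain s v where y: "y = qmul D (b, - 1) (a * s + b * v, v)" by (auto simp: qlattice_def)
        have D: "D = b * b - a * c" using c by (simp add: algebra_simps power2_eq_square)
        have "y = qmul D (a, 0) (c * v + (- b) * (- s), - s)"
          unfolding y qmul_def D by (simp add: algebra_simps)
        moreover have "(c * v + (- b) * (- s), - s) \<in> qlattice 1 c (- b)" by (simp add: lattice_mem)
        ultimately show "y \<in> qmul D (a, 0) ` qlattice 1 c (- b)" by blast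
      next
        fix y assume "y \<in> qmul D (a, 0) ` qlattice 1 c (- b)"
        then obtain w where "w \<in> qlattice 1 c (- b)" "y = qmul D (a, 0) w" by blast
        moreover from this obtain s v where "w = (c * s + (- b) * v, v)" by (auto simp: qlattice_def)
        ultimately have y: "y = qmul D (a, 0) (c * s + (- b) * v, v)" by simp
        have D: "D = b * b - a * c" using c by (simp add: algebra_simps power2_eq_square)
        have "y = qmul D (b, - 1) (a * (- v) + b * s, s)"
          unfolding y qmul_def D by (simp add: algebra_simps)
        moreover have "(a * (- v) + b * s, s) \<in> qlattice 1 a b" by (simp add: lattice_mem)
        ultimately show "y \<in> qmul D (b, - 1) ` qlattice 1 a b" by blast
      qed
      then have e: "qequiv D (qlattice 1 a b) (qlattice 1 c (- b))"
        unfolding qequiv_def using a0 by (intro exI[of _ "(b, - 1)"] exI[of _ "(a, 0)"]) (simp add: zero_prod_def)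
      obtain a' b' where n: "ideal_triple D 1 a' b'" "deg a' \<le> index_degree (qlattice 1 c (- b))"
        "qequiv D (qlattice 1 c (- b)) (qlattice 1 a' b')"
        using prim[OF lattice_qideal[OF _ c0 cd, of 1]] by auto
      have "deg a' < deg a" using n(2) index_degree_lattice(1)[of 1 c "- b"] c0 dc by simp
      moreover have "qequiv D J (qlattice 1 a' b')" using less.prems(2) e n(3) qequiv_trans by blast
      ultimately show ?thesis using less.hyps n(1) by blast
    qed (use less.prems in blast)
  qed
  then show ?thesis using prim[OF assms] by blast
qed

end

section \<open>Ideals of one class as elements of the conjugate lattice\<close>

locale small_ideal = imaginary_order D q for D :: "'a::{finite_field,field_gcd} poly" and q +
  fixes a b :: "'a poly"
  assumes triple: "ideal_triple D 1 a b" and small: "2 * deg a \<le> deg D"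
begin

text \<open>The product of \<open>I = qlattice 1 a b\<close> and its conjugate is the principal ideal of \<open>a\<close>, so the ideals
  equivalent to \<open>I\<close> are the quotients \<open>y I / a\<close> with \<open>y \<noteq> 0\<close> in the conjugate of \<open>I\<close>.\<close>

definition multiple :: "'a poly \<times> 'a poly \<Rightarrow> ('a poly \<times> 'a poly) set" where
  "multiple y = {z. qmul D (a, 0) z \<in> qmul D y ` qlattice 1 a b}"

lemma a_monic: "Polynomial.lead_coeff a = 1" and a_dvd: "a dvd b\<^sup>2 - D"
  using triple by (auto simp: ideal_triple_def)

lemma a_nonzero: "a \<noteq> 0" "(a, 0) \<noteq> 0"
  using a_monic by (auto simp: zero_prod_def)

lemma M_qideal: "qideal D (qlattice 1 a b)"
  using lattice_qideal[of 1 a b] a_nonzero a_dvd by simp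

lemma conj_mult:
  assumes "y \<in> qlattice 1 a (- b)" "z \<in> qlattice 1 a b"
  shows "\<exists>w. qmul D y z = qmul D (a, 0) w"
proof -
  obtain s v s' v' where y: "y = (a * s - b * v, v)" and z: "z = (a * s' + b * v', v')"
    using assms by (auto simp: qlattice_def)
  obtain c where c: "b\<^sup>2 - D = a * c" using a_dvd by (auto simp: dvd_def)
  have D: "D = b * b - a * c" using c by (simp add: algebra_simps power2_eq_square)
  have "qmul D y z = qmul D (a, 0) (a * s * s' + b * s * v' - b * v * s' - c * v * v', s * v' + v * s')"
    unfolding y z qmul_def D by (simp add: algebra_simps)
  then show ?thesis by blast
qed

lemma multiple_image:
  assumes "y \<in> qlattice 1 a (- b)"
  shows "qmul D (a, 0) ` multiple y = qmul D y ` qlattice 1 a b"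
proof (rule equalityI; rule subsetI)
  fix w assume "w \<in> qmul D y ` qlattice 1 a b"
  moreover from this obtain z where "w = qmul D (a, 0) z" using conj_mult[OF assms] by blast
  ultimately show "w \<in> qmul D (a, 0) ` multiple y" by (auto simp: multiple_def)
qed (auto simp: multiple_def)

lemma multiple_ideal:
  assumes "y \<in> qlattice 1 a (- b)" "y \<noteq> 0"
  shows "qideal D (multiple y)" "qequiv D (multiple y) (qlattice 1 a b)"
    "deg (qnorm D y) = index_degree (multiple y) + deg a"
proof -
  note m = multiple_image[OF assms(1)]
  have M: "0 \<in> qlattice 1 a b" "qlattice 1 a b \<noteq> {0}"
    "\<And>z w. z \<in> qlattice 1 a b \<Longrightarrow> w \<in> qlattice 1 a b \<Longrightarrow> z + w \<in> qlattice 1 a b"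
    "\<And>z w. w \<in> qlattice 1 a b \<Longrightarrow> qmul D z w \<in> qlattice 1 a b"
    using M_qideal unfolding qideal_def by blast+
  show i: "qideal D (multiple y)"
    unfolding qideal_def
  proof (intro conjI ballI allI)
    show "0 \<in> multiple y" using M(1) by (auto simp: multiple_def image_iff intro!: bexI[of _ 0])
    show "z + w \<in> multiple y" if zw: "z \<in> multiple y" "w \<in> multiple y" for z w
    proof -
      obtain z' w' where h: "z' \<in> qlattice 1 a b" "w' \<in> qlattice 1 a b" "qmul D (a, 0) z = qmul D y z'" "qmul D (a, 0) w = qmul D y w'"
        using zw unfolding multiple_def by blast
      have "qmul D (a, 0) (z + w) = qmul D y (z' + w')" by (simp only: qmul_add h)
      then show ?thesis unfolding multiple_def using M(3)[OF h(1,2)] by blast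
    qed
    show "qmul D z w \<in> multiple y" if w: "w \<in> multiple y" for z w
    proof -
      obtain w' where h: "w' \<in> qlattice 1 a b" "qmul D (a, 0) w = qmul D y w'"
        using w unfolding multiple_def by blast
      have "qmul D (a, 0) (qmul D z w) = qmul D z (qmul D (a, 0) w)" by (rule qmul_left_comm)
      also have "\<dots> = qmul D y (qmul D z w')" unfolding h by (rule qmul_left_comm)
      finally show ?thesis unfolding multiple_def using M(4)[OF h(1)] by blast
    qed
    obtain z where z: "z \<in> qlattice 1 a b" "z \<noteq> 0" using M by blast
    then have nz: "qmul D y z \<noteq> 0" using assms qmul_eq_0 by blast
    have "qmul D y z \<in> qmul D (a, 0) ` multiple y" unfolding m using z by blast
    then obtain w where w: "w \<in> multiple y" "qmul D y z = qmul D (a, 0) w" by blast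
    have "w \<noteq> 0"
    proof
      assume "w = 0"
      then show False using nz w(2) by simp
    qed
    then show "multiple y \<noteq> {0}" using w by blast
  qed
  show "qequiv D (multiple y) (qlattice 1 a b)" unfolding qequiv_def using m assms(2) a_nonzero(2)
    by (intro exI[of _ "(a, 0)"] exI[of _ y]) simp
  have "deg (qnorm D (a, 0)) + index_degree (multiple y) = deg (qnorm D y) + index_degree (qlattice 1 a b)"
    using index_degree_qmul[OF i a_nonzero(2)] index_degree_qmul[OF M_qideal assms(2)] m by metis
  then show "deg (qnorm D y) = index_degree (multiple y) + deg a"
    using index_degree_lattice(1)[of 1 a b] a_nonzero by (simp add: degree_power_eq)
qed

lemma ideal_multiple:
  assumes "qideal D J" "qequiv D J (qlattice 1 a b)"
  shows "\<exists>y\<in>qlattice 1 a (- b). y \<noteq> 0 \<and> J = multiple y"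
proof -
  obtain x x' where x: "x \<noteq> 0" "x' \<noteq> 0" "qmul D x ` J = qmul D x' ` qlattice 1 a b"
    using assms(2) by (auto simp: qequiv_def)
  have i: "qmul D (qmul D u v) ` A = qmul D u ` qmul D v ` A" for u v A by (simp add: image_image qmul_assoc)
  have inj: "inj (qmul D u)" if "u \<noteq> 0" for u using qmul_cancel[OF that] by (auto intro: injI)
  have "(a, 0) \<in> qlattice 1 a b" using lattice_gens(1)[of 1 a b] by simp
  then have "qmul D x' (a, 0) \<in> qmul D x ` J" unfolding x(3) by blast
  then obtain y where y: "y \<in> J" "qmul D x' (a, 0) = qmul D x y" by blast
  have "qmul D x ` qmul D (a, 0) ` J = qmul D (a, 0) ` qmul D x ` J" by (simp add: image_image qmul_left_comm)
  also have "\<dots> = qmul D (qmul D x' (a, 0)) ` qlattice 1 a b" unfolding x(3) i[symmetric] by (simp add: qmul_comm)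
  also have "\<dots> = qmul D x ` qmul D y ` qlattice 1 a b" unfolding y(2) i ..
  finally have e: "qmul D (a, 0) ` J = qmul D y ` qlattice 1 a b" using inj_image_eq_iff[OF inj[OF x(1)]] by metis
  have J: "J = multiple y"
  proof -
    have "z \<in> J \<longleftrightarrow> qmul D (a, 0) z \<in> qmul D (a, 0) ` J" for z
      using inj_image_mem_iff[OF inj[OF a_nonzero(2)]] by metis
    then show ?thesis unfolding multiple_def e by blast
  qed
  have "y \<noteq> 0"
  proof
    assume "y = 0"
    then have "qmul D x' (a, 0) = 0" using y by simp
    then show False using x a_nonzero qmul_eq_0 by blast
  qed
  moreover have "y \<in> qlattice 1 a (- b)"
  proof -
    obtain u v where uv: "y = (u, v)" by (cases y)
    have "(b, 1) \<in> qlattice 1 a b" using lattice_gens(2)[of 1 b a] by simp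
    then obtain z where "qmul D y (b, 1) = qmul D (a, 0) z" using e by blast
    then have "u + v * b = a * snd z" by (simp add: uv qmul_def)
    then show ?thesis unfolding uv lattice_mem by (simp add: mult.commute)
  qed
  ultimately show ?thesis using J by blast
qed

text \<open>The square of a common divisor of a, b, c divides b^2 - a c = D, so the divisor is a
  unit. The resulting Bezout relation, with 2 inverted, exhibits a in the product of the lattice and
  its conjugate; this is the invertibility of the ideal.\<close>

lemma conj_lattice_unit:
  "\<exists>m\<in>qlattice 1 a (- b). \<exists>m'\<in>qlattice 1 a (- b). qmul D (a, 0) m + qmul D (b, 1) m' = (a, 0)"
proof -
  obtain c where c: "b\<^sup>2 - D = a * c" using a_dvd by (auto simp: dvd_def)
  define g where "g = gcd a (gcd b c)"
  have "g dvd a" "g dvd b" "g dvd c" unfolding g_def by (meson dvd_trans gcd_dvd1 gcd_dvd2)+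
  then have "g\<^sup>2 dvd b\<^sup>2 - a * c" by (intro dvd_diff) (auto simp: dvd_power_same power2_eq_square mult_dvd_mono)
  moreover have "b\<^sup>2 - a * c = D * 1\<^sup>2" using c by (simp add: algebra_simps)
  ultimately have "g dvd 1" using sqfree by metis
  then have "gcd a (gcd b c) = 1" by (simp add: g_def)
  then obtain r r' s' t' where "r * a + r' * gcd b c = 1" "s' * b + t' * c = gcd b c"
    using bezout_coefficients_fst_snd by metis
  then have "r * a + r' * (s' * b + t' * c) = 1" by simp
  then have "r * a + (r' * s') * b + (r' * t') * c = 1" by (simp add: algebra_simps)
  moreover have "r' * s' = 2 * ([:1/2:] * (r' * s'))"
  proof -
    have "[:1/2:] * (2 :: 'a poly) = 1" using two by (simp add: numeral_poly one_pCons)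
    then have "2 * [:1/2:] = (1 :: 'a poly)" by (simp add: mult.commute)
    then show ?thesis by (simp only: mult.assoc[symmetric]) simp
  qed
  ultimately obtain s t where e: "r * a + 2 * s * b + t * c = 1" by (metis mult.assoc)
  have D: "D = b * b - a * c" using c by (simp add: algebra_simps power2_eq_square)
  let ?m = "(r * a + s * b, - s)" and ?m' = "(s * a + t * b, - t)"
  have "qmul D (a, 0) ?m + qmul D (b, 1) ?m' = (a * (r * a + 2 * s * b + t * c), 0)"
    unfolding qmul_def D by (simp add: algebra_simps)
  then have "qmul D (a, 0) ?m + qmul D (b, 1) ?m' = (a, 0)" unfolding e by simp
  moreover have "?m \<in> qlattice 1 a (- b)" "?m' \<in> qlattice 1 a (- b)" by (auto simp: lattice_mem algebra_simps)
  ultimately show ?thesis by blast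
qed

text \<open>Equal multiples mean y I = y' I. Multiplying by the conjugate of I puts y a into y' a
  times the order, and a cancels.\<close>

lemma multiple_eq_dvd:
  assumes "y \<in> qlattice 1 a (- b)" "y' \<in> qlattice 1 a (- b)" "multiple y = multiple y'"
  shows "\<exists>e. y = qmul D y' e"
proof -
  obtain m m' where m: "m \<in> qlattice 1 a (- b)" "m' \<in> qlattice 1 a (- b)" "qmul D (a, 0) m + qmul D (b, 1) m' = (a, 0)"
    using conj_lattice_unit by blast
  have im: "qmul D y ` qlattice 1 a b = qmul D y' ` qlattice 1 a b"
    using multiple_image assms by metis
  have *: "\<exists>w. qmul D y (qmul D z n) = qmul D (a, 0) (qmul D y' w)" if zn: "z \<in> qlattice 1 a b" "n \<in> qlattice 1 a (- b)" for z n
  proof -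
    have "qmul D y z \<in> qmul D y' ` qlattice 1 a b" unfolding im[symmetric] using zn by blast
    then obtain z' where z': "z' \<in> qlattice 1 a b" "qmul D y z = qmul D y' z'" by blast
    obtain w where w: "qmul D n z' = qmul D (a, 0) w" using conj_mult[OF zn(2) z'(1)] by blast
    have "qmul D y (qmul D z n) = qmul D y' (qmul D n z')"
      unfolding qmul_assoc[symmetric] z'(2) by (simp only: qmul_ac)
    also have "\<dots> = qmul D (a, 0) (qmul D y' w)" unfolding w by (rule qmul_left_comm)
    finally show ?thesis by blast
  qed
  have "(a, 0) \<in> qlattice 1 a b" "(b, 1) \<in> qlattice 1 a b" using lattice_gens[of 1 a b] lattice_gens[of 1 b a] by simp_all
  then obtain w w' where w: "qmul D y (qmul D (a, 0) m) = qmul D (a, 0) (qmul D y' w)"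
    "qmul D y (qmul D (b, 1) m') = qmul D (a, 0) (qmul D y' w')"
    using * m(1,2) by blast
  have "qmul D (a, 0) y = qmul D y (a, 0)" by (rule qmul_comm)
  also have "\<dots> = qmul D y (qmul D (a, 0) m + qmul D (b, 1) m')" by (simp only: m(3))
  also have "\<dots> = qmul D (a, 0) (qmul D y' (w + w'))" by (simp only: qmul_add w)
  finally have "y = qmul D y' (w + w')" using qmul_cancel[OF a_nonzero(2)] by blast
  then show ?thesis by blast
qed

text \<open>The two generators differ by a unit e of the order. Its norm is constant, and
  \<open>degree_qnorm_less\<close> then leaves only constants; so each ideal arises from exactly q -
  1 elements.\<close>

lemma multiple_eq_iff:
  assumes "y \<in> qlattice 1 a (- b)" "y' \<in> qlattice 1 a (- b)" "y \<noteq> 0" "y' \<noteq> 0"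
  shows "multiple y' = multiple y \<longleftrightarrow> (\<exists>c. c \<noteq> 0 \<and> y' = qmul D ([:c:], 0) y)"
proof
  assume m: "multiple y' = multiple y"
  obtain e where e: "y' = qmul D y e" using multiple_eq_dvd assms m by metis
  obtain e' where e': "y = qmul D y' e'" using multiple_eq_dvd assms m by metis
  have "qmul D y (1, 0) = qmul D y (qmul D e e')" using e e' by (metis qmul_assoc qmul_simps(2))
  then have "qmul D e e' = (1, 0)" using qmul_cancel[OF assms(3)] by metis
  then have "qnorm D e * qnorm D e' = 1" using qnorm_mult[of D e e'] by simp
  then have d: "deg (qnorm D e) < 1" by (metis degree_1 degree_mult_eq add_eq_0_iff_both_eq_0 less_one mult_eq_0_iff zero_neq_one)
  have e0: "e \<noteq> 0" using e assms by auto
  then have s: "snd e = 0" "fst e = 0 \<or> deg (fst e) = 0"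
    using degree_qnorm_less[of "fst e" "snd e" 1] d deg_pos by auto
  then obtain c where "e = ([:c:], 0)" by (metis degree_eq_zeroE prod.collapse pCons_0_0)
  then show "\<exists>c. c \<noteq> 0 \<and> y' = qmul D ([:c:], 0) y" using e e0 by (auto simp: qmul_comm zero_prod_def)
next
  assume "\<exists>c. c \<noteq> 0 \<and> y' = qmul D ([:c:], 0) y"
  then obtain c where c: "c \<noteq> 0" "y' = qmul D ([:c:], 0) y" by blast
  have sc: "qmul D ([:d:], 0) z \<in> qlattice 1 a b" if "z \<in> qlattice 1 a b" for d z
    using that M_qideal unfolding qideal_def by blast
  have "qmul D y' ` qlattice 1 a b = qmul D y ` qlattice 1 a b"
  proof (rule equalityI; rule subsetI)
    fix w assume "w \<in> qmul D y' ` qlattice 1 a b"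
    then obtain z where z: "z \<in> qlattice 1 a b" "w = qmul D y' z" by blast
    have "w = qmul D y (qmul D ([:c:], 0) z)" unfolding z c by (simp only: qmul_ac)
    then show "w \<in> qmul D y ` qlattice 1 a b" using sc z by blast
  next
    fix w assume "w \<in> qmul D y ` qlattice 1 a b"
    then obtain z where z: "z \<in> qlattice 1 a b" "w = qmul D y z" by blast
    have "qmul D ([:c:], 0) ([:inverse c:], 0) = (1, 0)" using c by (simp add: one_pCons)
    then have "w = qmul D (qmul D ([:c:], 0) ([:inverse c:], 0)) w" by simp
    then have "w = qmul D y' (qmul D ([:inverse c:], 0) z)" unfolding z c by (simp only: qmul_ac)
    then show "w \<in> qmul D y' ` qlattice 1 a b" using sc z by blast
  qed
  then show "multiple y' = multiple y" unfolding multiple_def by simp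
qed

definition class_count :: "nat \<Rightarrow> nat" where
  "class_count n = card {J. qideal D J \<and> qequiv D J (qlattice 1 a b) \<and> index_degree J = n}"

lemma class_count_elements:
  "finite {J. qideal D J \<and> qequiv D J (qlattice 1 a b) \<and> index_degree J = n}" (is "finite ?A")
  "card {y \<in> qlattice 1 a (- b). y \<noteq> 0 \<and> deg (qnorm D y) = n + deg a} = (q - 1) * class_count n"
proof -
  let ?Y = "{y \<in> qlattice 1 a (- b). y \<noteq> 0 \<and> deg (qnorm D y) = n + deg a}"
  have "finite {y \<in> qlattice 1 a (- b). y = 0 \<or> deg (qnorm D y) < n + 2 * deg a + deg D + 1}"
    by (rule card_lattice_below(1)[OF a_monic]) auto
  then have fin: "finite ?Y" by (rule finite_subset[rotated]) auto
  have A: "?A = multiple ` ?Y"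
  proof (rule equalityI; rule subsetI)
    fix J assume "J \<in> ?A"
    then obtain y where "y \<in> qlattice 1 a (- b)" "y \<noteq> 0" "J = multiple y" "index_degree J = n" using ideal_multiple by blast
    then show "J \<in> multiple ` ?Y" using multiple_ideal(3)[of y] by blast
  next
    fix J assume "J \<in> multiple ` ?Y"
    then show "J \<in> ?A" using multiple_ideal by force
  qed
  then show "finite ?A" using fin by simp
  have fib: "card {y \<in> ?Y. multiple y = J} = q - 1" if J: "J \<in> multiple ` ?Y" for J
  proof -
    obtain y where y: "y \<in> ?Y" "J = multiple y" using J by blast
    have "{y' \<in> ?Y. multiple y' = J} = (\<lambda>c. qmul D ([:c:], 0) y) ` (UNIV - {0})"
    proof (rule equalityI; rule subsetI)
      fix y' assume "y' \<in> {y' \<in> ?Y. multiple y' = J}"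
      then show "y' \<in> (\<lambda>c. qmul D ([:c:], 0) y) ` (UNIV - {0})" using multiple_eq_iff[of y y'] y by auto
    next
      fix y' assume "y' \<in> (\<lambda>c. qmul D ([:c:], 0) y) ` (UNIV - {0})"
      then obtain c where c: "c \<noteq> 0" "y' = qmul D ([:c:], 0) y" by blast
      obtain u v where uv: "y = (u, v)" by (cases y)
      have "y' \<in> qlattice 1 a (- b)"
        using y(1) c unfolding uv lattice_mem by (simp add: lattice_mem, metis dvd_smult smult_add_right)
      moreover have "y' \<noteq> 0" using c y uv by (auto simp: zero_prod_def)
      moreover have "deg (qnorm D y') = deg (qnorm D y)"
      proof -
        have "qnorm D y' = Polynomial.smult (c\<^sup>2) (qnorm D y)" using c by (simp add: qnorm_mult power2_eq_square)
        then show ?thesis using c by simp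
      qed
      ultimately have "y' \<in> ?Y" using y by simp
      then show "y' \<in> {y' \<in> ?Y. multiple y' = J}" using multiple_eq_iff[of y y'] y c by blast
    qed
    moreover have "inj_on (\<lambda>c. qmul D ([:c:], 0) y) (UNIV - {0})"
    proof (rule inj_onI)
      fix c d assume "qmul D ([:c:], 0) y = qmul D ([:d:], 0) y"
      then have "qmul D y ([:c:], 0) = qmul D y ([:d:], 0)" by (metis qmul_comm)
      then show "c = d" using qmul_cancel[of y] y by auto
    qed
    ultimately show ?thesis by (simp add: card_image q_card)
  qed
  have "card ?Y = (\<Sum>J\<in>multiple ` ?Y. card {y \<in> ?Y. multiple y = J})"
    by (simp only: card_eq_sum) (rule sum.image_gen[OF fin])
  also have "\<dots> = (q - 1) * class_count n" using fib A by (simp add: class_count_def)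
  finally show "card ?Y = (q - 1) * class_count n" .
qed

text \<open>The number c of lattice elements with norm degree below N + deg a, zero included, is a
  power of q. One degree further it is multiplied by q^2 or stays the same, according to the parity
  of N + deg a. Both c - 1 and the increment are q - 1 times a number of ideals.\<close>

lemma class_count_sum:
  assumes N: "N \<ge> deg D"
  shows "int (class_count N) - int (q - 1) * (\<Sum>n<N. int (class_count n)) =
    1 + (if even (N + deg a) then 1 else - 1) * int q ^ (N + 1 - deg D div 2)"
proof -
  let ?Y = "\<lambda>n. {y \<in> qlattice 1 a (- b). y \<noteq> 0 \<and> deg (qnorm D y) = n + deg a}"
  let ?C = "\<lambda>m. {y \<in> qlattice 1 a (- b). y = 0 \<or> deg (qnorm D y) < m}"
  have Na: "N \<ge> deg a" "N \<ge> deg a + deg D div 2" using small N by auto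
  have fC: "finite (?C m)" if "m \<ge> N + deg a" for m
    using that Na N by (intro card_lattice_below(1)[OF a_monic]) auto
  have cC: "card (?C m) = q ^ ((m + 1) div 2 - deg a) * q ^ ((m + 1) div 2 - deg D div 2)" if "m \<ge> N + deg a" for m
    using that Na N by (intro card_lattice_below(2)[OF a_monic]) auto
  have fY: "finite (?Y n)" for n
  proof -
    have "finite (?C (N + deg a + n + deg a + 1))" by (rule fC) simp
    then show ?thesis by (rule finite_subset[rotated]) auto
  qed
  have zero: "0 \<in> qlattice 1 a (- b)" by (auto simp: qlattice_def zero_prod_def intro!: exI[of _ 0])
  have dY: "deg a \<le> deg (qnorm D y)" if "y \<in> qlattice 1 a (- b)" "y \<noteq> 0" for y
    using multiple_ideal(3)[OF that] by simp
  have "?C (N + deg a) = insert 0 (\<Union>n\<in>{..<N}. ?Y n)"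
  proof (rule equalityI; rule subsetI)
    fix y assume y: "y \<in> ?C (N + deg a)"
    show "y \<in> insert 0 (\<Union>n\<in>{..<N}. ?Y n)"
    proof (cases "y = 0")
      case False
      then have "deg a \<le> deg (qnorm D y)" "deg (qnorm D y) < N + deg a" using dY y by auto
      then have "y \<in> ?Y (deg (qnorm D y) - deg a)" "deg (qnorm D y) - deg a < N" using False y by auto
      then show ?thesis by blast
    qed simp
  qed (use zero in auto)
  moreover have "card (insert 0 (\<Union>n\<in>{..<N}. ?Y n)) = Suc (\<Sum>n<N. card (?Y n))"
  proof -
    have U: "finite (\<Union>n\<in>{..<N}. ?Y n)" by (intro finite_UN_I) (auto simp: fY)
    have "0 \<notin> (\<Union>n\<in>{..<N}. ?Y n)" by simp
    note card_insert_disjoint[OF U this]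
    moreover have "card (\<Union>n\<in>{..<N}. ?Y n) = (\<Sum>n<N. card (?Y n))"
    proof (rule card_UN_disjoint)
      show "\<forall>i\<in>{..<N}. \<forall>j\<in>{..<N}. i \<noteq> j \<longrightarrow> ?Y i \<inter> ?Y j = {}"
        by (intro ballI impI equals0I) simp
    qed (simp_all add: fY)
    ultimately show ?thesis by simp
  qed
  ultimately have 1: "card (?C (N + deg a)) = Suc ((q - 1) * (\<Sum>n<N. class_count n))"
    by (simp add: class_count_elements(2) sum_distrib_left)
  have "(y = 0 \<or> deg (qnorm D y) < N + deg a + 1) \<longleftrightarrow>
      (y = 0 \<or> deg (qnorm D y) < N + deg a) \<or> (y \<noteq> 0 \<and> deg (qnorm D y) = N + deg a)" for y
    by (cases "y = 0") (simp_all add: less_Suc_eq)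
  then have "?C (N + deg a + 1) = ?C (N + deg a) \<union> ?Y N" by blast
  moreover have "?C (N + deg a) \<inter> ?Y N = {}" by auto
  ultimately have "card (?C (N + deg a + 1)) = card (?C (N + deg a)) + card (?Y N)"
    using card_Un_disjoint[OF fC[of "N + deg a"] fY[of N]] by simp
  then have 2: "card (?C (N + deg a + 1)) = card (?C (N + deg a)) + (q - 1) * class_count N"
    by (simp add: class_count_elements(2))
  define c where "c = int (card (?C (N + deg a)))"
  define c' where "c' = int (card (?C (N + deg a + 1)))"
  define S where "S = (\<Sum>n<N. int (class_count n))"
  have q1: "int (q - 1) = int q - 1" using q_ge_2 by simp
  have e1: "c = 1 + (int q - 1) * S" using 1 q_ge_2 by (simp add: c_def S_def)
  have e2: "c' = c + (int q - 1) * int (class_count N)" using 2 q_ge_2 by (simp add: c_def c'_def)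
  have e3: "(int q - 1) * (int (class_count N) - (int q - 1) * S) = c' - c - (int q - 1) * (c - 1)"
  proof -
    have "c - 1 = (int q - 1) * S" "c' - c = (int q - 1) * int (class_count N)" using e1 e2 by simp_all
    then show ?thesis by (simp only: right_diff_distrib)
  qed
  have "c' - c - (int q - 1) * (c - 1) = (int q - 1) *
      (1 + (if even (N + deg a) then 1 else - 1) * int q ^ (N + 1 - deg D div 2))"
  proof (cases "even (N + deg a)")
    case True
    then obtain B where B: "N + deg a = 2 * B" by blast
    define x where "x = B - deg a" define y where "y = B - deg D div 2"
    have le: "deg a \<le> B" "deg D div 2 \<le> B" using B Na N by auto
    have c: "c = int q ^ x * int q ^ y" using cC[of "N + deg a"] by (simp add: c_def x_def y_def B)
    have "(2 * B + 1 + 1) div 2 - deg a = Suc x" "(2 * B + 1 + 1) div 2 - deg D div 2 = Suc y"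
      using le by (auto simp: x_def y_def)
    then have c': "c' = int q ^ Suc x * int q ^ Suc y" unfolding c'_def using cC[of "N + deg a + 1"] by (simp add: B)
    have "N + 1 - deg D div 2 = Suc (x + y)" using B le by (auto simp: x_def y_def)
    then show ?thesis using True unfolding c c' by (simp add: power_add algebra_simps)
  next
    case False
    then obtain B where B: "N + deg a = 2 * B + 1" by (elim oddE)
    define x where "x = Suc B - deg a" define y where "y = Suc B - deg D div 2"
    have le: "deg a \<le> Suc B" "deg D div 2 \<le> Suc B" using B Na N by auto
    have c: "c = int q ^ x * int q ^ y" using cC[of "N + deg a"] by (simp add: c_def x_def y_def B)
    have c': "c' = int q ^ x * int q ^ y" using cC[of "N + deg a + 1"] by (simp add: c'_def x_def y_def B)
    have "N + 1 - deg D div 2 = x + y" using B le by (auto simp: x_def y_def)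
    then show ?thesis using False unfolding c c' by (simp add: power_add algebra_simps)
  qed
  then have "(int q - 1) * (int (class_count N) - (int q - 1) * S) = (int q - 1) *
      (1 + (if even (N + deg a) then 1 else - 1) * int q ^ (N + 1 - deg D div 2))" using e3 by simp
  moreover have "int q - 1 \<noteq> 0" using q_ge_2 by simp
  ultimately show ?thesis unfolding q1 S_def by (metis mult_left_cancel)
qed

end

section \<open>Summation over all ideal classes\<close>

context imaginary_order
begin

text \<open>Stated with normal forms because the evaluation by quadratic symbols runs over triples;
  \<open>ideal_count_eq\<close> returns to ideals.\<close>

definition ideal_count :: "nat \<Rightarrow> nat" where
  "ideal_count n = card {(g, a, b). ideal_triple D g a b \<and> 2 * deg g + deg a = n}"

lemma ideal_count_eq: "ideal_count n = card {J. qideal D J \<and> index_degree J = n}"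
proof -
  let ?T = "{(g, a, b). ideal_triple D g a b \<and> 2 * deg g + deg a = n}"
  have "bij_betw (\<lambda>(g, a, b). qlattice g a b) ?T {J. qideal D J \<and> index_degree J = n}"
    unfolding bij_betw_def
  proof
    show "inj_on (\<lambda>(g, a, b). qlattice g a b) ?T"
      using lattice_eqD by (auto simp: inj_on_def)
    show "(\<lambda>(g, a, b). qlattice g a b) ` ?T = {J. qideal D J \<and> index_degree J = n}"
    proof (rule equalityI; rule subsetI)
      fix J assume "J \<in> (\<lambda>(g, a, b). qlattice g a b) ` ?T"
      then obtain g a b where t: "ideal_triple D g a b" "2 * deg g + deg a = n" "J = qlattice g a b" by auto
      then have "g \<noteq> 0" "a \<noteq> 0" "a dvd b\<^sup>2 - D" by (auto simp: ideal_triple_def)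
      then show "J \<in> {J. qideal D J \<and> index_degree J = n}" using lattice_qideal index_degree_lattice(1) t by auto
    next
      fix J assume J: "J \<in> {J. qideal D J \<and> index_degree J = n}"
      then obtain g a b where t: "ideal_triple D g a b" "J = qlattice g a b" using qideal_lattice by blast
      then have "g \<noteq> 0" "a \<noteq> 0" by (auto simp: ideal_triple_def)
      then have "2 * deg g + deg a = n" using J t(2) index_degree_lattice(1) by auto
      then show "J \<in> (\<lambda>(g, a, b). qlattice g a b) ` ?T" using t by auto
    qed
  qed
  then show ?thesis unfolding ideal_count_def by (rule bij_betw_same_card)
qed

text \<open>Summing \<open>class_count_sum\<close> over the classes gives h as their number plus
  \<epsilon> times a power of q. From one N to the next, \<epsilon> changes sign and the power gains
  a factor q, while h stays the same; hence \<epsilon> = 0, that is, representatives with deg a even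
  and odd are equally frequent.\<close>

theorem card_classes:
  fixes f :: "('a poly \<times> 'a poly) set \<Rightarrow> 'c" and h :: int
  assumes f: "\<And>J J'. qideal D J \<Longrightarrow> qideal D J' \<Longrightarrow> f J = f J' \<longleftrightarrow> qequiv D J J'"
    and h: "\<And>N. N \<ge> deg D \<Longrightarrow> int (ideal_count N) - int (q - 1) * (\<Sum>n<N. int (ideal_count n)) = h"
  shows "int (card (f ` {J. qideal D J})) = h"
proof -
  let ?K = "f ` {J. qideal D J}"
  let ?R = "{(a, b). ideal_triple D 1 a b \<and> 2 * deg a \<le> deg D}"
  have finR: "finite ?R"
  proof (rule finite_subset)
    show "?R \<subseteq> polys_below (Suc (deg D)) \<times> polys_below (Suc (deg D))"
      by (auto simp: ideal_triple_def polys_below_def)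
  qed simp
  have tq: "qideal D (qlattice 1 a b)" if "ideal_triple D 1 a b" for a b
  proof -
    have "a \<noteq> 0" "a dvd b\<^sup>2 - D" using that by (auto simp: ideal_triple_def)
    then show ?thesis using lattice_qideal[of 1 a b] by simp
  qed
  have "?K \<subseteq> (\<lambda>(a, b). f (qlattice 1 a b)) ` ?R"
  proof
    fix \<kappa> assume "\<kappa> \<in> ?K"
    then obtain J where J: "qideal D J" "\<kappa> = f J" by blast
    obtain a b where ab: "ideal_triple D 1 a b" "2 * deg a \<le> deg D" "qequiv D J (qlattice 1 a b)"
      using qequiv_small_rep[OF J(1)] by blast
    then have "\<kappa> = f (qlattice 1 a b)" using f[OF J(1) tq] J by blast
    then show "\<kappa> \<in> (\<lambda>(a, b). f (qlattice 1 a b)) ` ?R" using ab by auto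
  qed
  then have finK: "finite ?K" using finR finite_surj by blast
  have "\<forall>\<kappa>\<in>?K. \<exists>ab. ideal_triple D 1 (fst ab) (snd ab) \<and> 2 * deg (fst ab) \<le> deg D \<and> f (qlattice 1 (fst ab) (snd ab)) = \<kappa>"
  proof
    fix \<kappa> assume "\<kappa> \<in> ?K"
    then obtain J where J: "qideal D J" "\<kappa> = f J" by blast
    obtain a b where ab: "ideal_triple D 1 a b" "2 * deg a \<le> deg D" "qequiv D J (qlattice 1 a b)"
      using qequiv_small_rep[OF J(1)] by blast
    then have "f (qlattice 1 a b) = \<kappa>" using f[OF J(1) tq] J by metis
    then show "\<exists>ab. ideal_triple D 1 (fst ab) (snd ab) \<and> 2 * deg (fst ab) \<le> deg D \<and> f (qlattice 1 (fst ab) (snd ab)) = \<kappa>"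
      using ab by (intro exI[of _ "(a, b)"]) auto
  qed
  then obtain r where r: "\<And>\<kappa>. \<kappa> \<in> ?K \<Longrightarrow> ideal_triple D 1 (fst (r \<kappa>)) (snd (r \<kappa>)) \<and> 2 * deg (fst (r \<kappa>)) \<le> deg D \<and> f (qlattice 1 (fst (r \<kappa>)) (snd (r \<kappa>))) = \<kappa>"
    by metis
  define cnt where "cnt \<kappa> n = card {J. qideal D J \<and> f J = \<kappa> \<and> index_degree J = n}" for \<kappa> n
  have sm: "small_ideal D q (fst (r \<kappa>)) (snd (r \<kappa>))" if "\<kappa> \<in> ?K" for \<kappa>
    using r[OF that] by (intro small_ideal.intro imaginary_order_axioms) (simp add: small_ideal_axioms_def)
  have same: "{J. qideal D J \<and> f J = \<kappa> \<and> index_degree J = n} =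
      {J. qideal D J \<and> qequiv D J (qlattice 1 (fst (r \<kappa>)) (snd (r \<kappa>))) \<and> index_degree J = n}" if "\<kappa> \<in> ?K" for \<kappa> n
  proof (rule Collect_cong)
    fix J
    have "ideal_triple D 1 (fst (r \<kappa>)) (snd (r \<kappa>))" "f (qlattice 1 (fst (r \<kappa>)) (snd (r \<kappa>))) = \<kappa>"
      using r[OF that] by auto
    then have "f J = \<kappa> \<longleftrightarrow> qequiv D J (qlattice 1 (fst (r \<kappa>)) (snd (r \<kappa>)))" if "qideal D J"
      using f[OF that tq] by metis
    then show "(qideal D J \<and> f J = \<kappa> \<and> index_degree J = n) \<longleftrightarrow>
        (qideal D J \<and> qequiv D J (qlattice 1 (fst (r \<kappa>)) (snd (r \<kappa>))) \<and> index_degree J = n)" by blast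
  qed
  have fin: "finite {J. qideal D J \<and> f J = \<kappa> \<and> index_degree J = n}" if "\<kappa> \<in> ?K" for \<kappa> n
    unfolding same[OF that] by (rule small_ideal.class_count_elements(1)[OF sm[OF that]])
  have cs: "int (cnt \<kappa> N) - int (q - 1) * (\<Sum>n<N. int (cnt \<kappa> n)) =
      1 + (if even (N + deg (fst (r \<kappa>))) then 1 else - 1) * int q ^ (N + 1 - deg D div 2)"
    if "\<kappa> \<in> ?K" "N \<ge> deg D" for \<kappa> N
    using small_ideal.class_count_sum[OF sm[OF that(1)] that(2)]
    unfolding small_ideal.class_count_def[OF sm[OF that(1)]] cnt_def same[OF that(1)] .
  have tot: "ideal_count n = (\<Sum>\<kappa>\<in>?K. cnt \<kappa> n)" for n
  proof -
    have "{J. qideal D J \<and> index_degree J = n} = (\<Union>\<kappa>\<in>?K. {J. qideal D J \<and> f J = \<kappa> \<and> index_degree J = n})" by auto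
    moreover have "card (\<Union>\<kappa>\<in>?K. {J. qideal D J \<and> f J = \<kappa> \<and> index_degree J = n}) = (\<Sum>\<kappa>\<in>?K. cnt \<kappa> n)"
      unfolding cnt_def by (rule card_UN_disjoint) (use finK fin in auto)
    ultimately show ?thesis unfolding ideal_count_eq by simp
  qed
  define \<epsilon> where "\<epsilon> N = (\<Sum>\<kappa>\<in>?K. (if even (N + deg (fst (r \<kappa>))) then 1 else - 1 :: int))" for N
  have main: "h = int (card ?K) + \<epsilon> N * int q ^ (N + 1 - deg D div 2)" if N: "N \<ge> deg D" for N
  proof -
    have "h = (\<Sum>\<kappa>\<in>?K. int (cnt \<kappa> N)) - int (q - 1) * (\<Sum>n<N. \<Sum>\<kappa>\<in>?K. int (cnt \<kappa> n))"
      using h[OF N] by (simp add: tot)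
    also have "(\<Sum>n<N. \<Sum>\<kappa>\<in>?K. int (cnt \<kappa> n)) = (\<Sum>\<kappa>\<in>?K. \<Sum>n<N. int (cnt \<kappa> n))" by (rule sum.swap)
    also have "(\<Sum>\<kappa>\<in>?K. int (cnt \<kappa> N)) - int (q - 1) * (\<Sum>\<kappa>\<in>?K. \<Sum>n<N. int (cnt \<kappa> n)) =
        (\<Sum>\<kappa>\<in>?K. int (cnt \<kappa> N) - int (q - 1) * (\<Sum>n<N. int (cnt \<kappa> n)))"
      by (simp add: sum_subtractf sum_distrib_left)
    also have "\<dots> = (\<Sum>\<kappa>\<in>?K. 1 + (if even (N + deg (fst (r \<kappa>))) then 1 else - 1) * int q ^ (N + 1 - deg D div 2))"
      using cs N by (intro sum.cong) auto
    also have "\<dots> = int (card ?K) + \<epsilon> N * int q ^ (N + 1 - deg D div 2)"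
      by (simp add: sum.distrib \<epsilon>_def sum_distrib_right)
    finally show ?thesis .
  qed
  have flip: "\<epsilon> (Suc N) = - \<epsilon> N" for N
    unfolding \<epsilon>_def sum_negf[symmetric] by (intro sum.cong) auto
  let ?N = "deg D"
  have "\<epsilon> ?N * int q ^ (?N + 1 - ?N div 2) = - \<epsilon> ?N * int q ^ (Suc ?N + 1 - ?N div 2)"
    using main[of ?N] main[of "Suc ?N"] flip[of ?N] by simp
  moreover have "Suc ?N + 1 - ?N div 2 = Suc (?N + 1 - ?N div 2)" by simp
  ultimately have "\<epsilon> ?N * (int q ^ (?N + 1 - ?N div 2) * (1 + int q)) = 0" by (simp add: algebra_simps)
  moreover have "int q ^ (?N + 1 - ?N div 2) * (1 + int q) \<noteq> 0" using q_ge_2 by auto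
  ultimately have "\<epsilon> ?N = 0" by (metis mult_eq_0_iff)
  then show ?thesis using main[of ?N] by simp
qed

end

section \<open>Quadratic symbols\<close>

abbreviation lift :: "'a::field_gcd poly \<Rightarrow> 'a alg_closure poly" where
  "lift \<equiv> map_poly to_ac"

definition ev :: "'a::field_gcd poly \<Rightarrow> 'a alg_closure \<Rightarrow> 'a alg_closure" where
  "ev f x = poly (lift f) x"

lemma lift_add: "lift (f + g) = lift f + lift g"
  by (rule poly_eqI) (simp add: coeff_map_poly)

lemma lift_mult: "lift (f * g) = lift f * lift g"
  by (rule poly_eqI) (simp add: coeff_map_poly coeff_mult to_ac_sum)

lemma lift_diff: "lift (f - g) = lift f - lift g"
  by (rule poly_eqI) (simp add: coeff_map_poly)

lemma lift_eq_iff [simp]: "lift f = lift g \<longleftrightarrow> f = g"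
  by (auto simp: poly_eq_iff coeff_map_poly)

lemma lift_pCons: "lift (pCons a f) = pCons (to_ac a) (lift f)"
  by (rule map_poly_pCons) simp

lemma deg_lift [simp]: "deg (lift f) = deg f"
  by (rule degree_map_poly) simp

lemma lead_coeff_lift: "Polynomial.lead_coeff (lift f) = to_ac (Polynomial.lead_coeff f)"
  by (simp add: coeff_map_poly)

lemma ev_simps [simp]: "ev (f + g) x = ev f x + ev g x" "ev (f - g) x = ev f x - ev g x"
  "ev (f * g) x = ev f x * ev g x" "ev 0 x = 0" "ev 1 x = 1" "ev (pCons a f) x = to_ac a + x * ev f x"
  "ev (Polynomial.smult c f) x = to_ac c * ev f x"
proof -
  show "ev (f * g) x = ev f x * ev g x" for f g by (simp add: ev_def lift_mult)
  show "ev (pCons a f) x = to_ac a + x * ev f x" for a f by (simp add: ev_def lift_pCons)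
  from this show "ev (Polynomial.smult c f) x = to_ac c * ev f x"
    using \<open>\<And>f g. ev (f * g) x = ev f x * ev g x\<close>[of "[:c:]" f] by (simp add: ev_def lift_pCons)
qed (simp_all add: ev_def lift_add lift_diff)

lemma ev_power [simp]: "ev (f ^ n) x = ev f x ^ n"
  by (induction n) simp_all

instance alg_closure :: (finite_field) field_prime_char
  by standard (auto intro!: exI[of _ "CHAR('a)"])

text \<open>Fermat's argument: multiplication by a nonzero y permutes the nonzero elements of
  S.\<close>

lemma group_power_card:
  fixes S :: "'k::Fields.field set"
  assumes "finite S" "\<And>x y. x \<in> S \<Longrightarrow> y \<in> S \<Longrightarrow> x * y \<in> S" "y \<in> S" "0 \<in> S"
  shows "y ^ card S = y"
proof (cases "y = 0")
  case True
  then show ?thesis using assms by (metis card_gt_0_iff empty_iff power_0_left neq0_conv)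
next
  case False
  have "inj_on ((*) y) (S - {0})" using False by (auto simp: inj_on_def)
  moreover have "(*) y ` (S - {0}) \<subseteq> S - {0}" using assms False by auto
  ultimately have "(*) y ` (S - {0}) = S - {0}" using assms(1) by (intro endo_inj_surj) auto
  then have "\<Prod>(S - {0}) = (\<Prod>x\<in>S - {0}. y * x)"
    using prod.reindex[OF \<open>inj_on ((*) y) (S - {0})\<close>, of "\<lambda>x. x"] by simp
  also have "\<dots> = y ^ (card S - 1) * \<Prod>(S - {0})" using assms by (simp add: prod.distrib)
  finally have "y ^ (card S - 1) = 1" using assms(1) by simp
  then have "y ^ Suc (card S - 1) = y" by simp
  moreover have "card S > 0" using assms by (auto simp: card_gt_0_iff)
  ultimately show ?thesis by simp
qed

section \<open>Frobenius and residue fields inside the algebraic closure\<close>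

locale finite_base =
  fixes F :: "'a::{finite_field,field_gcd} itself" and q :: nat
  assumes q_card: "q = card (UNIV :: 'a set)" and q_primepow: "primepow q" and q_odd: "odd q"
begin

lemma q_ge_3: "q \<ge> 3"
  using primepow_gt_Suc_0[OF q_primepow] q_odd by (cases "q = 2") auto

lemma q_pos [simp]: "0 < q"
  using q_ge_3 by simp

text \<open>Translation by 1 permutes the field, so adding 1 to each of the q summands leaves the
  sum of all elements unchanged.\<close>

lemma of_nat_q: "of_nat q = (0 :: 'a)"
proof -
  have "(\<Sum>x\<in>UNIV. x + 1) = (\<Sum>x\<in>(UNIV :: 'a set). x)"
    by (rule sum.reindex_bij_witness[of _ "\<lambda>x. x - 1" "\<lambda>x. x + 1"]) auto
  then show ?thesis by (simp add: sum.distrib q_card)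
qed

lemma q_CHAR: "\<exists>n. q = CHAR('a alg_closure) ^ n"
proof -
  obtain r n where r: "prime r" "q = r ^ n" using q_primepow by (auto simp: primepow_def)
  have "CHAR('a) dvd q" using of_nat_q of_nat_eq_0_iff_char_dvd by blast
  then have "CHAR('a) dvd r" unfolding r(2) using prime_dvd_power[OF CHAR_prime[where ?'a = 'a]] by blast
  then have "CHAR('a) = r" using r(1) CHAR_prime[where ?'a = 'a] primes_dvd_imp_eq by blast
  then show ?thesis using r(2) by auto
qed

lemma two_nonzero: "(2::'a) \<noteq> 0" "(2::'a alg_closure) \<noteq> 0"
proof -
  show *: "(2::'a) \<noteq> 0"
  proof
    assume "(2::'a) = 0"
    then have "of_nat 2 = (0 :: 'a)" by simp
    then have "CHAR('a) dvd 2" using of_nat_eq_0_iff_char_dvd by blast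
    moreover obtain n where "q = CHAR('a) ^ n" using q_CHAR by auto
    ultimately show False
      using q_odd CHAR_prime[where ?'a = 'a] q_ge_3 by (metis dvd_power even_power gr0I power_0 primes_dvd_imp_eq two_is_prime_nat Suc_1 Suc_n_not_le_n numeral_3_eq_3 One_nat_def le_SucI not_less_eq_eq odd_one)
  qed
  have "to_ac (2::'a) \<noteq> 0" using * by (simp only: to_ac_eq_0_iff not_False_eq_True)
  then show "(2::'a alg_closure) \<noteq> 0" by simp
qed

lemma frob_add: "(x + y :: 'a alg_closure) ^ (q ^ n) = x ^ (q ^ n) + y ^ (q ^ n)"
proof -
  obtain m where "q = CHAR('a alg_closure) ^ m" using q_CHAR by blast
  then have "q ^ n = CHAR('a alg_closure) ^ (m * n)" by (simp add: power_mult)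
  then show ?thesis by (rule freshmans_dream'[OF CHAR_prime])
qed

lemma q_pow_odd: "odd (q ^ n)"
  using q_odd by simp

lemma frob_minus: "(- x :: 'a alg_closure) ^ (q ^ n) = - (x ^ (q ^ n))"
  using q_pow_odd by simp

lemma frob_diff: "(x - y :: 'a alg_closure) ^ (q ^ n) = x ^ (q ^ n) - y ^ (q ^ n)"
  using frob_add[of x "- y" n] frob_minus by simp

lemma frob_inj: "(x :: 'a alg_closure) ^ (q ^ n) = y ^ (q ^ n) \<longleftrightarrow> x = y"
proof
  assume "x ^ (q ^ n) = y ^ (q ^ n)"
  then have "(x - y) ^ (q ^ n) = 0" by (simp add: frob_diff)
  then show "x = y" by simp
qed simp

lemma to_ac_frob: "to_ac (c::'a) ^ (q ^ n) = to_ac c"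
  using finite_field_power_card_power_eq_same[of "q ^ n" n c] by (simp add: q_card flip: to_ac_power)

lemma ev_frob: "ev (f :: 'a poly) (x ^ (q ^ n)) = ev f x ^ (q ^ n)"
  by (induction f) (simp_all add: frob_add to_ac_frob power_mult_distrib q_ge_3 zero_power)

lemma deg_frob_poly:
  assumes "n > 0"
  defines "f \<equiv> Polynomial.monom 1 (q ^ n) - [:0, 1:] :: 'a alg_closure poly"
  shows "deg f = q ^ n"
proof -
  have 1: "1 < q ^ n" using q_ge_3 assms by (intro one_less_power) auto
  have "deg (Polynomial.monom 1 (q ^ n) + - [:0, 1:] :: 'a alg_closure poly) = deg (Polynomial.monom 1 (q ^ n) :: 'a alg_closure poly)"
    by (rule degree_add_eq_left) (use 1 in \<open>simp add: degree_monom_eq\<close>)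
  then show "deg f = q ^ n" unfolding f_def by (metis diff_conv_add_uminus degree_monom_eq one_neq_zero)
qed

lemma card_fixed_le:
  assumes "n > 0"
  shows "finite {x :: 'a alg_closure. x ^ (q ^ n) = x}" "card {x :: 'a alg_closure. x ^ (q ^ n) = x} \<le> q ^ n"
proof -
  let ?f = "Polynomial.monom 1 (q ^ n) - [:0, 1:] :: 'a alg_closure poly"
  have 1: "1 < q ^ n" using q_ge_3 assms by (intro one_less_power) auto
  have d: "deg ?f = q ^ n" by (rule deg_frob_poly[OF assms])
  have nz: "?f \<noteq> 0"
  proof
    assume "?f = 0"
    then have "deg ?f = 0" by (simp only: degree_0)
    then show False using 1 unfolding d by linarith
  qed
  have s: "{x :: 'a alg_closure. x ^ (q ^ n) = x} = {x. poly ?f x = 0}" by (simp add: poly_monom)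
  show "finite {x :: 'a alg_closure. x ^ (q ^ n) = x}" unfolding s by (rule poly_roots_finite[OF nz])
  show "card {x :: 'a alg_closure. x ^ (q ^ n) = x} \<le> q ^ n" unfolding s using card_poly_roots_bound[OF nz] d by simp
qed

text \<open>The q elements of the base field already exhaust the at most q roots of X^q - X.\<close>

lemma frob_fixed_iff: "(x :: 'a alg_closure) ^ q = x \<longleftrightarrow> x \<in> range to_ac"
proof -
  have "range to_ac = {x :: 'a alg_closure. x ^ (q ^ 1) = x}"
  proof (rule card_seteq)
    show "range to_ac \<subseteq> {x :: 'a alg_closure. x ^ (q ^ 1) = x}" using to_ac_frob[of _ 1] by auto
    have "card (range (to_ac :: 'a \<Rightarrow> _)) = q" by (simp add: card_image inj_to_ac q_card)
    then show "card {x :: 'a alg_closure. x ^ (q ^ 1) = x} \<le> card (range (to_ac :: 'a \<Rightarrow> _))"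
      using card_fixed_le(2)[of 1] by simp
  qed (use card_fixed_le(1)[of 1] in simp)
  then show ?thesis by auto
qed

text \<open>Evaluation at \<beta> realizes the residue field of l inside the closure: the image has
  q^(deg l) elements and is closed under products, so it consists of roots of X^(q^(deg l)) - X, and
  there are no further roots.\<close>

lemma ev_below_field:
  fixes l :: "'a poly"
  assumes "irreducible l" "ev l \<beta> = 0"
  shows "(\<lambda>f. ev f \<beta>) ` polys_below (deg l) = {y. y ^ (q ^ deg l) = y}" "inj_on (\<lambda>f. ev f \<beta>) (polys_below (deg l))"
    "card {y :: 'a alg_closure. y ^ (q ^ deg l) = y} = q ^ deg l" "\<And>f. ev f \<beta> = 0 \<longleftrightarrow> l dvd f"
    "\<And>f. ev f \<beta> ^ (q ^ deg l) = ev f \<beta>"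
proof -
  let ?S = "(\<lambda>f. ev f \<beta>) ` polys_below (deg l)"
  have l0: "l \<noteq> 0" using assms(1) by auto
  have dl: "deg l > 0"
    using assms(1) l0 by (metis gr0I irreducible_not_unit is_unit_iff_degree)
  show dvd: "ev f \<beta> = 0 \<longleftrightarrow> l dvd f" for f
  proof
    assume f: "ev f \<beta> = 0"
    show "l dvd f"
    proof (rule ccontr)
      assume "\<not> l dvd f"
      then have "coprime l f" using assms(1) by (simp add: irreducible_imp_prime_elem_gcd prime_elem_imp_coprime)
      then obtain u v where "u * l + v * f = 1" using bezout_coefficients_fst_snd[of l f] by (metis coprime_iff_gcd_eq_1)
      then have "ev (u * l + v * f) \<beta> = 1" by simp
      then show False using f assms(2) by simp
    qed
  next
    assume "l dvd f"
    then show "ev f \<beta> = 0" using assms(2) by (auto elim!: dvdE)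
  qed
  show inj: "inj_on (\<lambda>f. ev f \<beta>) (polys_below (deg l))"
  proof (rule inj_onI)
    fix f g assume fg: "f \<in> polys_below (deg l)" "g \<in> polys_below (deg l)" "ev f \<beta> = ev g \<beta>"
    then have "l dvd f - g" using dvd[of "f - g"] by simp
    moreover have "f - g \<in> polys_below (deg l)" using fg by (auto simp: polys_below_iff)
    ultimately have "f - g = 0" using dvd_imp_degree_le[of l "f - g"] by (force simp: polys_below_def)
    then show "f = g" by simp
  qed
  have cS: "card ?S = q ^ deg l" using inj by (simp add: card_image card_polys_below q_card)
  have all: "ev f \<beta> \<in> ?S" for f
  proof -
    have "l dvd f - f mod l" by (simp add: minus_mod_eq_mult_div)
    then have "ev (f - f mod l) \<beta> = 0" using dvd by blast
    then have "ev f \<beta> = ev (f mod l) \<beta>" by simp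
    moreover have "f mod l \<in> polys_below (deg l)" using degree_mod_less[OF l0, of f] by (auto simp: polys_below_def)
    ultimately show ?thesis by simp
  qed
  have pw: "y ^ (q ^ deg l) = y" if "y \<in> ?S" for y
  proof -
    have "y ^ card ?S = y"
    proof (rule group_power_card)
      show "x * z \<in> ?S" if xz: "x \<in> ?S" "z \<in> ?S" for x z
      proof -
        obtain f g where "x = ev f \<beta>" "z = ev g \<beta>" using xz by blast
        then show ?thesis using all[of "f * g"] by simp
      qed
      show "0 \<in> ?S" using all[of 0] by simp
    qed (use that in auto)
    then show ?thesis by (simp add: cS)
  qed
  then show "ev f \<beta> ^ (q ^ deg l) = ev f \<beta>" for f using all by blast
  show eq: "?S = {y. y ^ (q ^ deg l) = y}"
    using card_fixed_le[OF dl] cS pw by (intro card_seteq) auto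
  show "card {y :: 'a alg_closure. y ^ (q ^ deg l) = y} = q ^ deg l" using eq cS by simp
qed

text \<open>If a smaller power of Frobenius fixed \<beta>, it would fix the whole residue field,
  which has too many elements for that.\<close>

lemma conj_distinct:
  fixes l :: "'a poly"
  assumes "irreducible l" "ev l \<beta> = 0"
  shows "inj_on (\<lambda>j. \<beta> ^ (q ^ j)) {..<deg l}"
proof -
  have "\<beta> ^ (q ^ i) \<noteq> \<beta> ^ (q ^ j)" if ij: "i < j" "j < deg l" for i j
  proof
    assume e: "\<beta> ^ (q ^ i) = \<beta> ^ (q ^ j)"
    define m where "m = j - i"
    have "q ^ j = q ^ m * q ^ i" using ij by (simp add: m_def flip: power_add)
    then have "(\<beta> ^ (q ^ m)) ^ (q ^ i) = \<beta> ^ (q ^ i)" using e by (simp add: power_mult[symmetric])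
    then have b: "\<beta> ^ (q ^ m) = \<beta>" using frob_inj by blast
    have "m > 0" using ij by (simp add: m_def)
    have sub: "{y :: 'a alg_closure. y ^ (q ^ deg l) = y} \<subseteq> {y. y ^ (q ^ m) = y}"
      unfolding ev_below_field(1)[OF assms, symmetric] by (auto simp: ev_frob[symmetric] b)
    then have "q ^ deg l \<le> card {y :: 'a alg_closure. y ^ (q ^ m) = y}"
      using card_mono[OF card_fixed_le(1)[OF \<open>m > 0\<close>] sub] ev_below_field(3)[OF assms] by simp
    also have "\<dots> \<le> q ^ m" by (rule card_fixed_le(2)[OF \<open>m > 0\<close>])
    finally have "deg l \<le> m" using q_ge_3 by (simp add: power_le_imp_le_exp)
    then show False using ij by (simp add: m_def)
  qed
  then show ?thesis unfolding inj_on_def by (metis lessThan_iff linorder_neqE_nat)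
qed

lemma monic_eq_prod_roots:
  fixes f :: "'k::Fields.field poly"
  assumes "Polynomial.lead_coeff f = 1" "inj_on r {..<deg f}" "\<And>j. j < deg f \<Longrightarrow> poly f (r j) = 0"
  shows "f = (\<Prod>j<deg f. [:- r j, 1:])"
proof (rule poly_eqI_degree_lead_coeff[where n = "deg f" and A = "r ` {..<deg f}"])
  have d: "deg (\<Prod>j<deg f. [:- r j, 1:]) = deg f" by (simp add: degree_prod_eq_sum_degree)
  moreover have "Polynomial.lead_coeff (\<Prod>j<deg f. [:- r j, 1:]) = 1" by (simp add: lead_coeff_prod)
  ultimately show "poly.coeff f (deg f) = poly.coeff (\<Prod>j<deg f. [:- r j, 1:]) (deg f)" using assms by metis
  show "deg (\<Prod>j<deg f. [:- r j, 1:]) \<le> deg f" using d by simp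
  show "deg f \<le> card (r ` {..<deg f})" using assms(2) by (simp add: card_image)
  show "poly f z = poly (\<Prod>j<deg f. [:- r j, 1:]) z" if "z \<in> r ` {..<deg f}" for z
    using that assms(3) by (auto simp: poly_prod)
qed simp

lemma irreducible_split:
  fixes l :: "'a poly"
  assumes "irreducible l" "ev l \<beta> = 0" "Polynomial.lead_coeff l = 1"
  shows "lift l = (\<Prod>j<deg l. [:- (\<beta> ^ (q ^ j)), 1:])"
  using monic_eq_prod_roots[of "lift l" "\<lambda>j. \<beta> ^ (q ^ j)"] conj_distinct[OF assms(1,2)] assms
  by (simp add: coeff_map_poly ev_def[symmetric] ev_frob zero_power)

text \<open>By Euler's criterion this is the quadratic character of the subfield with q^d elements,
  with values in the closure.\<close>

definition half_pow :: "nat \<Rightarrow> 'a alg_closure \<Rightarrow> 'a alg_closure" where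
  "half_pow d y = y ^ ((q ^ d - 1) div 2)"

lemma half_pow_mult: "half_pow d (x * y) = half_pow d x * half_pow d y"
  by (simp add: half_pow_def power_mult_distrib)

lemma half_pow_twice: "2 * ((q ^ d - 1) div 2) = q ^ d - 1"
  using q_pow_odd[of d] by simp

text \<open>The character of the extension is the character of the base field after the norm, since
  q^d - 1 is (q - 1) times the sum of the q^j.\<close>

lemma half_pow_eq_norm: "half_pow d y = (\<Prod>j<d. y ^ (q ^ j)) ^ ((q - 1) div 2)"
proof -
  have "(\<Sum>j<d. q ^ j) * (q - 1) = q ^ d - 1"
    using q_ge_3 by (induction d) (auto simp: algebra_simps diff_mult_distrib2)
  moreover have "q - 1 = 2 * ((q - 1) div 2)" using q_odd by simp
  ultimately have "(q ^ d - 1) div 2 = (\<Sum>j<d. q ^ j) * ((q - 1) div 2)"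
    by (metis mult.left_commute nonzero_mult_div_cancel_left zero_neq_numeral)
  then show ?thesis by (simp add: half_pow_def power_sum power_mult)
qed

lemma half_pow_cases:
  assumes "y ^ (q ^ d) = y" "d > 0"
  shows "y = 0 \<Longrightarrow> half_pow d y = 0" "y \<noteq> 0 \<Longrightarrow> half_pow d y = 1 \<or> half_pow d y = - 1"
proof -
  have g: "q ^ d > 1" using q_ge_3 assms(2) by (intro one_less_power) auto
  have "(q ^ d - 1) div 2 > 0" using g half_pow_twice[of d] by linarith
  then show "y = 0 \<Longrightarrow> half_pow d y = 0" by (simp add: half_pow_def zero_power)
  assume "y \<noteq> 0"
  have "Suc (q ^ d - 1) = q ^ d" using g by simp
  then have "y * y ^ (q ^ d - 1) = y" using assms(1) by (metis power_Suc)
  then have "y ^ (q ^ d - 1) = 1" using \<open>y \<noteq> 0\<close> by simp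
  then have "(half_pow d y)\<^sup>2 = 1" unfolding half_pow_def power_mult[symmetric] by (metis half_pow_twice mult.commute)
  then show "half_pow d y = 1 \<or> half_pow d y = - 1" by (simp add: power2_eq_1_iff)
qed

text \<open>The root z is taken in the closure; z^(q^d - 1) is the half power of y and decides
  whether z lies in the subfield.\<close>

lemma half_pow_square_iff:
  assumes "y ^ (q ^ d) = y" "d > 0" "y \<noteq> 0" "z\<^sup>2 = y"
  shows "z ^ (q ^ d) = z \<longleftrightarrow> half_pow d y = 1"
proof -
  have g: "q ^ d > 1" using q_ge_3 assms(2) by (intro one_less_power) auto
  have "z \<noteq> 0" using assms by auto
  have "z ^ (q ^ d) = z * z ^ (q ^ d - 1)" using g by (metis power_Suc Suc_diff_1 less_trans zero_less_one)
  also have "z ^ (q ^ d - 1) = half_pow d y"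
    unfolding half_pow_def assms(4)[symmetric] power_mult[symmetric] half_pow_twice ..
  finally show ?thesis using \<open>z \<noteq> 0\<close> by simp
qed

end

section \<open>The quadratic symbol modulo p\<close>

locale prime_discriminant = finite_base F q
  for F :: "'a::{finite_field,field_gcd} itself" and q +
  fixes p :: "'a poly" and e :: 'a and \<theta> :: "'a alg_closure"
  assumes p_irred: "irreducible p" and p_monic: "Polynomial.lead_coeff p = 1" and p_even: "even (deg p)"
    and root: "ev p \<theta> = 0" and e_nonsquare: "x\<^sup>2 \<noteq> e"
begin

definition D :: "'a poly" where "D = Polynomial.smult e p"

lemma e_nonzero: "e \<noteq> 0"
  using e_nonsquare[of 0] by simp

lemma irred_deg_pos: "irreducible (l :: 'a poly) \<Longrightarrow> deg l > 0"
  by (metis gr0I Factorial_Ring.irreducible_def is_unit_iff_degree)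

lemma deg_p_pos: "deg p > 0"
  by (rule irred_deg_pos[OF p_irred])

lemma deg_D: "deg D = deg p"
  using e_nonzero by (simp add: D_def)

text \<open>Comparing leading coefficients rules out u^2 = D v^2 because e is a nonsquare;
  squarefreeness of D comes from the irreducibility of p.\<close>

sublocale imaginary_order D q
proof
  show "(2::'a) \<noteq> 0" by (rule two_nonzero)
  show "q = card (UNIV :: 'a set)" by (rule q_card)
  show "0 < deg D" "even (deg D)" using deg_D deg_p_pos p_even by auto
  show "x\<^sup>2 \<noteq> Polynomial.lead_coeff D" for x using e_nonsquare p_monic e_nonzero by (simp add: D_def)
  then have ns: "x\<^sup>2 \<noteq> Polynomial.lead_coeff D" for x .
  show "v = 0" if uv: "u\<^sup>2 = D * v\<^sup>2" for u v
  proof (rule ccontr)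
    assume "v \<noteq> 0"
    have "(Polynomial.lead_coeff u)\<^sup>2 = Polynomial.lead_coeff D * (Polynomial.lead_coeff v)\<^sup>2"
      using arg_cong[OF uv, of Polynomial.lead_coeff] by (simp only: lead_coeff_mult lead_coeff_power)
    then have "(Polynomial.lead_coeff u / Polynomial.lead_coeff v)\<^sup>2 = Polynomial.lead_coeff D"
      using \<open>v \<noteq> 0\<close> by (simp add: power_divide)
    then show False using ns by blast
  qed
  show "c dvd v" if cv: "c\<^sup>2 dvd D * v\<^sup>2" for c v
  proof (cases "gcd c v = 0")
    case False
    obtain c' v' where g: "c = c' * gcd c v" "v = v' * gcd c v" "coprime c' v'"
      using gcd_coprime_exists[OF False] by blast
    define h where "h = gcd c v"
    have gh: "c = c' * h" "v = v' * h" "h \<noteq> 0" using g False by (simp_all add: h_def)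
    have "c'\<^sup>2 * h\<^sup>2 dvd (D * v'\<^sup>2) * h\<^sup>2" using cv unfolding gh by (simp add: power_mult_distrib mult_ac)
    then have "c'\<^sup>2 dvd D * v'\<^sup>2" using gh(3) by simp
    moreover have "coprime (c'\<^sup>2) (v'\<^sup>2)" using g(3) by simp
    ultimately have "c'\<^sup>2 dvd D" by (simp add: coprime_dvd_mult_left_iff)
    then have "c'\<^sup>2 dvd p" using e_nonzero by (simp add: D_def dvd_smult_iff)
    then obtain w where "p = c' * (c' * w)" by (auto simp: dvd_def power2_eq_square mult.assoc)
    then have "is_unit c'" using p_irred Factorial_Ring.irreducibleD by (metis is_unit_mult_iff)
    then have "c dvd h" unfolding gh(1) by (simp add: mult_unit_dvd_iff')
    then show ?thesis unfolding gh(2) by (rule dvd_mult)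
  qed simp
qed

definition sg :: "'a alg_closure \<Rightarrow> int" where
  "sg x = (if x = 1 then 1 else if x = - 1 then - 1 else 0)"

definition sym :: "'a poly \<Rightarrow> int" where
  "sym f = sg (half_pow (deg p) (ev f \<theta>))"

text \<open>For monic f this is the symbol (D/f): the nonsquare constant e contributes the sign, and
  (p/f) = (f/p) by reciprocity.\<close>

definition chi :: "'a poly \<Rightarrow> int" where
  "chi f = (- 1) ^ deg f * sym f"

lemma one_neq_minus: "(1 :: 'a alg_closure) \<noteq> - 1"
proof
  assume "(1 :: 'a alg_closure) = - 1"
  then have "(1 + 1 :: 'a alg_closure) = 0" by (metis add.right_inverse)
  then show False using two_nonzero(2) by simp
qed

lemma half_pow_ev:
  "p dvd f \<Longrightarrow> half_pow (deg p) (ev f \<theta>) = 0" "\<not> p dvd f \<Longrightarrow> half_pow (deg p) (ev f \<theta>) = 1 \<or> half_pow (deg p) (ev f \<theta>) = - 1"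
  using half_pow_cases[OF ev_below_field(5)[OF p_irred root, of f] deg_p_pos] ev_below_field(4)[OF p_irred root, of f] by auto

lemma sym_cases: "sym f = 0 \<or> sym f = 1 \<or> sym f = - 1" "sym f = 0 \<longleftrightarrow> p dvd f"
  using half_pow_ev[of f] by (cases "p dvd f"; auto simp: sym_def sg_def)+

lemma of_int_sym: "of_int (sym f) = half_pow (deg p) (ev f \<theta>)"
  using half_pow_ev[of f] one_neq_minus by (cases "p dvd f") (auto simp: sym_def sg_def)

lemma of_int_eqD:
  assumes "of_int x = (of_int y :: 'a alg_closure)" "x \<in> {0, 1, - 1}" "y \<in> {0, 1, - 1}"
  shows "x = y"
  using assms one_neq_minus by auto

lemma sym_mult: "sym (f * g) = sym f * sym g"
proof (rule of_int_eqD)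
  show "of_int (sym (f * g)) = (of_int (sym f * sym g) :: 'a alg_closure)"
    by (simp add: of_int_sym half_pow_mult)
qed (use sym_cases(1)[of f] sym_cases(1)[of g] sym_cases(1)[of "f * g"] in auto)

lemma sym_1: "sym 1 = 1"
  by (simp add: sym_def sg_def half_pow_def)

lemma chi_mult: "f \<noteq> 0 \<Longrightarrow> g \<noteq> 0 \<Longrightarrow> chi (f * g) = chi f * chi g"
  by (simp add: chi_def sym_mult degree_mult_eq power_add)

lemma chi_1: "chi 1 = 1"
  by (simp add: chi_def sym_1)

lemma chi_cases: "chi f = 0 \<or> chi f = 1 \<or> chi f = - 1" "chi f = 0 \<longleftrightarrow> p dvd f"
  using sym_cases[of f] by (auto simp: chi_def minus_one_power_iff)

lemma exists_root:
  fixes f :: "'a poly"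
  assumes "deg f > 0"
  shows "\<exists>\<beta>. ev f \<beta> = 0"
  using alg_closed_imp_poly_has_root[of "lift f"] assms by (auto simp: ev_def)

text \<open>Quadratic reciprocity: both symbols are the same resultant, since \<open>deg p\<close> is even.\<close>

lemma half_pow_D:
  assumes l: "irreducible l" "Polynomial.lead_coeff l = 1" "ev l \<beta> = 0"
  shows "half_pow (deg l) (ev D \<beta>) = of_int (chi l)"
proof -
  let ?m = "(q - 1) div 2" and ?d = "deg l" and ?k = "deg p"
  let ?b = "\<lambda>j. \<beta> ^ (q ^ j)" and ?t = "\<lambda>i. \<theta> ^ (q ^ i)"
  have pb: "ev p x = (\<Prod>i<?k. x - ?t i)" for x
    unfolding ev_def irreducible_split[OF p_irred root p_monic] by (simp add: poly_prod)
  have lt: "ev l x = (\<Prod>j<?d. x - ?b j)" for x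
    unfolding ev_def irreducible_split[OF l(1,3,2)] by (simp add: poly_prod)
  have em: "to_ac e ^ ?m = - 1"
  proof -
    have h: "half_pow 1 (to_ac e) = to_ac e ^ ?m" by (simp add: half_pow_def)
    obtain z where z: "z\<^sup>2 = to_ac e" using nth_root_exists[of 2 "to_ac e"] by auto
    have fx: "to_ac e ^ (q ^ 1) = to_ac e" by (rule to_ac_frob)
    have "z ^ (q ^ 1) \<noteq> z"
    proof
      assume "z ^ (q ^ 1) = z"
      then obtain x where "z = to_ac x" using frob_fixed_iff[of z] by auto
      then have "to_ac (x\<^sup>2) = to_ac e" using z by simp
      then show False using e_nonsquare[of x] by (simp only: to_ac_eq_iff)
    qed
    then have "half_pow 1 (to_ac e) \<noteq> 1" using half_pow_square_iff[OF fx _ _ z] e_nonzero by simp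
    then show ?thesis using half_pow_cases(2)[OF fx] e_nonzero h by simp
  qed
  have sgn: "((- 1 :: 'a alg_closure) ^ (?d * ?k)) = 1" using p_even by simp
  have "half_pow ?d (ev D \<beta>) = (\<Prod>j<?d. ev D (?b j)) ^ ?m"
    unfolding half_pow_eq_norm by (simp add: ev_frob)
  also have "(\<Prod>j<?d. ev D (?b j)) = to_ac e ^ ?d * (\<Prod>j<?d. \<Prod>i<?k. ?b j - ?t i)"
    by (simp add: D_def pb prod.distrib)
  also have "(\<Prod>j<?d. \<Prod>i<?k. ?b j - ?t i) = (\<Prod>j<?d. \<Prod>i<?k. - 1 * (?t i - ?b j))" by simp
  also have "\<dots> = (- 1) ^ (?d * ?k) * (\<Prod>j<?d. \<Prod>i<?k. ?t i - ?b j)"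
    unfolding prod.distrib by (simp add: power_mult[symmetric] mult.commute)
  also have "(\<Prod>j<?d. \<Prod>i<?k. ?t i - ?b j) = (\<Prod>i<?k. \<Prod>j<?d. ?t i - ?b j)" by (rule prod.swap)
  also have "\<dots> = (\<Prod>i<?k. ev l \<theta> ^ (q ^ i))" 
    by (rule prod.cong[OF refl]) (metis ev_frob lt)
  finally have "half_pow ?d (ev D \<beta>) = (to_ac e ^ ?m) ^ ?d * half_pow ?k (ev l \<theta>)"
    unfolding half_pow_eq_norm[of ?k] sgn by (simp add: power_mult_distrib power_mult[symmetric] mult.commute)
  then show ?thesis unfolding em chi_def by (simp add: of_int_sym)
qed

definition root_count :: "'a poly \<Rightarrow> nat" where
  "root_count a = card {b \<in> polys_below (deg a). a dvd b\<^sup>2 - D}"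

text \<open>Evaluation at \<beta> turns the solutions b into the square roots of D(\<beta>) in the
  residue field; there are 0, 1 or 2 of them by Euler's criterion and
  \<open>half_pow_D\<close>.\<close>

lemma root_count_prime:
  assumes l: "irreducible l" "Polynomial.lead_coeff l = 1"
  shows "int (root_count l) = 1 + chi l"
proof -
  obtain \<beta> where b: "ev l \<beta> = 0" using exists_root[OF irred_deg_pos[OF l(1)]] by blast
  note dl = irred_deg_pos[OF l(1)]
  note E = ev_below_field[OF l(1) b]
  define y where "y = ev D \<beta>"
  obtain z where z: "z\<^sup>2 = y" using nth_root_exists[of 2 y] by auto
  have yf: "y ^ (q ^ deg l) = y" unfolding y_def by (rule E(5))
  have "bij_betw (\<lambda>f. ev f \<beta>) {b \<in> polys_below (deg l). l dvd b\<^sup>2 - D} {x. x ^ (q ^ deg l) = x \<and> x\<^sup>2 = y}"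
    unfolding bij_betw_def
  proof
    show "inj_on (\<lambda>f. ev f \<beta>) {b \<in> polys_below (deg l). l dvd b\<^sup>2 - D}"
      using E(2) by (rule inj_on_subset) auto
    have m: "l dvd f\<^sup>2 - D \<longleftrightarrow> (ev f \<beta>)\<^sup>2 = y" for f
      using E(4)[of "f\<^sup>2 - D"] by (simp add: y_def)
    show "(\<lambda>f. ev f \<beta>) ` {b \<in> polys_below (deg l). l dvd b\<^sup>2 - D} = {x. x ^ (q ^ deg l) = x \<and> x\<^sup>2 = y}"
    proof (rule equalityI; rule subsetI)
      fix x assume "x \<in> (\<lambda>f. ev f \<beta>) ` {b \<in> polys_below (deg l). l dvd b\<^sup>2 - D}"
      then show "x \<in> {x. x ^ (q ^ deg l) = x \<and> x\<^sup>2 = y}" using E(5) m by auto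
    next
      fix x assume x: "x \<in> {x. x ^ (q ^ deg l) = x \<and> x\<^sup>2 = y}"
      then obtain f where "f \<in> polys_below (deg l)" "x = ev f \<beta>" using E(1) by blast
      then show "x \<in> (\<lambda>f. ev f \<beta>) ` {b \<in> polys_below (deg l). l dvd b\<^sup>2 - D}" using x m by auto
    qed
  qed
  then have c: "root_count l = card {x. x ^ (q ^ deg l) = x \<and> x\<^sup>2 = y}"
    unfolding root_count_def by (rule bij_betw_same_card)
  have sq: "x\<^sup>2 = y \<longleftrightarrow> x = z \<or> x = - z" for x using z power2_eq_iff by metis
  have hp: "half_pow (deg l) y = of_int (chi l)" unfolding y_def by (rule half_pow_D[OF l b])
  show ?thesis
  proof (cases "y = 0")
    case True
    then have "{x. x ^ (q ^ deg l) = x \<and> x\<^sup>2 = y} = {0}" by auto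
    moreover have "chi l = 0"
      using hp half_pow_cases(1)[OF yf dl True] chi_cases(1)[of l] by (intro of_int_eqD) auto
    ultimately show ?thesis using c by simp
  next
    case False
    have zz: "z \<noteq> - z"
    proof
      assume "z = - z"
      then have "2 * z = 0" by (metis add.right_inverse mult_2)
      then show False using two_nonzero(2) z False by auto
    qed
    show ?thesis
    proof (cases "half_pow (deg l) y = 1")
      case True
      then have "z ^ (q ^ deg l) = z" using half_pow_square_iff[OF yf dl False z] by simp
      then have "{x. x ^ (q ^ deg l) = x \<and> x\<^sup>2 = y} = {z, - z}" using sq frob_minus by auto
      moreover have "chi l = 1" using hp True chi_cases(1)[of l] by (intro of_int_eqD) auto
      ultimately show ?thesis using c zz by simp
    next
      case f: False
      have mz: "(- z)\<^sup>2 = y" using z by simp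
      have 1: "z ^ (q ^ deg l) \<noteq> z" using half_pow_square_iff[OF yf dl False z] f by simp
      have 2: "(- z) ^ (q ^ deg l) \<noteq> - z" using half_pow_square_iff[OF yf dl False mz] f by simp
      have em: "{x. x ^ (q ^ deg l) = x \<and> x\<^sup>2 = y} = {}"
      proof (rule equals0I)
        fix x assume "x \<in> {x. x ^ (q ^ deg l) = x \<and> x\<^sup>2 = y}"
        then have "x = z \<or> x = - z" "x ^ (q ^ deg l) = x" using sq by auto
        then show False using 1 2 by metis
      qed
      moreover have "chi l = - 1"
        using hp f half_pow_cases(2)[OF yf dl False] chi_cases(1)[of l] by (intro of_int_eqD) auto
      moreover have "root_count l = 0" unfolding c em by simp
      ultimately show ?thesis by simp
    qed
  qed
qed

end

section \<open>Counting ideals by quadratic symbols\<close>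

definition monic_divisors :: "'a::field_gcd poly \<Rightarrow> 'a poly set" where
  "monic_divisors N = {f. f dvd N \<and> Polynomial.lead_coeff f = 1}"

definition square_divisors :: "'a::field_gcd poly \<Rightarrow> 'a poly set" where
  "square_divisors N = {g. g\<^sup>2 dvd N \<and> Polynomial.lead_coeff g = 1}"

lemma monic_normalize: "Polynomial.lead_coeff (f::'a::field_gcd poly) = 1 \<Longrightarrow> normalize f = f"
  by (simp add: normalize_poly_eq_map_poly map_poly_idI)

lemma monic_eqI:
  fixes f g :: "'a::field_gcd poly"
  assumes "f dvd g" "g dvd f" "Polynomial.lead_coeff f = 1" "Polynomial.lead_coeff g = 1"
  shows "f = g"
  using associated_eqI[OF assms(1,2)] assms(3,4) monic_normalize by metis

lemma make_monic:
  fixes f :: "'a::field_gcd poly"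
  assumes "f \<noteq> 0"
  shows "\<exists>c g. c \<noteq> 0 \<and> f = Polynomial.smult c g \<and> Polynomial.lead_coeff g = 1"
  using assms by (intro exI[of _ "Polynomial.lead_coeff f"] exI[of _ "Polynomial.smult (inverse (Polynomial.lead_coeff f)) f"]) auto

lemma monic_mult_split:
  fixes f g :: "'a::field_gcd poly"
  assumes "Polynomial.lead_coeff (f * g) = 1"
  obtains f' g' where "Polynomial.lead_coeff f' = 1" "Polynomial.lead_coeff g' = 1" "f * g = f' * g'" "f' dvd f" "g' dvd g"
proof -
  have nz: "f \<noteq> 0" "g \<noteq> 0" using assms by auto
  obtain c f' where f: "c \<noteq> 0" "f = Polynomial.smult c f'" "Polynomial.lead_coeff f' = 1" using make_monic[OF nz(1)] by blast
  obtain d g' where g: "d \<noteq> 0" "g = Polynomial.smult d g'" "Polynomial.lead_coeff g' = 1" using make_monic[OF nz(2)] by blast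
  have "Polynomial.lead_coeff f * Polynomial.lead_coeff g = 1" using assms by (simp only: lead_coeff_mult)
  then have "c * d = 1" using f(1,3) g(1,3) unfolding f(2) g(2) by simp
  then have "f * g = f' * g'" unfolding f(2) g(2) by (simp add: mult.commute)
  moreover have "f' dvd f" "g' dvd g" unfolding f(2) g(2) by (simp_all add: dvd_smult)
  ultimately show ?thesis using that f(3) g(3) by blast
qed

lemma square_dvdD: "(g::'a::comm_semiring_1)\<^sup>2 dvd N \<Longrightarrow> g dvd N"
  by (metis dvd_mult_left power2_eq_square)

lemma square_divisors_subset: "square_divisors N \<subseteq> monic_divisors N"
  unfolding monic_divisors_def square_divisors_def by (rule Collect_mono) (metis square_dvdD)

lemma finite_monic_divisors:
  fixes N :: "'a::{finite,field_gcd} poly"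
  assumes "N \<noteq> 0"
  shows "finite (monic_divisors N)" "finite (square_divisors N)"
proof -
  have "monic_divisors N \<subseteq> polys_below (Suc (deg N))"
  proof
    fix f assume "f \<in> monic_divisors N"
    then have "deg f \<le> deg N" using assms by (auto simp: monic_divisors_def intro: dvd_imp_degree_le)
    then show "f \<in> polys_below (Suc (deg N))" by (simp add: polys_below_def)
  qed
  then show 1: "finite (monic_divisors N)" by (rule finite_subset) simp
  show "finite (square_divisors N)" by (rule finite_subset[OF square_divisors_subset 1])
qed

lemma coprime_mult_inj:
  fixes M N :: "'a::field_gcd poly"
  assumes "coprime M N" "f dvd M" "f' dvd M" "g dvd N" "g' dvd N" "f * g = f' * g'"
    "Polynomial.lead_coeff f = 1" "Polynomial.lead_coeff g = 1" "Polynomial.lead_coeff f' = 1" "Polynomial.lead_coeff g' = 1"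
  shows "f = f' \<and> g = g'"
proof -
  have c: "coprime f g'" "coprime f' g" using assms coprime_divisors by blast+
  have "f dvd f' * g'" "f' dvd f * g" using assms(6) by (metis dvd_triv_left)+
  then have "f dvd f'" "f' dvd f" using c by (simp_all add: coprime_dvd_mult_left_iff)
  then have e: "f = f'" using monic_eqI assms by blast
  moreover have "f \<noteq> 0" using assms(7) by auto
  ultimately show ?thesis using assms(6) by simp
qed

lemma monic_divisors_coprime:
  fixes M N :: "'a::field_gcd poly"
  assumes "coprime M N"
  shows "bij_betw (\<lambda>(f, g). f * g) (monic_divisors M \<times> monic_divisors N) (monic_divisors (M * N))"
  unfolding bij_betw_def
proof
  show "inj_on (\<lambda>(f, g). f * g) (monic_divisors M \<times> monic_divisors N)"
  proof (rule inj_onI)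
    fix x y assume "x \<in> monic_divisors M \<times> monic_divisors N" "y \<in> monic_divisors M \<times> monic_divisors N"
      "(\<lambda>(f, g). f * g) x = (\<lambda>(f, g). f * g) y"
    then have "fst x = fst y \<and> snd x = snd y"
      by (intro coprime_mult_inj[OF assms]) (auto simp: monic_divisors_def)
    then show "x = y" by (simp add: prod_eq_iff)
  qed
  show "(\<lambda>(f, g). f * g) ` (monic_divisors M \<times> monic_divisors N) = monic_divisors (M * N)"
  proof (rule equalityI; rule subsetI)
    fix h assume "h \<in> monic_divisors (M * N)"
    then have h: "h dvd M * N" "Polynomial.lead_coeff h = 1" by (auto simp: monic_divisors_def)
    obtain f g where fg: "h = f * g" "f dvd M" "g dvd N" using division_decomp[OF h(1)] by blast
    obtain f' g' where "Polynomial.lead_coeff f' = 1" "Polynomial.lead_coeff g' = 1" "f * g = f' * g'" "f' dvd f" "g' dvd g"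
      using monic_mult_split h(2) fg(1) by metis
    then have "f' \<in> monic_divisors M" "g' \<in> monic_divisors N" "h = f' * g'"
      using fg dvd_trans by (auto simp: monic_divisors_def)
    then show "h \<in> (\<lambda>(f, g). f * g) ` (monic_divisors M \<times> monic_divisors N)" by blast
  qed (auto simp: monic_divisors_def lead_coeff_mult mult_dvd_mono)
qed

lemma square_divisors_coprime:
  fixes M N :: "'a::field_gcd poly"
  assumes "coprime M N"
  shows "bij_betw (\<lambda>(f, g). f * g) (square_divisors M \<times> square_divisors N) (square_divisors (M * N))"
  unfolding bij_betw_def
proof
  note sd = square_dvdD
  show "inj_on (\<lambda>(f, g). f * g) (square_divisors M \<times> square_divisors N)"
    using square_divisors_subset monic_divisors_coprime[OF assms]
    by (intro inj_on_subset[OF bij_betw_imp_inj_on[OF monic_divisors_coprime[OF assms]]] Sigma_mono)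
  show "(\<lambda>(f, g). f * g) ` (square_divisors M \<times> square_divisors N) = square_divisors (M * N)"
  proof (rule equalityI; rule subsetI)
    fix h assume "h \<in> square_divisors (M * N)"
    then have h: "h\<^sup>2 dvd M * N" "Polynomial.lead_coeff h = 1" by (auto simp: square_divisors_def)
    obtain f g where fg: "h = f * g" "f dvd M" "g dvd N" using division_decomp[OF sd[OF h(1)]] by blast
    obtain f' g' where fg': "Polynomial.lead_coeff f' = 1" "Polynomial.lead_coeff g' = 1" "f * g = f' * g'" "f' dvd f" "g' dvd g"
      using monic_mult_split h(2) fg(1) by metis
    have hh: "h\<^sup>2 = f'\<^sup>2 * g'\<^sup>2" using fg fg' by (simp add: power_mult_distrib)
    have "coprime (f'\<^sup>2) N" "coprime (g'\<^sup>2) M"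
      using coprime_divisors[of f' M N N] coprime_divisors[of g' N M M] assms fg fg' dvd_trans by (auto simp: coprime_commute)
    moreover have "f'\<^sup>2 dvd M * N" "g'\<^sup>2 dvd M * N" using h(1) unfolding hh by (auto dest: dvd_mult_left dvd_mult_right)
    ultimately have "f'\<^sup>2 dvd M" "g'\<^sup>2 dvd N" by (simp_all add: coprime_dvd_mult_left_iff coprime_dvd_mult_right_iff)
    then have "f' \<in> square_divisors M" "g' \<in> square_divisors N" "h = f' * g'"
      using fg fg' by (auto simp: square_divisors_def)
    then show "h \<in> (\<lambda>(f, g). f * g) ` (square_divisors M \<times> square_divisors N)" by blast
  qed (auto simp: square_divisors_def lead_coeff_mult mult_dvd_mono power_mult_distrib)
qed

lemma monic_divisors_prime_power:
  fixes l :: "'a::field_gcd poly"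
  assumes "irreducible l" "Polynomial.lead_coeff l = 1"
  shows "monic_divisors (l ^ n) = (\<lambda>i. l ^ i) ` {..n}"
proof (rule equalityI; rule subsetI)
  fix f assume "f \<in> monic_divisors (l ^ n)"
  then have f: "f dvd l ^ n" "Polynomial.lead_coeff f = 1" by (auto simp: monic_divisors_def)
  have "prime l" unfolding Factorial_Ring.prime_def using irreducible_imp_prime_elem_gcd[OF assms(1)] monic_normalize[OF assms(2)] by simp
  then obtain m where m: "m \<le> n" "normalize f = normalize (l ^ m)" using divides_primepow_weak[OF _ f(1)] by blast
  have "Polynomial.lead_coeff (l ^ m) = 1" using assms by (simp add: lead_coeff_power)
  then have "f = l ^ m" using m(2) f(2) monic_normalize by metis
  then show "f \<in> (\<lambda>i. l ^ i) ` {..n}" using m by blast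
next
  fix f assume "f \<in> (\<lambda>i. l ^ i) ` {..n}"
  then obtain i where i: "i \<le> n" "f = l ^ i" by blast
  have "l ^ i dvd l ^ n" using i(1) by (rule le_imp_power_dvd)
  moreover have "Polynomial.lead_coeff (l ^ i) = 1" using assms(2) by (simp only: lead_coeff_power power_one)
  ultimately show "f \<in> monic_divisors (l ^ n)" by (simp add: monic_divisors_def i(2))
qed

context prime_discriminant
begin

text \<open>The Dirichlet convolution of chi with the constant function 1.\<close>

definition divisor_sum :: "'a poly \<Rightarrow> int" where
  "divisor_sum N = (\<Sum>f\<in>monic_divisors N. chi f)"

text \<open>The number of ideals of norm N: a triple (g, a, b) has norm g^2 a, and b runs over the
  square roots of D modulo a.\<close>

definition ideal_sum :: "'a poly \<Rightarrow> int" where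
  "ideal_sum N = (\<Sum>g\<in>square_divisors N. int (root_count (N div g\<^sup>2)))"

text \<open>Chinese remainder theorem.\<close>

lemma root_count_coprime:
  assumes "coprime M N" "M \<noteq> 0" "N \<noteq> 0"
  shows "root_count (M * N) = root_count M * root_count N"
proof -
  let ?R = "\<lambda>a. {b \<in> polys_below (deg a). a dvd b\<^sup>2 - D}"
  have dvd_mod: "a dvd (b mod a)\<^sup>2 - D \<longleftrightarrow> a dvd b\<^sup>2 - D" for a b
  proof -
    have "(b mod a)\<^sup>2 mod a = b\<^sup>2 mod a" by (simp add: power_mod)
    then show ?thesis by (metis mod_eq_dvd_iff mod_diff_left_eq dvd_eq_mod_eq_0)
  qed
  have mb: "a \<noteq> 0 \<Longrightarrow> b mod a \<in> polys_below (deg a)" for a b :: "'a poly"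
    using degree_mod_less[of a b] by (auto simp: polys_below_def)
  have idm: "b mod a = b" if "b \<in> polys_below (deg a)" for a b :: "'a poly"
    using that by (auto simp: polys_below_def mod_poly_less)
  have dMN: "deg (M * N) = deg M + deg N" using assms by (simp add: degree_mult_eq)
  have "bij_betw (\<lambda>b. (b mod M, b mod N)) (?R (M * N)) (?R M \<times> ?R N)"
    unfolding bij_betw_def
  proof
    show "inj_on (\<lambda>b. (b mod M, b mod N)) (?R (M * N))"
    proof (rule inj_onI)
      fix b c assume bc: "b \<in> ?R (M * N)" "c \<in> ?R (M * N)" "(b mod M, b mod N) = (c mod M, c mod N)"
      then have "M dvd b - c" "N dvd b - c" by (auto simp: mod_eq_dvd_iff)
      then have "M * N dvd b - c" using assms(1) by (rule divides_mult)
      then have "b mod (M * N) = c mod (M * N)" by (simp add: mod_eq_dvd_iff)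
      moreover have "b mod (M * N) = b" "c mod (M * N) = c" using bc(1,2) by (simp_all only: mem_Collect_eq idm)
      ultimately show "b = c" by simp
    qed
    show "(\<lambda>b. (b mod M, b mod N)) ` ?R (M * N) = ?R M \<times> ?R N"
    proof (rule equalityI; rule subsetI)
      fix x assume "x \<in> (\<lambda>b. (b mod M, b mod N)) ` ?R (M * N)"
      then obtain b where b: "x = (b mod M, b mod N)" "M * N dvd b\<^sup>2 - D" by blast
      then have "M dvd b\<^sup>2 - D" "N dvd b\<^sup>2 - D" by (auto dest: dvd_mult_left dvd_mult_right)
      then show "x \<in> ?R M \<times> ?R N" using b dvd_mod mb assms by auto
    next
      fix x assume "x \<in> ?R M \<times> ?R N"
      then obtain b c where bc: "x = (b, c)" "b \<in> ?R M" "c \<in> ?R N" by blast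
      obtain u v where uv: "u * M + v * N = 1" using assms(1) bezout_coefficients_fst_snd[of M N] by (metis coprime_iff_gcd_eq_1)
      define y where "y = (b * (v * N) + c * (u * M)) mod (M * N)"
      have "M dvd (b * (v * N) + c * (u * M)) - b"
      proof -
        have "v * N = 1 - u * M" using uv by (metis add_diff_cancel_left')
        then have "b * (v * N) = b * (1 - u * M)" by (simp only:)
        then have "(b * (v * N) + c * (u * M)) - b = b * (1 - u * M) + c * (u * M) - b" by (simp only:)
        also have "\<dots> = M * (c * u - b * u)" by (simp add: algebra_simps)
        finally have "(b * (v * N) + c * (u * M)) - b = M * (c * u - b * u)" .
        then show ?thesis by simp
      qed
      moreover have "N dvd (b * (v * N) + c * (u * M)) - c"
      proof -
        have "u * M = 1 - v * N" using uv by (metis add_diff_cancel_right')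
        then have "c * (u * M) = c * (1 - v * N)" by (simp only:)
        then have "(b * (v * N) + c * (u * M)) - c = b * (v * N) + c * (1 - v * N) - c" by (simp only:)
        also have "\<dots> = N * (b * v - c * v)" by (simp add: algebra_simps)
        finally have "(b * (v * N) + c * (u * M)) - c = N * (b * v - c * v)" .
        then show ?thesis by simp
      qed
      ultimately have ym: "y mod M = b mod M" "y mod N = c mod N"
        unfolding y_def by (simp_all add: mod_mod_cancel mod_eq_dvd_iff)
      then have yb: "y mod M = b" "y mod N = c" using bc idm by auto
      have "M dvd y\<^sup>2 - D" "N dvd y\<^sup>2 - D" using dvd_mod[of M y] dvd_mod[of N y] yb bc by auto
      then have "M * N dvd y\<^sup>2 - D" using assms(1) by (rule divides_mult)
      moreover have "y \<in> polys_below (deg (M * N))" unfolding y_def using mb assms by simp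
      ultimately show "x \<in> (\<lambda>b. (b mod M, b mod N)) ` ?R (M * N)" using bc yb by blast
    qed
  qed
  then show ?thesis unfolding root_count_def by (simp add: bij_betw_same_card card_cartesian_product)
qed

lemma root_count_1: "root_count 1 = 1"
  by (simp add: root_count_def polys_below_def)

text \<open>Hensel lifting: l divides neither D nor 2, so 2 b is invertible modulo l for every root
  b, and reduction modulo l^j is a bijection between the two sets of roots.\<close>

lemma root_count_hensel:
  assumes l: "irreducible l" "Polynomial.lead_coeff l = 1" "\<not> l dvd D" and j: "j > 0"
  shows "root_count (l ^ Suc j) = root_count (l ^ j)"
proof -
  let ?R = "\<lambda>a. {b \<in> polys_below (deg a). a dvd b\<^sup>2 - D}"
  have l0: "l \<noteq> 0" "l ^ j \<noteq> 0" "l ^ Suc j \<noteq> 0" using l(2) by auto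
  have pl: "prime_elem l" using l(1) by (rule irreducible_imp_prime_elem_gcd)
  have nl: "\<not> l dvd 2 * b" if "l ^ j dvd b\<^sup>2 - D" for b
  proof
    assume "l dvd 2 * b"
    then have "l dvd [:1/2:] * (2 * b)" by (rule dvd_mult)
    moreover have "[:1/2:] * (2 * b) = b"
    proof -
      have "[:1/2:] * (2 :: 'a poly) = 1" using two_nonzero(1) by (simp add: numeral_poly one_pCons)
      then show ?thesis by (simp only: mult.assoc[symmetric]) simp
    qed
    ultimately have "l dvd b\<^sup>2" by (simp add: power2_eq_square)
    moreover have "l dvd b\<^sup>2 - D" using that j by (meson dvd_power dvd_trans)
    ultimately have "l dvd b\<^sup>2 - (b\<^sup>2 - D)" by (rule dvd_diff)
    then show False using l(3) by simp
  qed
  have mb: "a \<noteq> 0 \<Longrightarrow> b mod a \<in> polys_below (deg a)" for a b :: "'a poly"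
    using degree_mod_less[of a b] by (auto simp: polys_below_def)
  have idm: "b mod a = b" if "b \<in> polys_below (deg a)" for a b :: "'a poly"
    using that by (auto simp: polys_below_def mod_poly_less)
  have dm: "a dvd (b mod a)\<^sup>2 - D \<longleftrightarrow> a dvd b\<^sup>2 - D" for a b
  proof -
    have "(b mod a)\<^sup>2 mod a = b\<^sup>2 mod a" by (simp add: power_mod)
    then show ?thesis by (metis mod_eq_dvd_iff mod_diff_left_eq dvd_eq_mod_eq_0)
  qed
  have "bij_betw (\<lambda>b. b mod l ^ j) (?R (l ^ Suc j)) (?R (l ^ j))"
    unfolding bij_betw_def
  proof
    show "inj_on (\<lambda>b. b mod l ^ j) (?R (l ^ Suc j))"
    proof (rule inj_onI)
      fix b c assume bc: "b \<in> ?R (l ^ Suc j)" "c \<in> ?R (l ^ Suc j)" "b mod l ^ j = c mod l ^ j"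
      have bj: "l ^ j dvd b\<^sup>2 - D" using bc(1) by (auto dest: dvd_mult_right)
      have "l ^ j dvd b - c" using bc(3) by (simp add: mod_eq_dvd_iff)
      then have "l dvd b - c" using j by (meson dvd_power dvd_trans)
      then have "\<not> l dvd b + c"
      proof -
        assume d: "l dvd b - c"
        have "2 * b = (b - c) + (b + c)" by (simp add: algebra_simps)
        then show ?thesis using nl[OF bj] d by (metis dvd_add)
      qed
      then have cop: "coprime (l ^ Suc j) (b + c)" using pl prime_elem_imp_coprime coprime_power_left_iff by blast
      have "l ^ Suc j dvd b\<^sup>2 - D" "l ^ Suc j dvd c\<^sup>2 - D" using bc by blast+
      then have "l ^ Suc j dvd (b\<^sup>2 - D) - (c\<^sup>2 - D)" by (rule dvd_diff)
      then have "l ^ Suc j dvd (b - c) * (b + c)" by (simp add: power2_eq_square algebra_simps)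
      then have "l ^ Suc j dvd b - c" using cop by (simp add: coprime_dvd_mult_left_iff)
      then have "b mod l ^ Suc j = c mod l ^ Suc j" by (simp add: mod_eq_dvd_iff)
      moreover have "b mod l ^ Suc j = b" "c mod l ^ Suc j = c" using bc(1,2) by (simp_all only: mem_Collect_eq idm)
      ultimately show "b = c" by simp
    qed
    show "(\<lambda>b. b mod l ^ j) ` ?R (l ^ Suc j) = ?R (l ^ j)"
    proof (rule equalityI; rule subsetI)
      fix x assume "x \<in> (\<lambda>b. b mod l ^ j) ` ?R (l ^ Suc j)"
      then obtain b where b: "x = b mod l ^ j" "l ^ Suc j dvd b\<^sup>2 - D" by blast
      then have "l ^ j dvd b\<^sup>2 - D" by (auto dest: dvd_mult_right)
      then show "x \<in> ?R (l ^ j)" using b dm mb l0 by auto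
    next
      fix b assume b: "b \<in> ?R (l ^ j)"
      then obtain c where c: "b\<^sup>2 - D = l ^ j * c" by (auto simp: dvd_def)
      have "coprime l (2 * b)" using nl b pl prime_elem_imp_coprime by blast
      then obtain u v where uv: "u * l + v * (2 * b) = 1" using bezout_coefficients_fst_snd[of l "2 * b"] by (metis coprime_iff_gcd_eq_1)
      \<comment> \<open>Newton correction: v inverts 2 b modulo l, so adding l^j t to b cancels the
        coefficient c of l^j modulo l.\<close>
      define t where "t = - (c * v)"
      have t: "c + 2 * b * t = l * (c * u)"
      proof -
        have e: "v * (2 * b) = 1 - u * l" using uv by (metis add_diff_cancel_left')
        have "2 * b * t = - (c * (v * (2 * b)))" by (simp add: t_def mult_ac)
        also have "\<dots> = - (c * (1 - u * l))" by (simp only: e)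
        finally have "c + 2 * b * t = c + - (c * (1 - u * l))" by (simp only:)
        also have "\<dots> = l * (c * u)" by (simp add: algebra_simps)
        finally show ?thesis .
      qed
      define y where "y = b + l ^ j * t"
      obtain i where i: "j = Suc i" using j by (cases j) auto
      have "y\<^sup>2 - D = (b\<^sup>2 - D) + l ^ j * (2 * b * t) + l ^ j * (l ^ j * t\<^sup>2)"
        by (simp add: y_def power2_eq_square algebra_simps)
      also have "\<dots> = l ^ j * (c + 2 * b * t) + l ^ j * (l ^ j * t\<^sup>2)" unfolding c by (simp add: algebra_simps)
      also have "\<dots> = l ^ Suc j * (c * u + l ^ i * t\<^sup>2)" unfolding t by (simp add: i algebra_simps)
      finally have "l ^ Suc j dvd y\<^sup>2 - D" by simp
      then have "y mod l ^ Suc j \<in> ?R (l ^ Suc j)" using dm[of "l ^ Suc j" y] mb[OF l0(3)] by blast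
      moreover have "y mod l ^ Suc j mod l ^ j = b"
      proof -
        have "y mod l ^ Suc j mod l ^ j = y mod l ^ j" by (rule mod_mod_cancel) simp
        also have "\<dots> = b mod l ^ j" by (simp add: y_def)
        finally show ?thesis using b idm by simp
      qed
      ultimately show "b \<in> (\<lambda>b. b mod l ^ j) ` ?R (l ^ Suc j)" by force
    qed
  qed
  then show ?thesis unfolding root_count_def by (rule bij_betw_same_card)
qed

text \<open>If p^2 divided b^2 - D, then p would divide b, and p^2 would divide D.\<close>

lemma root_count_ramified:
  assumes "j \<ge> 2"
  shows "root_count (p ^ j) = 0"
proof -
  have "\<not> p ^ j dvd b\<^sup>2 - D" for b
  proof
    assume "p ^ j dvd b\<^sup>2 - D"
    then have 2: "p\<^sup>2 dvd b\<^sup>2 - D" using assms by (meson dvd_trans le_imp_power_dvd)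
    then have "p dvd b\<^sup>2 - D" by (auto simp: power2_eq_square dest: dvd_mult_left)
    moreover have "p dvd D" by (simp add: D_def dvd_smult)
    ultimately have "p dvd (b\<^sup>2 - D) + D" by (rule dvd_add)
    then have "p dvd b\<^sup>2" by simp
    then have "p dvd b" using p_irred irreducible_imp_prime_elem_gcd prime_elem_dvd_power by blast
    then have "p\<^sup>2 dvd b\<^sup>2" by (rule dvd_power_same)
    then have "p\<^sup>2 dvd b\<^sup>2 - (b\<^sup>2 - D)" using 2 by (rule dvd_diff)
    then have "p\<^sup>2 dvd D * 1\<^sup>2" by simp
    then have "p dvd 1" by (rule sqfree)
    then show False using p_irred Factorial_Ring.irreducible_def by blast
  qed
  then show ?thesis by (simp add: root_count_def)
qed

lemma root_count_prime_power:
  assumes l: "irreducible l" "Polynomial.lead_coeff l = 1"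
  shows "int (root_count (l ^ j)) = (if j = 0 then 1 else if chi l = 0 \<and> j \<ge> 2 then 0 else 1 + chi l)"
proof (cases "p dvd l")
  case True
  then have "l dvd p" using l(1) p_irred by (metis irreducibleD' Factorial_Ring.irreducible_def)
  then have lp: "l = p" using True monic_eqI l p_monic by blast
  show ?thesis using root_count_ramified[of j] root_count_prime[OF l] chi_cases(2)[of l]
    by (cases "j \<ge> 2"; cases "j = 0"; cases "j = 1") (auto simp: root_count_1 lp)
next
  case False
  have "\<not> l dvd D"
  proof
    assume "l dvd D"
    then have "l dvd p" using e_nonzero by (simp add: D_def dvd_smult_iff)
    then have "p dvd l" using p_irred l(1) by (metis irreducibleD' Factorial_Ring.irreducible_def)
    then show False using False by simp
  qed
  then have "j > 0 \<Longrightarrow> root_count (l ^ j) = root_count l"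
    by (induction j) (use root_count_hensel[OF l] in \<open>force simp del: power_Suc\<close>, metis neq0_conv power_one_right root_count_hensel[OF l] power_0 One_nat_def)
  then show ?thesis using root_count_prime[OF l] chi_cases(2)[of l] False by (auto simp: root_count_1)
qed

text \<open>Passing from n to n + 2 adds the roots modulo l^(n+2) on the left and chi^(n+1) +
  chi^(n+2) on the right; these agree for each of the values 1, 0 and -1 of chi at l.\<close>

lemma ideal_sum_prime_power:
  assumes l: "irreducible l" "Polynomial.lead_coeff l = 1"
  shows "ideal_sum (l ^ n) = divisor_sum (l ^ n)"
proof -
  have l0: "l \<noteq> 0" using l by auto
  have nu: "\<not> is_unit l" using l(1) Factorial_Ring.irreducible_def by blast
  have inj: "inj_on (\<lambda>i. l ^ i) A" for A
    using irred_deg_pos[OF l(1)] l0 by (auto simp: inj_on_def dest!: arg_cong[of _ _ deg] simp: degree_power_eq)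
  have ds: "divisor_sum (l ^ n) = (\<Sum>i\<le>n. chi l ^ i)" for n
  proof -
    have cp: "chi (l ^ i) = chi l ^ i" for i
      by (induction i) (use l0 in \<open>auto simp: chi_1 chi_mult\<close>)
    show ?thesis unfolding divisor_sum_def monic_divisors_prime_power[OF l]
      by (simp add: sum.reindex[OF inj] cp)
  qed
  have sq: "square_divisors (l ^ n) = (\<lambda>i. l ^ i) ` {i. 2 * i \<le> n}" for n
  proof -
    have "l ^ i \<in> square_divisors (l ^ n) \<longleftrightarrow> 2 * i \<le> n" for i
      using nu l l0 by (simp add: square_divisors_def lead_coeff_power power_mult[symmetric] dvd_power_iff mult.commute)
    moreover have "square_divisors (l ^ n) \<subseteq> range (\<lambda>i. l ^ i)"
    proof -
      show ?thesis using square_divisors_subset[of "l ^ n"] unfolding monic_divisors_prime_power[OF l] by auto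
    qed
    ultimately show ?thesis by auto
  qed
  have is_eq: "ideal_sum (l ^ n) = (\<Sum>i\<in>{i. 2 * i \<le> n}. int (root_count (l ^ (n - 2 * i))))" for n
    unfolding ideal_sum_def sq sum.reindex[OF inj] comp_def
  proof (rule sum.cong[OF refl])
    fix i assume "i \<in> {i. 2 * i \<le> n}"
    then have "l ^ n = l ^ (n - 2 * i) * (l ^ i)\<^sup>2" by (simp add: power_mult[symmetric] power_add[symmetric] mult.commute)
    then have "l ^ n div (l ^ i)\<^sup>2 = l ^ (n - 2 * i)" using l0 by simp
    then show "int (root_count (l ^ n div (l ^ i)\<^sup>2)) = int (root_count (l ^ (n - 2 * i)))" by simp
  qed
  have step: "ideal_sum (l ^ Suc (Suc n)) = int (root_count (l ^ Suc (Suc n))) + ideal_sum (l ^ n)" for n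
  proof -
    have "{i. 2 * i \<le> Suc (Suc n)} = insert 0 (Suc ` {i. 2 * i \<le> n})"
    proof (rule equalityI; rule subsetI)
      fix i assume "i \<in> {i. 2 * i \<le> Suc (Suc n)}"
      then show "i \<in> insert 0 (Suc ` {i. 2 * i \<le> n})" by (cases i) auto
    qed auto
    moreover have "finite {i. 2 * i \<le> n}" by (rule finite_subset[of _ "{..n}"]) auto
    ultimately show ?thesis unfolding is_eq by (simp add: sum.reindex del: power_Suc)
  qed
  show ?thesis
  proof (induction n rule: less_induct)
    case (less n)
    consider "n = 0" | "n = 1" | m where "n = Suc (Suc m)" by (metis One_nat_def not0_implies_Suc)
    then show ?case
    proof cases
      case 1
      then have "{i. 2 * i \<le> n} = {0}" by auto
      then show ?thesis unfolding is_eq ds using 1 by (simp add: root_count_1)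
    next
      case 2
      then have "{i. 2 * i \<le> n} = {0}" by auto
      then show ?thesis unfolding is_eq ds using 2 root_count_prime[OF l] by simp
    next
      case 3
      have "ideal_sum (l ^ m) = divisor_sum (l ^ m)" using less 3 by simp
      moreover have "int (root_count (l ^ Suc (Suc m))) = chi l ^ Suc m + chi l ^ Suc (Suc m)"
        using root_count_prime_power[OF l, of "Suc (Suc m)"] chi_cases(1)[of l]
        by (auto simp: minus_one_power_iff simp del: power_Suc)
      ultimately show ?thesis unfolding 3 step ds by (simp del: power_Suc)
    qed
  qed
qed

lemma sum_multiplicative:
  assumes "coprime M N" "M \<noteq> 0" "N \<noteq> 0"
  shows "ideal_sum (M * N) = ideal_sum M * ideal_sum N" "divisor_sum (M * N) = divisor_sum M * divisor_sum N"
proof -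
  have "divisor_sum (M * N) = (\<Sum>(f, g)\<in>monic_divisors M \<times> monic_divisors N. chi (f * g))"
    unfolding divisor_sum_def
    using sum.reindex_bij_betw[OF monic_divisors_coprime[OF assms(1)], of chi] by (simp add: case_prod_unfold)
  also have "\<dots> = (\<Sum>(f, g)\<in>monic_divisors M \<times> monic_divisors N. chi f * chi g)"
    by (rule sum.cong[OF refl]) (auto simp: monic_divisors_def intro!: chi_mult)
  also have "\<dots> = divisor_sum M * divisor_sum N"
    unfolding divisor_sum_def sum_product sum.cartesian_product ..
  finally show "divisor_sum (M * N) = divisor_sum M * divisor_sum N" .
  have "ideal_sum (M * N) = (\<Sum>(f, g)\<in>square_divisors M \<times> square_divisors N. int (root_count ((M * N) div (f * g)\<^sup>2)))"
    unfolding ideal_sum_def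
    using sum.reindex_bij_betw[OF square_divisors_coprime[OF assms(1)], of "\<lambda>h. int (root_count ((M * N) div h\<^sup>2))"]
    by (simp add: case_prod_unfold)
  also have "\<dots> = (\<Sum>(f, g)\<in>square_divisors M \<times> square_divisors N. int (root_count (M div f\<^sup>2)) * int (root_count (N div g\<^sup>2)))"
  proof (rule sum.cong[OF refl], clarify)
    fix f g assume "f \<in> square_divisors M" "g \<in> square_divisors N"
    then obtain M' N' where MN: "M = f\<^sup>2 * M'" "N = g\<^sup>2 * N'" by (auto simp: square_divisors_def elim!: dvdE)
    have nz: "f\<^sup>2 \<noteq> 0" "g\<^sup>2 \<noteq> 0" "M' \<noteq> 0" "N' \<noteq> 0" using MN assms by auto
    have "M div f\<^sup>2 = M'" "N div g\<^sup>2 = N'" unfolding MN using nz by (simp_all only: nonzero_mult_div_cancel_left not_False_eq_True)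
    moreover have "(M * N) div (f * g)\<^sup>2 = M' * N'"
    proof -
      have "M * N = (f * g)\<^sup>2 * (M' * N')" unfolding MN by (simp add: power_mult_distrib mult_ac)
      moreover have "(f * g)\<^sup>2 \<noteq> 0" using nz by simp
      ultimately show ?thesis by (simp only: nonzero_mult_div_cancel_left not_False_eq_True)
    qed
    moreover have "coprime M' N'" using assms(1) MN coprime_divisors by (metis dvd_triv_right)
    ultimately show "int (root_count ((M * N) div (f * g)\<^sup>2)) = int (root_count (M div f\<^sup>2)) * int (root_count (N div g\<^sup>2))"
      using root_count_coprime nz by simp
  qed
  also have "\<dots> = ideal_sum M * ideal_sum N"
    unfolding ideal_sum_def sum_product sum.cartesian_product ..
  finally show "ideal_sum (M * N) = ideal_sum M * ideal_sum N" .
qed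

text \<open>The coefficients of the factorization of the zeta function of the order into that of the
  polynomial ring and the L-series of chi. Both sides are multiplicative, so prime powers
  suffice.\<close>

theorem ideal_sum_eq_divisor_sum:
  assumes "Polynomial.lead_coeff N = 1"
  shows "ideal_sum N = divisor_sum N"
  using assms
proof (induction "deg N" arbitrary: N rule: less_induct)
  case less
  have N0: "N \<noteq> 0" using less.prems by auto
  show ?case
  proof (cases "deg N = 0")
    case True
    then have "N = 1" using less.prems by (metis degree_eq_zeroE lead_coeff_pCons(2) one_pCons)
    then show ?thesis using ideal_sum_prime_power[OF p_irred p_monic, of 0] by simp
  next
    case False
    then have "\<not> is_unit N" using N0 by (simp add: is_unit_iff_degree)
    then obtain l where l: "prime l" "l dvd N" using N0 prime_divisor_exists by blast
    then have li: "irreducible l" by (simp add: prime_elem_imp_irreducible)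
    have l0: "l \<noteq> 0" using li by auto
    have "normalize l = l" using l(1) by (simp add: prime_def)
    moreover have "poly.coeff (normalize l) (deg l) = normalize (Polynomial.lead_coeff l)"
      by (simp add: normalize_poly_eq_map_poly coeff_map_poly)
    moreover have "normalize (Polynomial.lead_coeff l) = 1"
      using l0 by (intro is_unit_normalize) (simp add: dvd_field_iff)
    ultimately have lm: "Polynomial.lead_coeff l = 1" by simp
    define m where "m = multiplicity l N"
    obtain M where M: "N = l ^ m * M" "\<not> l dvd M" unfolding m_def
      using multiplicity_decompose'[of N l] N0 li by (metis Factorial_Ring.irreducible_def)
    have M0: "M \<noteq> 0" "l ^ m \<noteq> 0" using M N0 by auto
    have "m > 0" using M l(2) by (cases m) auto
    have Mm: "Polynomial.lead_coeff M = 1" using less.prems lm unfolding M(1) by (simp add: lead_coeff_mult lead_coeff_power)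
    have "deg (l ^ m) > 0" using irred_deg_pos[OF li] \<open>m > 0\<close> li by (metis degree_power_eq Factorial_Ring.irreducible_def nat_0_less_mult_iff)
    then have "deg M < deg N" using M0 M(1) by (simp add: degree_mult_eq)
    then have "ideal_sum M = divisor_sum M" using less.hyps Mm by blast
    moreover have "coprime (l ^ m) M" using li M(2) irreducible_imp_prime_elem_gcd prime_elem_imp_coprime coprime_power_left_iff by blast
    ultimately show ?thesis unfolding M(1) using sum_multiplicative M0 ideal_sum_prime_power[OF li lm] by simp
  qed
qed

end

definition monics :: "nat \<Rightarrow> 'a::field_gcd poly set" where
  "monics n = {f. Polynomial.lead_coeff f = 1 \<and> deg f = n}"

lemma finite_monics [simp]: "finite (monics n :: 'a::{finite,field_gcd} poly set)"
proof (rule finite_subset)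
  show "monics n \<subseteq> (polys_below (Suc n) :: 'a poly set)" by (auto simp: monics_def polys_below_def)
qed (rule finite_polys_below)

lemma monics_eq: "monics n = (\<lambda>f. Polynomial.monom 1 n + f) ` polys_below n"
proof (rule equalityI; rule subsetI)
  fix f :: "'a::field_gcd poly" assume f: "f \<in> monics n"
  then have "poly.coeff f n = 1" "deg f = n" by (auto simp: monics_def)
  then have "f - Polynomial.monom 1 n \<in> polys_below n"
    unfolding polys_below_iff by (auto simp: coeff_eq_0)
  moreover have "f = Polynomial.monom 1 n + (f - Polynomial.monom 1 n)" by simp
  ultimately show "f \<in> (\<lambda>f. Polynomial.monom 1 n + f) ` polys_below n" by blast
next
  fix f :: "'a::field_gcd poly" assume "f \<in> (\<lambda>f. Polynomial.monom 1 n + f) ` polys_below n"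
  then obtain g where g: "f = Polynomial.monom 1 n + g" "g \<in> polys_below n" by blast
  have c: "poly.coeff f n = 1" "\<And>i. i > n \<Longrightarrow> poly.coeff f i = 0"
    using g by (auto simp: polys_below_iff)
  then have "deg f = n" by (metis degree_le le_antisym le_degree one_neq_zero)
  then show "f \<in> monics n" using c by (simp add: monics_def)
qed

lemma card_monics: "card (monics n :: 'a::{finite,field_gcd} poly set) = card (UNIV :: 'a set) ^ n"
  unfolding monics_eq by (subst card_image) (auto simp: inj_on_def card_polys_below)

section \<open>The L-polynomial of chi and its value at 1\<close>

context prime_discriminant
begin

definition A :: "nat \<Rightarrow> int" where "A n = (\<Sum>f\<in>monics n. chi f)"

text \<open>Triples are sorted by their norm N, the ideals of norm N become divisors f of N, and
  q^(n-j) counts the cofactors when f has degree j.\<close>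

lemma ideal_count_sum: "int (ideal_count n) = (\<Sum>j\<le>n. int q ^ (n - j) * A j)"
proof -
  have T: "{(g, a, b). ideal_triple D g a b \<and> 2 * deg g + deg a = n} =
      (\<lambda>(N, g, b). (g, N div g\<^sup>2, b)) ` (SIGMA N:monics n. SIGMA g:square_divisors N. {b \<in> polys_below (deg (N div g\<^sup>2)). N div g\<^sup>2 dvd b\<^sup>2 - D})" (is "?T = ?f ` ?S")
  proof (rule equalityI; rule subsetI)
    fix x assume "x \<in> ?T"
    then obtain g a b where x: "x = (g, a, b)" and t: "ideal_triple D g a b" "2 * deg g + deg a = n" by auto
    then have m: "Polynomial.lead_coeff g = 1" "Polynomial.lead_coeff a = 1" "b \<in> polys_below (deg a)" "a dvd b\<^sup>2 - D"
      by (auto simp: ideal_triple_def polys_below_def)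
    then have nz: "g \<noteq> 0" "a \<noteq> 0" by auto
    define N where "N = g\<^sup>2 * a"
    have Na: "N div g\<^sup>2 = a" using nz by (simp add: N_def)
    have "Polynomial.lead_coeff N = 1" using m by (simp add: N_def lead_coeff_mult lead_coeff_power)
    moreover have "deg N = n" using t nz by (simp add: N_def degree_mult_eq degree_power_eq)
    ultimately have "N \<in> monics n" by (simp add: monics_def)
    moreover have "g \<in> square_divisors N" using m by (simp add: square_divisors_def N_def)
    ultimately have "(N, g, b) \<in> ?S" using m Na by simp
    moreover have "x = ?f (N, g, b)" using x Na by simp
    ultimately show "x \<in> ?f ` ?S" by blast
  next
    fix x assume "x \<in> ?f ` ?S"
    then obtain N g b where x: "x = (g, N div g\<^sup>2, b)" and h: "N \<in> monics n" "g \<in> square_divisors N"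
      "b \<in> polys_below (deg (N div g\<^sup>2))" "N div g\<^sup>2 dvd b\<^sup>2 - D" by auto
    obtain a where N: "N = g\<^sup>2 * a" using h(2) by (auto simp: square_divisors_def)
    have g: "Polynomial.lead_coeff g = 1" "g \<noteq> 0" using h(2) by (auto simp: square_divisors_def)
    have a: "N div g\<^sup>2 = a" using g N by simp
    have "Polynomial.lead_coeff a = 1" using h(1) g N by (simp add: monics_def lead_coeff_mult lead_coeff_power)
    moreover from this have "a \<noteq> 0" by auto
    then have "2 * deg g + deg a = n" using h(1) g N by (simp add: monics_def degree_mult_eq degree_power_eq)
    ultimately show "x \<in> ?T" using h g by (auto simp: x a ideal_triple_def polys_below_def)
  qed
  have "inj_on ?f ?S"
  proof (rule inj_onI)
    fix x y assume xy: "x \<in> ?S" "y \<in> ?S" "?f x = ?f y"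
    obtain N g b where x: "x = (N, g, b)" by (cases x)
    obtain N' g' b' where y: "y = (N', g', b')" by (cases y)
    have e: "g = g'" "b = b'" "N div g\<^sup>2 = N' div g\<^sup>2" "g\<^sup>2 dvd N" "g\<^sup>2 dvd N'"
      using xy by (auto simp: x y square_divisors_def)
    then have "N = N'" by (metis dvd_div_eq_iff)
    then show "x = y" using e by (simp add: x y)
  qed
  then have "ideal_count n = card ?S" unfolding ideal_count_def T by (rule card_image)
  also have "\<dots> = (\<Sum>N\<in>monics n. \<Sum>g\<in>square_divisors N. root_count (N div g\<^sup>2))"
  proof -
    have fsd: "finite (square_divisors N)" if "N \<in> monics n" for N :: "'a poly"
      using that by (intro finite_monic_divisors(2)) (auto simp: monics_def)
    have "card ?S = (\<Sum>N\<in>monics n. card (SIGMA g:square_divisors N. {b \<in> polys_below (deg (N div g\<^sup>2)). N div g\<^sup>2 dvd b\<^sup>2 - D}))"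
      by (rule card_SigmaI) (auto intro!: finite_SigmaI fsd)
    also have "\<dots> = (\<Sum>N\<in>monics n. \<Sum>g\<in>square_divisors N. root_count (N div g\<^sup>2))"
      unfolding root_count_def by (intro sum.cong refl card_SigmaI) (auto intro: fsd)
    finally show ?thesis .
  qed
  finally have "int (ideal_count n) = (\<Sum>N\<in>monics n. ideal_sum N)" by (simp add: ideal_sum_def)
  also have "\<dots> = (\<Sum>N\<in>monics n. divisor_sum N)"
    by (intro sum.cong refl ideal_sum_eq_divisor_sum) (auto simp: monics_def)
  also have "\<dots> = (\<Sum>(N, f)\<in>(SIGMA N:monics n. monic_divisors N). chi f)"
    unfolding divisor_sum_def
  proof (rule sum.Sigma)
    show "\<forall>N\<in>monics n. finite (monic_divisors (N :: 'a poly))"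
      by (intro ballI finite_monic_divisors(1)) (auto simp: monics_def)
  qed simp
  also have "\<dots> = (\<Sum>(j, f, h)\<in>(SIGMA j:{..n}. monics j \<times> (monics (n - j) :: 'a poly set)). chi f)"
  proof (rule sum.reindex_bij_witness[of _ "\<lambda>(j::nat, f::'a poly, h). (f * h, f)" "\<lambda>(N, f). (deg f, f, N div f)"])
    fix x :: "'a poly \<times> 'a poly" assume "x \<in> (SIGMA N:monics n. monic_divisors N)"
    then obtain N f where x: "x = (N, f)" "N \<in> monics n" "f \<in> monic_divisors N" by auto
    obtain h where h: "N = f * h" using x by (auto simp: monic_divisors_def)
    have f: "Polynomial.lead_coeff f = 1" "f \<noteq> 0" using x by (auto simp: monic_divisors_def)
    have d: "N div f = h" using f h by simp
    have l: "Polynomial.lead_coeff h = 1" using x(2) f h by (simp add: monics_def lead_coeff_mult)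
    then have "h \<noteq> 0" by auto
    then have "deg f + deg h = n" using x(2) f h by (simp add: monics_def degree_mult_eq)
    then show "(case x of (N, f) \<Rightarrow> (deg f, f, N div f)) \<in> (SIGMA j:{..n}. monics j \<times> (monics (n - j) :: 'a poly set))"
      using x f d l by (auto simp: monics_def)
    show "(case case x of (N, f) \<Rightarrow> (deg f, f, N div f) of (j, f, h) \<Rightarrow> (f * h, f)) = x" using x d h by simp
    show "(case case x of (N, f) \<Rightarrow> (deg f, f, N div f) of (j, f, h) \<Rightarrow> chi f) = (case x of (N, f) \<Rightarrow> chi f)"
      by (simp add: x)
  next
    fix x :: "nat \<times> 'a poly \<times> 'a poly" assume "x \<in> (SIGMA j:{..n}. monics j \<times> (monics (n - j) :: 'a poly set))"
    then obtain j f h where x: "x = (j, f, h)" "j \<le> n" "f \<in> monics j" "h \<in> monics (n - j)" by auto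
    then have m: "Polynomial.lead_coeff f = 1" "deg f = j" "Polynomial.lead_coeff h = 1" "deg h = n - j" "f \<noteq> 0" "h \<noteq> 0"
      by (auto simp: monics_def)
    have dn: "deg (f * h) = n" using m x(2) by (simp add: degree_mult_eq)
    have ln: "Polynomial.lead_coeff (f * h) = 1" unfolding lead_coeff_mult using m by simp
    show "(case x of (j, f, h) \<Rightarrow> (f * h, f)) \<in> (SIGMA N:monics n. monic_divisors N)"
      using x(1) m dn ln by (simp add: monics_def monic_divisors_def)
    show "(case case x of (j, f, h) \<Rightarrow> (f * h, f) of (N, f) \<Rightarrow> (deg f, f, N div f)) = x" using m x(1) by simp
  qed
  also have "\<dots> = (\<Sum>j\<le>n. \<Sum>x\<in>monics j \<times> (monics (n - j) :: 'a poly set). chi (fst x))"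
    by (subst sum.Sigma) (auto simp: case_prod_unfold)
  also have "\<dots> = (\<Sum>j\<le>n. int q ^ (n - j) * A j)"
  proof (rule sum.cong[OF refl])
    fix j
    have "(\<Sum>x\<in>monics j \<times> (monics (n - j) :: 'a poly set). chi (fst x)) = (\<Sum>f\<in>monics j. \<Sum>h\<in>(monics (n - j) :: 'a poly set). chi f)"
      by (subst sum.cartesian_product) (simp add: case_prod_unfold)
    then show "(\<Sum>x\<in>monics j \<times> (monics (n - j) :: 'a poly set). chi (fst x)) = int q ^ (n - j) * A j"
      by (simp add: A_def card_monics q_card[symmetric] sum_distrib_left)
  qed
  finally show ?thesis .
qed

text \<open>The convolution gives the recursion that the count at n + 1 is q times the count at n
  plus \<open>A (Suc n)\<close>.\<close>

lemma ideal_count_telescope: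
  "int (ideal_count N) - int (q - 1) * (\<Sum>n<N. int (ideal_count n)) = (\<Sum>j\<le>N. A j)"
proof -
  have q1: "int (q - 1) = int q - 1" using q_ge_3 by simp
  have rec: "int (ideal_count (Suc n)) = int q * int (ideal_count n) + A (Suc n)" for n
  proof -
    have "(\<Sum>j\<le>n. int q ^ (Suc n - j) * A j) = (\<Sum>j\<le>n. int q * (int q ^ (n - j) * A j))"
      by (intro sum.cong refl) (simp add: Suc_diff_le)
    then show ?thesis unfolding ideal_count_sum by (simp add: sum_distrib_left)
  qed
  show ?thesis
  proof (induction N)
    case 0
    then show ?case by (simp add: ideal_count_sum)
  next
    case (Suc N)
    let ?I = "int (ideal_count N)" and ?S = "\<Sum>n<N. int (ideal_count n)"
    have "(int q * ?I + A (Suc N)) - (int q - 1) * (?S + ?I) = (?I - (int q - 1) * ?S) + A (Suc N)"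
      by (simp add: algebra_simps)
    then show ?case using Suc unfolding rec q1 by simp
  qed
qed

text \<open>Otherwise X^((q^k - 1)/2) - 1, with k = deg p, would have q^k - 1 roots.\<close>

lemma exists_nonresidue: "\<exists>u. sym u = - 1"
proof -
  have "(\<exists>x :: 'a alg_closure. x \<in> {y. y ^ (q ^ deg p) = y} \<and> x \<noteq> 0 \<and> half_pow (deg p) x \<noteq> 1)"
  proof (rule ccontr)
    assume "\<not> ?thesis"
    then have all: "\<And>x :: 'a alg_closure. x ^ (q ^ deg p) = x \<Longrightarrow> x \<noteq> 0 \<Longrightarrow> half_pow (deg p) x = 1" by blast
    let ?m = "(q ^ deg p - 1) div 2"
    let ?f = "Polynomial.monom 1 ?m - 1 :: 'a alg_closure poly"
    have g: "q ^ deg p \<ge> 3"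
    proof -
      have "q ^ 1 \<le> q ^ deg p" using deg_p_pos by (intro power_increasing) (auto simp: Suc_le_eq)
      then show ?thesis using q_ge_3 by simp
    qed
    then have m: "?m > 0" "?m < q ^ deg p - 1" using half_pow_twice[of "deg p"] by linarith+
    have c: "poly.coeff ?f ?m = 1" using m by (simp add: coeff_1)
    then have f0: "?f \<noteq> 0" by (metis coeff_0 zero_neq_one)
    have df: "deg ?f \<le> ?m" by (intro degree_diff_le) (auto simp: degree_monom_le)
    have "{y :: 'a alg_closure. y ^ (q ^ deg p) = y} - {0} \<subseteq> {x. poly ?f x = 0}"
      using all by (auto simp: poly_monom half_pow_def)
    then have "card ({y :: 'a alg_closure. y ^ (q ^ deg p) = y} - {0}) \<le> ?m"
      by (rule order.trans[OF card_mono[OF poly_roots_finite[OF f0]] order.trans[OF card_poly_roots_bound[OF f0] df]])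
    moreover have "card ({y :: 'a alg_closure. y ^ (q ^ deg p) = y} - {0}) = q ^ deg p - 1"
      using ev_below_field(3)[OF p_irred root] card_Diff_singleton[of 0 "{y :: 'a alg_closure. y ^ (q ^ deg p) = y}"]
      by (simp add: zero_power)
    ultimately show False using m(2) by linarith
  qed
  then obtain x where x: "x ^ (q ^ deg p) = x" "x \<noteq> 0" "half_pow (deg p) x \<noteq> 1" by blast
  then obtain u where u: "x = ev u \<theta>" using ev_below_field(1)[OF p_irred root] by blast
  have "half_pow (deg p) x = - 1" using half_pow_cases(2)[OF x(1) deg_p_pos x(2)] x(3) by blast
  then have "sym u = - 1" unfolding sym_def u[symmetric] sg_def using one_neq_minus by simp
  then show ?thesis by blast
qed

lemma sym_cong: "p dvd f - g \<Longrightarrow> sym f = sym g"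
proof -
  assume "p dvd f - g"
  then have "ev (f - g) \<theta> = 0" using ev_below_field(4)[OF p_irred root] by blast
  then show ?thesis by (simp add: sym_def)
qed

text \<open>In degree at least deg p the residue modulo p can be changed freely. Multiplying it by a
  nonresidue u permutes the monic polynomials and reverses every symbol.\<close>

lemma sum_sym_high:
  assumes n: "n \<ge> deg p"
  shows "(\<Sum>f\<in>monics n. sym f) = 0"
proof -
  have p0: "p \<noteq> 0" using p_irred by auto
  obtain u where u: "sym u = - 1" using exists_nonresidue by blast
  have "\<not> p dvd u" using u sym_cases(2)[of u] by auto
  then have cu: "coprime p u" using irreducible_imp_prime_elem_gcd[OF p_irred] prime_elem_imp_coprime by blast
  \<comment> \<open>Only the remainder modulo p changes, so T f stays monic of degree n although u f
    need not have that degree.\<close>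
  define T where "T f = f - f mod p + (u * f) mod p" for f
  have below: "f mod p \<in> polys_below n" for f
    using degree_mod_less[OF p0, of f] n by (auto simp: polys_below_def)
  have Tm: "T f \<in> monics n" if f: "f \<in> monics n" for f
  proof -
    obtain g where g: "g \<in> polys_below n" "f = Polynomial.monom 1 n + g" using f unfolding monics_eq by blast
    have "T f = Polynomial.monom 1 n + (g - f mod p + (u * f) mod p)" by (simp add: T_def g)
    moreover have "g - f mod p + (u * f) mod p \<in> polys_below n"
      using g(1) below[of f] below[of "u * f"] by (simp add: polys_below_iff)
    ultimately show ?thesis unfolding monics_eq by blast
  qed
  have Tc: "p dvd T f - u * f" for f
  proof -
    have "T f - u * f = (f - f mod p) - (u * f - (u * f) mod p)" by (simp add: T_def)
    then show ?thesis by (metis dvd_diff dvd_minus_mod)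
  qed
  have Ts: "sym (T f) = - sym f" for f using sym_cong[OF Tc[of f]] u by (simp add: sym_mult)
  have Ti: "inj_on T (monics n)"
  proof (rule inj_onI)
    fix f g assume e: "T f = T g"
    have "p dvd (T g - u * g) - (T f - u * f)" by (rule dvd_diff[OF Tc Tc])
    then have "p dvd u * (f - g)" using e by (simp add: algebra_simps)
    then have "p dvd f - g" using cu by (simp add: coprime_dvd_mult_right_iff)
    then have m: "f mod p = g mod p" "(u * f) mod p = (u * g) mod p"
      by (simp_all add: mod_eq_dvd_iff flip: right_diff_distrib)
    then show "f = g" using e by (simp add: T_def)
  qed
  have Tim: "T ` monics n = monics n" using Tm Ti by (intro endo_inj_surj) auto
  have "(\<Sum>f\<in>monics n. sym f) = (\<Sum>f\<in>T ` monics n. sym f)" using Tim by simp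
  also have "\<dots> = (\<Sum>f\<in>monics n. sym (T f))" by (simp add: sum.reindex[OF Ti])
  also have "\<dots> = - (\<Sum>f\<in>monics n. sym f)" by (simp add: Ts sum_negf)
  finally show ?thesis by simp
qed

lemma A_eq: "A n = (- 1) ^ n * (\<Sum>f\<in>monics n. sym f)"
  unfolding A_def chi_def by (simp add: sum_distrib_left monics_def)

definition class_sum :: int where
  "class_sum = (\<Sum>j<deg p. (- 1) ^ j * (\<Sum>f\<in>monics j. sym f))"

text \<open>Since \<open>A j\<close> vanishes from deg p on, the telescoped sums no longer depend on
  N, as \<open>card_classes\<close> requires.\<close>

theorem class_number_formula:
  fixes f :: "('a poly \<times> 'a poly) set \<Rightarrow> 'c"
  assumes f: "\<And>J J'. qideal D J \<Longrightarrow> qideal D J' \<Longrightarrow> f J = f J' \<longleftrightarrow> qequiv D J J'"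
  shows "int (card (f ` {J. qideal D J})) = class_sum"
proof (rule card_classes[OF f])
  fix N assume N: "N \<ge> deg D"
  have "(\<Sum>j\<le>N. A j) = (\<Sum>j<deg p. A j)"
    by (rule sum.mono_neutral_right) (use N in \<open>auto simp: deg_D A_eq sum_sym_high not_less\<close>)
  then show "int (ideal_count N) - int (q - 1) * (\<Sum>n<N. int (ideal_count n)) = class_sum"
    unfolding ideal_count_telescope by (simp add: class_sum_def A_eq)
qed

end

section \<open>The class number modulo 8\<close>

context finite_base
begin

text \<open>The factorization of X^q - X over the base field at X = u/v, with denominators
  cleared.\<close>

lemma prod_shift_field: "(\<Prod>c\<in>(UNIV :: 'a set). (u :: 'a alg_closure) + to_ac c * v) = u ^ q - v ^ (q - 1) * u"
proof (cases "v = 0")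
  case True
  then show ?thesis using q_ge_3 by (simp add: q_card zero_power)
next
  case False
  let ?f = "Polynomial.monom 1 q - [:0, 1:] :: 'a alg_closure poly"
  let ?g = "\<Prod>c\<in>(UNIV :: 'a set). [:to_ac c, 1:]"
  have "?f = ?g"
  proof (rule poly_eqI_degree_lead_coeff[where n = q and A = "range (to_ac :: 'a \<Rightarrow> _)"])
    have dg: "deg ?g = q" by (simp add: degree_prod_eq_sum_degree q_card)
    moreover have "Polynomial.lead_coeff ?g = 1" by (simp add: lead_coeff_prod)
    ultimately have "poly.coeff ?g q = 1" by metis
    moreover have "poly.coeff [:0, 1 :: 'a alg_closure:] q = 0" using q_ge_3 by (intro coeff_eq_0) simp
    ultimately show "poly.coeff ?f q = poly.coeff ?g q" by simp
    show "deg ?g \<le> q" using dg by simp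
    show "deg ?f \<le> q" using q_ge_3 by (intro degree_diff_le) (auto simp: degree_monom_le)
    show "q \<le> card (range (to_ac :: 'a \<Rightarrow> _))" by (simp add: card_image inj_to_ac q_card)
    show "poly ?f z = poly ?g z" if z: "z \<in> range (to_ac :: 'a \<Rightarrow> _)" for z
    proof -
      obtain c where c: "z = to_ac c" using z by blast
      have "poly ?f z = 0" using to_ac_frob[of c 1] by (simp add: c poly_monom)
      moreover have "poly ?g z = 0" unfolding poly_prod
        by (intro prod_zero bexI[of _ "- c"]) (simp_all add: c)
      ultimately show ?thesis by simp
    qed
  qed
  then have "poly ?f (u / v) = poly ?g (u / v)" by simp
  then have "(u / v) ^ q - u / v = (\<Prod>c\<in>(UNIV :: 'a set). to_ac c + u / v)" by (simp add: poly_prod poly_monom)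
  then have "v ^ q * ((u / v) ^ q - u / v) = (\<Prod>c\<in>(UNIV :: 'a set). v * (to_ac c + u / v))"
    by (simp add: prod.distrib q_card)
  also have "\<dots> = (\<Prod>c\<in>(UNIV :: 'a set). u + to_ac c * v)" using False
    by (intro prod.cong refl) (simp add: distrib_left add.commute mult.commute)
  also have "v ^ q * ((u / v) ^ q - u / v) = u ^ q - v ^ (q - 1) * u"
  proof -
    have "v ^ q = v ^ (q - 1) * v" using q_ge_3 by (metis Suc_diff_1 power_Suc2 q_pos)
    then have "v ^ q * (u / v) = v ^ (q - 1) * u" using False by simp
    moreover have "v ^ q * (u / v) ^ q = u ^ q" using False by (simp add: power_divide)
    ultimately show ?thesis by (simp add: right_diff_distrib)
  qed
  finally show ?thesis by simp
qed

text \<open>Let E be the product for d. Sorting the factors for d + 1 by their coefficient of degree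
  d, additivity of E and \<open>prod_shift_field\<close> give E(y)^q - E(x^d)^(q-1) E(y), again a
  combination of the y^(q^i) with top coefficient 1.\<close>

lemma span_product_linearized:
  "\<exists>a. a d = 1 \<and> (\<forall>y. (\<Prod>g\<in>(polys_below d :: 'a poly set). y + ev g x) = (\<Sum>i\<le>d. a i * y ^ (q ^ i)))"
proof (induction d)
  case 0
  then show ?case by (intro exI[of _ "\<lambda>_. 1"]) (simp add: polys_below_def)
next
  case (Suc d)
  then obtain a where a: "a d = 1" "\<And>y. (\<Prod>g\<in>(polys_below d :: 'a poly set). y + ev g x) = (\<Sum>i\<le>d. a i * y ^ (q ^ i))"
    by blast
  define E where "E y = (\<Sum>i\<le>d. a i * y ^ (q ^ i))" for y
  have lin: "E (y + to_ac c * z) = E y + to_ac c * E z" for y z and c :: 'a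
    unfolding E_def by (simp add: frob_add power_mult_distrib to_ac_frob sum_distrib_left sum.distrib algebra_simps)
  have ev_monom: "ev (Polynomial.monom c d) x = to_ac c * x ^ d" for c :: 'a
    by (simp add: ev_def map_poly_monom poly_monom)
  have split: "(polys_below (Suc d) :: 'a poly set) = (\<lambda>(c, g). Polynomial.monom c d + g) ` (UNIV \<times> polys_below d)"
  proof (rule equalityI; rule subsetI)
    fix f :: "'a poly" assume f: "f \<in> polys_below (Suc d)"
    have "poly.coeff (f - Polynomial.monom (poly.coeff f d) d) i = 0" if "d \<le> i" for i
      using f that by (cases "i = d") (auto simp: polys_below_iff)
    then have "f - Polynomial.monom (poly.coeff f d) d \<in> polys_below d" unfolding polys_below_iff by blast
    moreover have "f = Polynomial.monom (poly.coeff f d) d + (f - Polynomial.monom (poly.coeff f d) d)" by simp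
    ultimately show "f \<in> (\<lambda>(c, g). Polynomial.monom c d + g) ` (UNIV \<times> polys_below d)"
      by (intro image_eqI[where x = "(poly.coeff f d, f - Polynomial.monom (poly.coeff f d) d)"]) auto
  qed (auto simp: polys_below_iff)
  have inj: "inj_on (\<lambda>(c, g). Polynomial.monom c d + g) (UNIV \<times> (polys_below d :: 'a poly set))"
  proof (rule inj_onI)
    fix s t assume st: "s \<in> UNIV \<times> (polys_below d :: 'a poly set)" "t \<in> UNIV \<times> (polys_below d :: 'a poly set)"
      "(\<lambda>(c, g). Polynomial.monom c d + g) s = (\<lambda>(c, g). Polynomial.monom c d + g) t"
    obtain c g c' g' where cg: "s = (c, g)" "t = (c', g')" by (cases s; cases t)
    have z: "poly.coeff g d = 0" "poly.coeff g' d = 0" using st by (auto simp: cg polys_below_iff)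
    have e: "Polynomial.monom c d + g = Polynomial.monom c' d + g'" using st by (simp add: cg)
    have "poly.coeff (Polynomial.monom c d + g) d = poly.coeff (Polynomial.monom c' d + g') d" by (simp only: e)
    then have "c = c'" using z by simp
    then show "s = t" using e by (simp add: cg)
  qed
  have "(\<Prod>g\<in>(polys_below (Suc d) :: 'a poly set). y + ev g x) = (\<Sum>i\<le>Suc d. (if i = 0 then 0 else a (i - 1) ^ q) * y ^ (q ^ i) - (E (x ^ d) ^ (q - 1)) * (if i \<le> d then a i else 0) * y ^ (q ^ i))" for y
  proof -
    have "(\<Prod>g\<in>(polys_below (Suc d) :: 'a poly set). y + ev g x) = (\<Prod>(c, g)\<in>UNIV \<times> (polys_below d :: 'a poly set). (y + to_ac c * x ^ d) + ev g x)"
      unfolding split by (subst prod.reindex[OF inj]) (simp add: case_prod_unfold ev_monom add_ac)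
    also have "\<dots> = (\<Prod>c\<in>(UNIV :: 'a set). \<Prod>g\<in>(polys_below d :: 'a poly set). (y + to_ac c * x ^ d) + ev g x)"
      by (rule prod.cartesian_product[symmetric])
    also have "\<dots> = (\<Prod>c\<in>(UNIV :: 'a set). E y + to_ac c * E (x ^ d))"
      unfolding a(2) E_def[symmetric] lin ..
    also have "\<dots> = E y ^ q - E (x ^ d) ^ (q - 1) * E y" by (rule prod_shift_field)
    also have "E y ^ q = (\<Sum>i\<le>d. (a i ^ q) * y ^ (q ^ Suc i))"
    proof -
      have "(\<Sum>i\<in>I. f i) ^ q = (\<Sum>i\<in>I. f i ^ q)" if "finite I" for f :: "nat \<Rightarrow> 'a alg_closure" and I
        using that by (induction I rule: finite_induct) (use frob_add[of _ _ 1] in \<open>auto simp: zero_power\<close>)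
      then show ?thesis by (simp add: E_def power_mult_distrib power_mult[symmetric] mult.commute)
    qed
    also have "\<dots> = (\<Sum>i\<le>Suc d. (if i = 0 then 0 else a (i - 1) ^ q) * y ^ (q ^ i))"
      by (simp only: sum.atMost_Suc_shift) simp
    also have "E (x ^ d) ^ (q - 1) * E y = (\<Sum>i\<le>Suc d. (E (x ^ d) ^ (q - 1)) * (if i \<le> d then a i else 0) * y ^ (q ^ i))"
      unfolding E_def[of y] by (simp add: sum_distrib_left mult.assoc)
    finally show ?thesis by (simp only: sum_subtractf)
  qed
  then show ?case
    using a(1) by (intro exI[of _ "\<lambda>i. (if i = 0 then 0 else a (i - 1) ^ q) - E (x ^ d) ^ (q - 1) * (if i \<le> d then a i else 0)"])
      (simp add: left_diff_distrib)
qed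

text \<open>Carlitz's formula. The linearized polynomial of the span of \<open>1, x, \<dots>, x\<^sup>d\<^sup>-\<^sup>1\<close> defines a functional on
  polynomials that vanishes in degree below \<open>d\<close>; it is evaluated at the monic polynomial with roots
  \<open>x\<^sup>q\<^sup>^\<^sup>i\<close>, \<open>i < d\<close>.\<close>

lemma prod_monics: "(\<Prod>f\<in>(monics d :: 'a poly set). ev f x) = (\<Prod>i<d. x ^ (q ^ d) - x ^ (q ^ i))"
proof -
  obtain a where a: "a d = 1" "\<And>y. (\<Prod>g\<in>(polys_below d :: 'a poly set). y + ev g x) = (\<Sum>i\<le>d. a i * y ^ (q ^ i))"
    using span_product_linearized by blast
  define E where "E y = (\<Sum>i\<le>d. a i * y ^ (q ^ i))" for y
  have ev_monom: "ev (Polynomial.monom c j) x = to_ac c * x ^ j" for c :: 'a and j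
    by (simp add: ev_def map_poly_monom poly_monom)
  have E0: "E (x ^ j) = 0" if j: "j < d" for j
  proof -
    have "Polynomial.monom (- 1) j \<in> (polys_below d :: 'a poly set)" using j by (auto simp: polys_below_iff)
    moreover have "x ^ j + ev (Polynomial.monom (- 1 :: 'a) j) x = 0" by (simp add: ev_monom)
    ultimately show ?thesis unfolding E_def a(2)[symmetric] by (intro prod_zero) auto
  qed
  let ?h = "\<Prod>i<d. [:- (x ^ (q ^ i)), 1:]"
  have dh: "deg ?h = d" by (simp add: degree_prod_eq_sum_degree)
  have lh: "poly.coeff ?h d = 1"
    using lead_coeff_prod[of "\<lambda>i. [:- (x ^ (q ^ i)), 1:]" "{..<d}"] dh by simp
  have "(\<Sum>i\<le>d. a i * poly ?h (x ^ (q ^ i))) = (\<Sum>i\<le>d. a i * (\<Sum>j\<le>d. poly.coeff ?h j * (x ^ (q ^ i)) ^ j))"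
    by (simp add: poly_altdef dh)
  also have "\<dots> = (\<Sum>j\<le>d. poly.coeff ?h j * E (x ^ j))"
    unfolding E_def sum_distrib_left
    by (subst sum.swap) (simp add: power_mult[symmetric] mult_ac)
  also have "\<dots> = E (x ^ d)"
  proof -
    have "(\<Sum>j\<le>d. poly.coeff ?h j * E (x ^ j)) = (\<Sum>j\<in>{d}. poly.coeff ?h j * E (x ^ j))"
      by (rule sum.mono_neutral_right) (auto simp: E0)
    then show ?thesis using lh by simp
  qed
  also have "\<dots> = (\<Prod>f\<in>(monics d :: 'a poly set). ev f x)"
    unfolding E_def a(2)[symmetric] monics_eq
    by (subst prod.reindex) (auto simp: inj_on_def ev_monom)
  finally have "(\<Prod>f\<in>(monics d :: 'a poly set). ev f x) = (\<Sum>i\<le>d. a i * poly ?h (x ^ (q ^ i)))" by simp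
  also have "\<dots> = (\<Sum>i\<in>{d}. a i * poly ?h (x ^ (q ^ i)))"
  proof (rule sum.mono_neutral_right)
    show "\<forall>i\<in>{..d} - {d}. a i * poly ?h (x ^ (q ^ i)) = 0"
    proof
      fix i assume "i \<in> {..d} - {d}"
      then have "i < d" by auto
      then have "poly ?h (x ^ (q ^ i)) = 0" unfolding poly_prod by (intro prod_zero) auto
      then show "a i * poly ?h (x ^ (q ^ i)) = 0" by simp
    qed
  qed auto
  also have "\<dots> = (\<Prod>i<d. x ^ (q ^ d) - x ^ (q ^ i))" using a(1) by (simp add: poly_prod)
  finally show ?thesis .
qed

end

context prime_discriminant
begin

text \<open>The norm of a constant c to the base field is c^(deg p), a square since deg p is
  even.\<close>

lemma sym_const: "c \<noteq> 0 \<Longrightarrow> sym [:c:] = 1"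
proof -
  assume c: "c \<noteq> 0"
  let ?m = "(q - 1) div 2"
  obtain k' where k': "deg p = 2 * k'" using p_even by blast
  have qm: "2 * ?m = q - 1" using q_odd by simp
  have "to_ac c * to_ac c ^ (q - 1) = to_ac c ^ q" using q_ge_3 by (metis Suc_diff_1 power_Suc q_pos)
  also have "\<dots> = to_ac c" using to_ac_frob[of c 1] by simp
  finally have c1: "to_ac c ^ (q - 1) = 1" using c by simp
  have "half_pow (deg p) (ev [:c:] \<theta>) = (\<Prod>j<deg p. to_ac c) ^ ?m"
    unfolding half_pow_eq_norm by (simp add: to_ac_frob)
  also have "\<dots> = (to_ac c ^ (2 * ?m)) ^ k'"
    unfolding k' by (simp add: power_mult[symmetric] mult_ac)
  also have "\<dots> = 1" unfolding qm c1 by simp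
  finally show ?thesis by (simp add: sym_def sg_def)
qed

text \<open>The monic polynomials of degree deg p represent all residues modulo p, so
  \<open>sum_sym_high\<close> gives sum zero over the residues. A nonzero residue is uniquely a
  constant times a monic polynomial of lower degree, and constants do not affect the symbol.\<close>

lemma sum_sym_monics: "(\<Sum>j<deg p. \<Sum>f\<in>monics j. sym f) = 0"
proof -
  let ?k = "deg p"
  have p0: "p \<noteq> 0" using p_irred by auto
  have "monics ?k = (\<lambda>g. p + g) ` polys_below ?k"
  proof (rule equalityI; rule subsetI)
    fix f :: "'a poly" assume "f \<in> monics ?k"
    then have f: "poly.coeff f ?k = 1" "deg f = ?k" by (auto simp: monics_def)
    then have "f - p \<in> polys_below ?k" unfolding polys_below_iff using p_monic by (metis coeff_diff coeff_eq_0 diff_self le_neq_implies_less)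
    moreover have "f = p + (f - p)" by simp
    ultimately show "f \<in> (\<lambda>g. p + g) ` polys_below ?k" by blast
  next
    fix f :: "'a poly" assume "f \<in> (\<lambda>g. p + g) ` polys_below ?k"
    then obtain g where g: "f = p + g" "g \<in> polys_below ?k" by blast
    have c: "poly.coeff f ?k = 1" "\<And>i. i > ?k \<Longrightarrow> poly.coeff f i = 0"
      using g p_monic by (auto simp: polys_below_iff coeff_eq_0)
    then have "deg f = ?k" by (metis degree_le le_antisym le_degree one_neq_zero)
    then show "f \<in> monics ?k" using c by (simp add: monics_def)
  qed
  then have "0 = (\<Sum>g\<in>polys_below ?k. sym (p + g))"
    using sum_sym_high[of ?k] by (simp add: sum.reindex inj_on_def)
  also have "\<dots> = (\<Sum>g\<in>polys_below ?k. sym g)" by (intro sum.cong refl sym_cong) simp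
  also have "\<dots> = (\<Sum>g\<in>polys_below ?k - {0}. sym g)"
    by (rule sum.mono_neutral_right) (auto simp: sym_cases(2))
  also have "\<dots> = (\<Sum>(c, j, f)\<in>(UNIV - {0 :: 'a}) \<times> (SIGMA j:{..<?k}. (monics j :: 'a poly set)). sym f)"
  proof (rule sum.reindex_bij_witness[of _ "\<lambda>(c :: 'a, j :: nat, f). Polynomial.smult c f" "\<lambda>f :: 'a poly. (Polynomial.lead_coeff f, deg f, Polynomial.smult (inverse (Polynomial.lead_coeff f)) f)"])
    fix f :: "'a poly" assume "f \<in> polys_below ?k - {0}"
    then have f: "f \<noteq> 0" "deg f < ?k" by (auto simp: polys_below_def)
    show "(case (Polynomial.lead_coeff f, deg f, Polynomial.smult (inverse (Polynomial.lead_coeff f)) f) of (c, j, f) \<Rightarrow> Polynomial.smult c f) = f"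
      using f by simp
    show "(Polynomial.lead_coeff f, deg f, Polynomial.smult (inverse (Polynomial.lead_coeff f)) f) \<in> (UNIV - {0 :: 'a}) \<times> (SIGMA j:{..<?k}. (monics j :: 'a poly set))"
      using f by (simp add: monics_def)
    have "sym f = sym ([:Polynomial.lead_coeff f:] * Polynomial.smult (inverse (Polynomial.lead_coeff f)) f)" using f by simp
    also have "\<dots> = sym (Polynomial.smult (inverse (Polynomial.lead_coeff f)) f)"
      unfolding sym_mult using f sym_const[of "Polynomial.lead_coeff f"] by simp
    finally show "(case (Polynomial.lead_coeff f, deg f, Polynomial.smult (inverse (Polynomial.lead_coeff f)) f) of (c, j, f) \<Rightarrow> sym f) = sym f" by simp
  next
    fix x :: "'a \<times> nat \<times> 'a poly" assume "x \<in> (UNIV - {0 :: 'a}) \<times> (SIGMA j:{..<?k}. (monics j :: 'a poly set))"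
    then obtain c j f where x: "x = (c, j, f)" "c \<noteq> 0" "j < ?k" "Polynomial.lead_coeff f = 1" "deg f = j"
      by (auto simp: monics_def)
    then have "f \<noteq> 0" by auto
    then show "(case x of (c, j, f) \<Rightarrow> Polynomial.smult c f) \<in> polys_below ?k - {0}" using x by (simp add: polys_below_def)
    show "(Polynomial.lead_coeff (case x of (c, j, f) \<Rightarrow> Polynomial.smult c f), deg (case x of (c, j, f) \<Rightarrow> Polynomial.smult c f),
        Polynomial.smult (inverse (Polynomial.lead_coeff (case x of (c, j, f) \<Rightarrow> Polynomial.smult c f))) (case x of (c, j, f) \<Rightarrow> Polynomial.smult c f)) = x"
      using x by simp
  qed
  also have "\<dots> = (\<Sum>c\<in>UNIV - {0 :: 'a}. \<Sum>(j, f)\<in>(SIGMA j:{..<?k}. (monics j :: 'a poly set)). sym f)"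
    by (subst sum.cartesian_product) (simp add: case_prod_unfold)
  also have "\<dots> = int (q - 1) * (\<Sum>j<?k. \<Sum>f\<in>monics j. sym f)"
    by (subst sum.Sigma) (auto simp: q_card)
  finally show ?thesis using q_ge_3 by simp
qed

definition parity_sign :: int where
  "parity_sign = (\<Prod>j\<in>{j. j < deg p \<and> even j}. \<Prod>f\<in>monics j. sym f)"

definition nonresidues :: nat where
  "nonresidues = (\<Sum>j\<in>{j. j < deg p \<and> even j}. card {f \<in> monics j. sym f = - 1})"

lemma sym_low: "f \<in> monics j \<Longrightarrow> j < deg p \<Longrightarrow> sym f = 1 \<or> sym f = - 1"
proof -
  assume f: "f \<in> monics j" "j < deg p"
  then have "f \<noteq> 0" by (auto simp: monics_def)
  then have "\<not> p dvd f" using f dvd_imp_degree_le[of p f] by (auto simp: monics_def)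
  then show ?thesis using sym_cases[of f] by auto
qed

text \<open>Adding the vanishing unsigned sum cancels odd degrees and doubles even ones; a sum of
  q^j signs is q^j minus twice the number of negative ones.\<close>

lemma class_sum_nonresidues: "class_sum = 2 * (\<Sum>j\<in>{j. j < deg p \<and> even j}. int q ^ j) - 4 * int nonresidues"
proof -
  let ?S = "\<lambda>j. \<Sum>f\<in>monics j. sym f" and ?E = "{j. j < deg p \<and> even j}"
  have "class_sum = class_sum + (\<Sum>j<deg p. ?S j)" using sum_sym_monics by simp
  also have "\<dots> = (\<Sum>j<deg p. if even j then 2 * ?S j else 0)"
    unfolding class_sum_def sum.distrib[symmetric] by (intro sum.cong) auto
  also have "\<dots> = (\<Sum>j\<in>?E. 2 * ?S j)"
    by (simp add: sum.If_cases lessThan_def Collect_conj_eq[symmetric])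
  also have "\<dots> = (\<Sum>j\<in>?E. 2 * int q ^ j - 4 * int (card {f \<in> monics j. sym f = - 1}))"
  proof (rule sum.cong[OF refl])
    fix j assume "j \<in> ?E"
    then have j: "j < deg p" by simp
    have "?S j = (\<Sum>f\<in>monics j. 1 - (if sym f = - 1 then 2 else 0))"
      using sym_low j by (intro sum.cong refl) force
    also have "\<dots> = int q ^ j - 2 * int (card {f \<in> monics j. sym f = - 1})"
      by (simp add: sum_subtractf card_monics q_card sum.If_cases Int_def)
    finally show "2 * ?S j = 2 * int q ^ j - 4 * int (card {f \<in> monics j. sym f = - 1})" by simp
  qed
  finally show ?thesis by (simp add: sum_subtractf sum_distrib_left nonresidues_def)
qed

lemma parity_sign_eq: "parity_sign = (- 1) ^ nonresidues"
proof -
  have "(\<Prod>f\<in>monics j. sym f) = (- 1) ^ card {f \<in> monics j. sym f = - 1}" if j: "j < deg p" for j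
  proof -
    have "(\<Prod>f\<in>monics j. sym f) = (\<Prod>f\<in>monics j. if sym f = - 1 then - 1 else 1)"
      using sym_low j by (intro prod.cong refl) force
    then show ?thesis by (simp add: prod.If_cases Int_def)
  qed
  then show ?thesis unfolding parity_sign_def nonresidues_def by (simp add: power_sum)
qed

lemma parity_sign_theta:
  "of_int parity_sign = half_pow (deg p) (\<Prod>j\<in>{j. j < deg p \<and> even j}. \<Prod>i<j. \<theta> ^ (q ^ j) - \<theta> ^ (q ^ i))"
proof -
  have hp: "half_pow d (prod f A) = (\<Prod>x\<in>A. half_pow d (f x))" for d A and f :: "'b \<Rightarrow> 'a alg_closure"
    by (simp add: half_pow_def prod_power_distrib)
  have "of_int parity_sign = (\<Prod>j\<in>{j. j < deg p \<and> even j}. \<Prod>f\<in>monics j. half_pow (deg p) (ev f \<theta>))"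
    by (simp add: parity_sign_def of_int_sym)
  also have "\<dots> = half_pow (deg p) (\<Prod>j\<in>{j. j < deg p \<and> even j}. \<Prod>f\<in>(monics j :: 'a poly set). ev f \<theta>)"
    by (simp add: hp)
  finally show ?thesis by (simp add: prod_monics)
qed

end

section \<open>Stepanov's method\<close>

lemma dvd_poly_of_low_zero:
  fixes P :: "'a::comm_ring_1 poly"
  assumes "\<And>i. i < M \<Longrightarrow> poly.coeff P i = 0"
  shows "u ^ M dvd poly P u"
proof -
  have "poly P u = (\<Sum>i\<le>deg P. poly.coeff P i * u ^ i)" by (rule poly_altdef)
  moreover have "u ^ M dvd poly.coeff P i * u ^ i" for i
    using assms by (cases "i < M") (auto simp: le_imp_power_dvd not_less)
  ultimately show ?thesis by (simp add: dvd_sum)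
qed

text \<open>For a polynomial in Y over polynomials in X, this bounds the degree in X only.\<close>

definition coeff_bound :: "'a::zero poly poly \<Rightarrow> nat \<Rightarrow> bool" where
  "coeff_bound P d \<longleftrightarrow> (\<forall>i. deg (poly.coeff P i) \<le> d)"

lemma coeff_bound_mono: "coeff_bound P d \<Longrightarrow> d \<le> e \<Longrightarrow> coeff_bound P e"
  by (meson coeff_bound_def le_trans)

lemma coeff_bound_add: "coeff_bound P d \<Longrightarrow> coeff_bound Q d \<Longrightarrow> coeff_bound (P + Q) d"
  by (simp add: coeff_bound_def degree_add_le)

lemma coeff_bound_sum: "(\<And>x. x \<in> A \<Longrightarrow> coeff_bound (P x) d) \<Longrightarrow> coeff_bound (\<Sum>x\<in>A. P x) d"
  by (induction A rule: infinite_finite_induct) (auto simp: coeff_bound_add, auto simp: coeff_bound_def)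

lemma coeff_bound_mult: "coeff_bound P d \<Longrightarrow> coeff_bound Q e \<Longrightarrow> coeff_bound (P * Q) (d + e)"
  unfolding coeff_bound_def coeff_mult
  by (intro allI degree_sum_le order.trans[OF degree_mult_le] add_mono) auto

lemma coeff_bound_const: "coeff_bound [:c:] (deg c)"
  by (auto simp: coeff_bound_def coeff_pCons split: nat.splits)

lemma coeff_bound_power: "coeff_bound P d \<Longrightarrow> coeff_bound (P ^ n) (n * d)"
  by (induction n) (auto simp: coeff_bound_mult, simp add: coeff_bound_def coeff_1)

text \<open>\<open>\<Phi>\<close> is the Taylor expansion \<open>f(X + Y)\<close> as a polynomial in \<open>Y\<close>.\<close>

lemma exists_taylor:
  fixes f :: "'a::comm_ring_1 poly"
  shows "\<exists>\<Phi>. poly.coeff \<Phi> 0 = f \<and> coeff_bound \<Phi> (deg f) \<and> (\<forall>u. poly \<Phi> u = pcompose f ([:0, 1:] + u))"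
proof (induction f)
  case 0
  then show ?case by (intro exI[of _ 0]) (simp add: coeff_bound_def)
next
  case (pCons a f)
  then obtain \<Phi> where P: "poly.coeff \<Phi> 0 = f" "coeff_bound \<Phi> (deg f)" "\<And>u. poly \<Phi> u = pcompose f ([:0, 1:] + u)" by blast
  let ?P = "[:[:a:]:] + [:[:0, 1:], 1:] * \<Phi>"
  show ?case
  proof (cases "f = 0")
    case True
    then show ?thesis by (intro exI[of _ "[:[:a:]:]"]) (auto simp: coeff_bound_def coeff_pCons split: nat.splits)
  next
    case False
    have "coeff_bound [:[:0, 1 :: 'a:], 1:] 1"
      by (auto simp: coeff_bound_def coeff_pCons split: nat.splits)
    then have "coeff_bound ([:[:0, 1:], 1:] * \<Phi>) (1 + deg f)" using P(2) by (rule coeff_bound_mult)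
    moreover have "coeff_bound [:[:a:]:] (1 + deg f)" using coeff_bound_const[of "[:a:]"] by (rule coeff_bound_mono) simp
    ultimately have "coeff_bound ?P (deg (pCons a f))" using False coeff_bound_add by fastforce
    moreover have "poly.coeff ?P 0 = pCons a f" using P(1) by simp
    moreover have "poly ?P u = pcompose (pCons a f) ([:0, 1:] + u)" for u
    proof -
      have "pCons 0 Z = [:0, 1:] * Z" for Z :: "'a poly" by simp
      then have "pCons 0 Z + u * Z = ([:0, 1:] + u) * Z" for Z by (metis distrib_right)
      then show ?thesis by (simp add: P(3) pcompose_pCons)
    qed
    ultimately show ?thesis by blast
  qed
qed

text \<open>\<open>\<Sum> sqrt_coeff \<phi> f i / f\<^sup>i Y\<^sup>i\<close> is the square root of \<open>\<Sum> \<phi> i / f Y\<^sup>i\<close>, where \<open>\<phi> 0 = f\<close>.\<close>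

function sqrt_coeff :: "(nat \<Rightarrow> 'a::Fields.field poly) \<Rightarrow> 'a poly \<Rightarrow> nat \<Rightarrow> 'a poly" where
  "sqrt_coeff \<phi> f i = (if i = 0 then 1 else Polynomial.smult (1 / 2)
     (\<phi> i * f ^ (i - 1) - (\<Sum>a\<in>{1..<i}. sqrt_coeff \<phi> f a * sqrt_coeff \<phi> f (i - a))))"
  by pat_completeness auto
termination by (relation "measure (\<lambda>(\<phi>, f, i). i)") auto

declare sqrt_coeff.simps [simp del]

lemma sqrt_coeff_0 [simp]: "sqrt_coeff \<phi> f 0 = 1"
  by (simp add: sqrt_coeff.simps)

text \<open>The coefficient of Y^i in the square of the root, multiplied by f^(i+1) to clear
  denominators.\<close>

lemma sqrt_coeff_conv:
  fixes f :: "'a::Fields.field poly"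
  assumes "(2::'a) \<noteq> 0" "\<phi> 0 = f"
  shows "f * (\<Sum>a\<le>i. sqrt_coeff \<phi> f a * sqrt_coeff \<phi> f (i - a)) = \<phi> i * f ^ i"
proof (cases i)
  case 0
  then show ?thesis using assms(2) by simp
next
  case (Suc j)
  let ?c = "sqrt_coeff \<phi> f"
  have "{..i} = insert 0 (insert i {1..<i})" using Suc by auto
  then have "(\<Sum>a\<le>i. ?c a * ?c (i - a)) = ?c i + ?c i + (\<Sum>a\<in>{1..<i}. ?c a * ?c (i - a))"
    using Suc by (simp add: add.assoc)
  also have "?c i + ?c i = \<phi> i * f ^ (i - 1) - (\<Sum>a\<in>{1..<i}. ?c a * ?c (i - a))"
  proof -
    have "Polynomial.smult (1/2) x + Polynomial.smult (1/2) x = x" for x :: "'a poly"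
    proof -
      have "(1/2 + 1/2 :: 'a) = 1" using assms(1) by (simp add: field_simps)
      then show ?thesis by (simp flip: smult_add_left)
    qed
    moreover have "?c i = Polynomial.smult (1 / 2) (\<phi> i * f ^ (i - 1) - (\<Sum>a\<in>{1..<i}. ?c a * ?c (i - a)))"
      using Suc by (subst sqrt_coeff.simps) simp
    ultimately show ?thesis by metis
  qed
  finally show ?thesis using Suc by (simp add: mult_ac)
qed

lemma sqrt_coeff_degree:
  fixes f :: "'a::Fields.field poly"
  assumes "\<And>i. deg (\<phi> i) \<le> deg f"
  shows "deg (sqrt_coeff \<phi> f i) \<le> deg f * i"
proof (induction i rule: less_induct)
  case (less i)
  show ?case
  proof (cases "i = 0")
    case False
    have "deg (\<phi> i * f ^ (i - 1)) \<le> deg f + deg f * (i - 1)"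
      by (rule order.trans[OF degree_mult_le add_mono[OF assms]]) (simp add: degree_power_le)
    also have "\<dots> = deg f * i" using False by (cases i) auto
    finally have 1: "deg (\<phi> i * f ^ (i - 1)) \<le> deg f * i" .
    have 2: "deg (\<Sum>a\<in>{1..<i}. sqrt_coeff \<phi> f a * sqrt_coeff \<phi> f (i - a)) \<le> deg f * i"
    proof (rule degree_sum_le)
      fix a assume a: "a \<in> {1..<i}"
      then have "deg (sqrt_coeff \<phi> f a * sqrt_coeff \<phi> f (i - a)) \<le> deg f * a + deg f * (i - a)"
        using less by (intro order.trans[OF degree_mult_le add_mono]) auto
      also have "\<dots> = deg f * i" using a by (simp flip: distrib_left)
      finally show "deg (sqrt_coeff \<phi> f a * sqrt_coeff \<phi> f (i - a)) \<le> deg f * i" .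
    qed simp
    show ?thesis using False degree_diff_le[OF 1 2] by (subst sqrt_coeff.simps) simp
  qed simp
qed

context finite_base
begin

lemma poly_frob: "(f :: 'a poly) ^ q = pcompose f (Polynomial.monom 1 q)"
proof (induction f)
  case (pCons a f)
  obtain n where n: "q = CHAR('a) ^ n" using q_CHAR by auto
  have "([:a:] + [:0, 1:] * f) ^ q = [:a:] ^ q + ([:0, 1:] * f) ^ q"
    by (rule freshmans_dream'[where n = n]) (simp_all add: n)
  also have "[:a:] ^ q = [:a:]"
  proof -
    have "a ^ q = a" using to_ac_frob[of a 1] by (simp flip: to_ac_power)
    then show ?thesis by (simp add: poly_const_pow)
  qed
  finally have "([:a:] + [:0, 1:] * f) ^ q = [:a:] + [:0, 1:] ^ q * f ^ q" by (simp only: power_mult_distrib)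
  moreover have "[:a:] + [:0, 1:] * f = pCons a f" by simp
  moreover have "[:0, 1:] ^ q = Polynomial.monom (1 :: 'a) q" by (simp add: monom_altdef)
  ultimately show ?case using pCons by (simp add: pcompose_pCons)
qed (use q_pos in simp)

definition field_poly :: "'a poly" where
  "field_poly = Polynomial.monom 1 q - [:0, 1:]"

lemma field_poly_prod: "field_poly = (\<Prod>t\<in>UNIV. [:- t, 1:])"
proof (rule poly_eqI_degree_lead_coeff[where n = q and A = UNIV])
  let ?g = "\<Prod>t\<in>UNIV. [:- t, 1 :: 'a:]"
  have dg: "deg ?g = q" by (simp add: degree_prod_eq_sum_degree q_card)
  moreover have "Polynomial.lead_coeff ?g = 1" by (simp add: lead_coeff_prod)
  ultimately have "poly.coeff ?g q = 1" by metis
  moreover have "poly.coeff [:0, 1 :: 'a:] q = 0" using q_ge_3 by (intro coeff_eq_0) simp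
  ultimately show "poly.coeff field_poly q = poly.coeff ?g q" by (simp add: field_poly_def)
  show "deg ?g \<le> q" using dg by simp
  show "deg field_poly \<le> q" unfolding field_poly_def using q_ge_3 by (intro degree_diff_le) (auto simp: degree_monom_le)
  show "q \<le> card (UNIV :: 'a set)" by (simp add: q_card)
  show "poly field_poly z = poly ?g z" for z
  proof -
    have "z ^ q = z" using to_ac_frob[of z 1] by (simp flip: to_ac_power)
    then have "poly field_poly z = 0" by (simp add: field_poly_def poly_monom)
    moreover have "poly ?g z = 0" unfolding poly_prod by (intro prod_zero bexI[of _ z]) auto
    ultimately show ?thesis by simp
  qed
qed

lemma poly_field_poly [simp]: "poly field_poly t = 0"
  unfolding field_poly_prod poly_prod by (intro prod_zero bexI[of _ t]) auto

lemma deg_field_poly: "deg field_poly = q"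
  unfolding field_poly_prod by (simp add: degree_prod_eq_sum_degree q_card)

lemma coprime_field_poly:
  assumes "\<And>t. poly h t \<noteq> 0"
  shows "coprime (field_poly ^ M) h"
proof -
  have "coprime [:- t, 1:] h" for t
  proof -
    obtain s where s: "h - [:poly h t:] = [:- t, 1:] * s"
      using poly_eq_0_iff_dvd[of "h - [:poly h t:]" t] by (auto elim: dvdE)
    show ?thesis
    proof (rule coprimeI)
      fix c assume "c dvd [:- t, 1:]" "c dvd h"
      then have "c dvd h - [:- t, 1:] * s" by (intro dvd_diff dvd_mult2)
      then have "c dvd [:poly h t:]" using s by (simp add: algebra_simps)
      then show "is_unit c" using assms[of t] by (meson dvd_trans is_unit_pCons_iff)
    qed
  qed
  then have "coprime field_poly h" unfolding field_poly_prod by (intro prod_coprime_left) auto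
  then show ?thesis by simp
qed

text \<open>A version of Stepanov's argument: \<open>g = \<epsilon> f\<^bsup>(q-1)/2\<^esup>\<close> is \<open>1\<close> on the base field, and \<open>f g\<^sup>2 = f(X\<^sup>q)\<close>. Modulo powers
  of \<open>X\<^sup>q - X\<close> it thus has an expansion with coefficients of small degree. An auxiliary
  \<open>R = \<Sum> (r\<^sub>j + s\<^sub>j g) X\<^bsup>qj\<^esup>\<close> that vanishes to a high order at all points of the base field
  is found by the pigeonhole principle, and it must be zero for degree reasons.\<close>

lemma stepanov:
  fixes f :: "'a poly"
  defines "n \<equiv> deg f"
  assumes eps: "\<epsilon> = 1 \<or> \<epsilon> = - 1" and const: "\<And>t. poly f t ^ ((q - 1) div 2) = \<epsilon>"
    and big: "q > n + 2 * ((2 * n + 1) * (n * (2 * n + 1) + n + 1)) + 2"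
  shows "\<exists>r s c. c \<noteq> 0 \<and> r \<noteq> 0 \<and> s \<noteq> 0 \<and> r\<^sup>2 * f = Polynomial.smult c (s\<^sup>2)"
proof -
  define m where "m = (q - 1) div 2"
  have qm: "q = 2 * m + 1" using q_odd by (auto simp: m_def)
  have m0: "m > 0" using q_ge_3 qm by simp
  have ft: "poly f t \<noteq> 0" for t
  proof
    assume "poly f t = 0"
    then have "\<epsilon> = 0 ^ m" using const[of t] unfolding m_def[symmetric] by simp
    then show False using eps m0 by (simp add: zero_power)
  qed
  then have f0: "f \<noteq> 0" by auto
  define g where "g = Polynomial.smult \<epsilon> (f ^ m)"
  have ee: "\<epsilon> * \<epsilon> = 1" using eps by auto
  have gt: "poly g t = 1" for t using const[of t] ee by (simp add: g_def m_def)
  define u where "u = field_poly"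
  have Xu: "[:0, 1:] + u = Polynomial.monom 1 q" by (simp add: u_def field_poly_def)
  have fg: "f * g\<^sup>2 = pcompose f (Polynomial.monom 1 q)"
  proof -
    have "f * g\<^sup>2 = f ^ q" unfolding g_def qm using ee
      by (simp add: power2_eq_square power_add[symmetric] mult_2 mult_2_right mult.commute)
    then show ?thesis by (simp add: poly_frob)
  qed
  obtain \<Phi> where Phi: "poly.coeff \<Phi> 0 = f" "coeff_bound \<Phi> n" "\<And>u. poly \<Phi> u = pcompose f ([:0, 1:] + u)"
    using exists_taylor[of f] unfolding n_def by blast
  define \<phi> where "\<phi> = poly.coeff \<Phi>"
  define C where "C = sqrt_coeff \<phi> f"
  have Cdeg: "deg (C i) \<le> n * i" for i
    unfolding C_def n_def using Phi(2) by (intro sqrt_coeff_degree) (simp add: \<phi>_def coeff_bound_def n_def)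
  have Cconv: "f * (\<Sum>a\<le>i. C a * C (i - a)) = \<phi> i * f ^ i" for i
    unfolding C_def by (rule sqrt_coeff_conv) (simp_all add: two_nonzero \<phi>_def Phi(1))
  \<comment> \<open>The 2 l J = M l + l free coefficients of the r_j and s_j must outnumber the M B
    coefficients that have to vanish; the degree of R must stay below q M; and 2 l + n \<le> q is
    needed for the congruence modulo X^q at the end to become an equality.\<close>
  define J where "J = n + 1"
  define M where "M = 2 * n + 1"
  define l where "l = (q - n) div 2"
  define G where "G = (\<Sum>i<M. Polynomial.monom (C i * f ^ (M - i)) i)"
  have Gc: "poly.coeff G i = (if i < M then C i * f ^ (M - i) else 0)" for i
    by (simp add: G_def coeff_sum if_distrib[of "\<lambda>x. x = _"] sum.delta' cong: if_cong)
  define Gu where "Gu = poly G u"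
  \<comment> \<open>Both f^M g and Gu are square roots of the same element modulo u^M, up to the
    factor f: the squares agree because \<Phi> at Y = u is f(X^q) = f g^2. On the base field the sum
    of the two roots, times f, takes the nonzero value 2 f^(M+1), so u^M divides their
    difference.\<close>
  have div: "u ^ M dvd f ^ M * g - Gu"
  proof -
    have low: "poly.coeff ([:f:] * (G * G) - [:f ^ (2 * M):] * \<Phi>) i = 0" if i: "i < M" for i
    proof -
      have "poly.coeff (G * G) i = (\<Sum>a\<le>i. (C a * C (i - a)) * f ^ (2 * M - i))"
        unfolding coeff_mult Gc
      proof (rule sum.cong[OF refl])
        fix a assume "a \<in> {..i}"
        then have a: "a \<le> i" "a < M" "i - a < M" "(M - a) + (M - (i - a)) = 2 * M - i" using i by auto
        have "f ^ (M - a) * f ^ (M - (i - a)) = f ^ (2 * M - i)" unfolding power_add[symmetric] a(4) ..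
        then show "(if a < M then C a * f ^ (M - a) else 0) * (if i - a < M then C (i - a) * f ^ (M - (i - a)) else 0) =
            (C a * C (i - a)) * f ^ (2 * M - i)" using a by (simp add: mult_ac)
      qed
      then have "f * poly.coeff (G * G) i = (f * (\<Sum>a\<le>i. C a * C (i - a))) * f ^ (2 * M - i)"
        by (simp add: sum_distrib_right mult.assoc)
      also have "\<dots> = \<phi> i * (f ^ i * f ^ (2 * M - i))" unfolding Cconv by (simp only: mult.assoc)
      also have "f ^ i * f ^ (2 * M - i) = f ^ (2 * M)" unfolding power_add[symmetric] using i by simp
      finally show ?thesis by (simp add: \<phi>_def mult.commute)
    qed
    have "poly ([:f:] * (G * G) - [:f ^ (2 * M):] * \<Phi>) u = f * (Gu * Gu) - f ^ (2 * M) * (f * g\<^sup>2)"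
      by (simp add: Gu_def Phi(3) Xu fg)
    also have "\<dots> = (f * (Gu + f ^ M * g)) * (Gu - f ^ M * g)"
      by (simp add: algebra_simps power2_eq_square mult_2 mult_2_right power_add)
    finally have "u ^ M dvd (f * (Gu + f ^ M * g)) * (Gu - f ^ M * g)"
      using dvd_poly_of_low_zero[OF low, of M u] by simp
    moreover have "coprime (u ^ M) (f * (Gu + f ^ M * g))"
      unfolding u_def
    proof (rule coprime_field_poly)
      fix t
      have "poly Gu t = poly (poly.coeff G 0) t"
      proof -
        obtain c G' where GG: "G = pCons c G'" by (rule pCons_cases)
        show ?thesis unfolding Gu_def u_def GG by simp
      qed
      also have "\<dots> = poly f t ^ M" unfolding Gc C_def by (simp add: M_def)
      finally have "poly (f * (Gu + f ^ M * g)) t = 2 * (poly f t * poly f t ^ M)" by (simp add: gt algebra_simps)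
      then show "poly (f * (Gu + f ^ M * g)) t \<noteq> 0" using ft two_nonzero(1) by simp
    qed
    ultimately have "u ^ M dvd Gu - f ^ M * g" by (simp add: coprime_dvd_mult_right_iff)
    then have "u ^ M dvd - (Gu - f ^ M * g)" by (simp only: dvd_minus_iff)
    then show ?thesis by simp
  qed
  let ?Y = "[:[:0, 1:], 1:] :: 'a poly poly"
  \<comment> \<open>At Y = u this becomes f^M R up to a multiple of u^M: G stands for f^M g and X +
    Y for X^q. Vanishing of the coefficients below Y^M is thus a system of linear conditions on
    polynomials of small degree.\<close>
  define P where "P r s = (\<Sum>j<J. ([:f ^ M * r j:] + Polynomial.smult (s j) G) * ?Y ^ j)" for r s :: "nat \<Rightarrow> 'a poly"
  have Gb: "coeff_bound G (n * M)"
    unfolding coeff_bound_def Gc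
  proof
    fix i
    have "deg (C i * f ^ (M - i)) \<le> n * M" if "i < M"
    proof -
      have "deg (C i * f ^ (M - i)) \<le> n * i + n * (M - i)"
        by (rule order.trans[OF degree_mult_le add_mono[OF Cdeg]]) (simp add: degree_power_le n_def)
      also have "\<dots> = n * M" using that by (simp flip: distrib_left)
      finally show ?thesis .
    qed
    then show "deg (if i < M then C i * f ^ (M - i) else 0) \<le> n * M" by simp
  qed
  have l0: "l > 0" and lbig: "l > (2 * n + 1) * (n * (2 * n + 1) + n + 1)" using big by (auto simp: l_def)
  define B where "B = l + n * M + J"
  have Pb: "poly.coeff (P r s) i \<in> polys_below B" if rs: "\<And>j. j < J \<Longrightarrow> r j \<in> polys_below l" "\<And>j. j < J \<Longrightarrow> s j \<in> polys_below l" for r s i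
  proof -
    have "coeff_bound (P r s) ((n * M + (l - 1)) + (J - 1))"
      unfolding P_def
    proof (rule coeff_bound_sum)
      fix j assume "j \<in> {..<J}"
      then have j: "j < J" by simp
      have d: "deg (r j) \<le> l - 1" "deg (s j) \<le> l - 1" using rs[OF j] l0 by (auto simp: polys_below_def)
      have "deg (f ^ M * r j) \<le> n * M + (l - 1)"
        by (rule order.trans[OF degree_mult_le add_mono[OF _ d(1)]]) (simp add: degree_power_le n_def)
      then have "coeff_bound [:f ^ M * r j:] (n * M + (l - 1))" by (rule coeff_bound_mono[OF coeff_bound_const])
      moreover have "coeff_bound (Polynomial.smult (s j) G) (n * M + (l - 1))"
        using coeff_bound_mult[OF Gb coeff_bound_mono[OF coeff_bound_const d(2)]] by (simp add: mult.commute)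
      ultimately have 1: "coeff_bound ([:f ^ M * r j:] + Polynomial.smult (s j) G) (n * M + (l - 1))" by (rule coeff_bound_add)
      have "coeff_bound ?Y 1" by (auto simp: coeff_bound_def coeff_pCons split: nat.splits)
      then have "coeff_bound (?Y ^ j) (j * 1)" by (rule coeff_bound_power)
      then have "coeff_bound (?Y ^ j) (J - 1)" by (rule coeff_bound_mono) (use j in simp)
      then show "coeff_bound (([:f ^ M * r j:] + Polynomial.smult (s j) G) * ?Y ^ j) ((n * M + (l - 1)) + (J - 1))"
        by (rule coeff_bound_mult[OF 1])
    qed
    moreover have "(n * M + (l - 1)) + (J - 1) < B" using l0 by (simp add: B_def J_def)
    ultimately show ?thesis unfolding coeff_bound_def polys_below_def by (auto intro: le_less_trans)
  qed
  let ?V = "PiE {..<J} (\<lambda>_. (polys_below l :: 'a poly set) \<times> (polys_below l :: 'a poly set))"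
  let ?Z = "\<lambda>w. \<lambda>i\<in>{..<M}. poly.coeff (P (\<lambda>j. fst (w j)) (\<lambda>j. snd (w j))) i"
  \<comment> \<open>Pigeonhole: the conditions are additive, so the difference of two tuples with
    the same image is a nonzero solution.\<close>
  have "\<not> inj_on ?Z ?V"
  proof
    assume i: "inj_on ?Z ?V"
    have sub: "?Z ` ?V \<subseteq> PiE {..<M} (\<lambda>_. polys_below B)"
    proof
      fix z assume "z \<in> ?Z ` ?V"
      then obtain w where w: "w \<in> ?V" "z = ?Z w" by blast
      have "fst (w j) \<in> polys_below l" "snd (w j) \<in> polys_below l" if "j < J" for j
        using PiE_mem[OF w(1), of j] that by auto
      then show "z \<in> PiE {..<M} (\<lambda>_. polys_below B)" unfolding w(2) by (intro restrict_PiE_iff[THEN iffD2] ballI Pb)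
    qed
    have "card ?V = q ^ (2 * l * J)"
      by (simp add: card_PiE card_cartesian_product card_polys_below q_card power_mult[symmetric] power_add[symmetric] mult_2)
    moreover have "card (PiE {..<M} (\<lambda>_. polys_below B :: 'a poly set)) = q ^ (B * M)"
      by (simp add: card_PiE card_polys_below q_card power_mult[symmetric])
    moreover have "card ?V \<le> card (PiE {..<M} (\<lambda>_. polys_below B :: 'a poly set))"
      by (rule card_inj_on_le[OF i sub]) (simp add: finite_PiE)
    ultimately have "q ^ (2 * l * J) \<le> q ^ (B * M)" by simp
    then have "2 * l * J \<le> B * M" using q_ge_3 by (simp add: power_le_imp_le_exp)
    moreover have "B * M = M * l + (2 * n + 1) * (n * (2 * n + 1) + n + 1)" by (simp add: B_def M_def J_def algebra_simps)
    moreover have "2 * l * J = M * l + l" by (simp add: M_def J_def algebra_simps)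
    ultimately show False using lbig by simp
  qed
  then obtain w w' where w: "w \<in> ?V" "w' \<in> ?V" "w \<noteq> w'" "?Z w = ?Z w'" unfolding inj_on_def by blast
  define r where "r j = fst (w j) - fst (w' j)" for j
  define s where "s j = snd (w j) - snd (w' j)" for j
  have rs: "r j \<in> polys_below l" "s j \<in> polys_below l" if "j < J" for j
    using PiE_mem[OF w(1), of j] PiE_mem[OF w(2), of j] that by (auto simp: r_def s_def polys_below_iff)
  have nz: "\<exists>j<J. r j \<noteq> 0 \<or> s j \<noteq> 0"
  proof (rule ccontr)
    assume "\<not> ?thesis"
    then have "w j = w' j" if "j < J" for j using that by (auto simp: r_def s_def prod_eq_iff)
    then have "w = w'" by (intro PiE_ext[OF w(1,2)]) auto
    then show False using w by blast
  qed
  have P0: "poly.coeff (P r s) i = 0" if "i < M" for i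
  proof -
    have "P r s = P (\<lambda>j. fst (w j)) (\<lambda>j. snd (w j)) - P (\<lambda>j. fst (w' j)) (\<lambda>j. snd (w' j))"
      unfolding P_def sum_subtractf[symmetric] by (intro sum.cong refl) (simp add: r_def s_def algebra_simps smult_diff_left)
    moreover have "poly.coeff (P (\<lambda>j. fst (w j)) (\<lambda>j. snd (w j))) i = poly.coeff (P (\<lambda>j. fst (w' j)) (\<lambda>j. snd (w' j))) i"
      using fun_cong[OF w(4), of i] that by simp
    ultimately show ?thesis by simp
  qed
  let ?T = "Polynomial.monom 1 q :: 'a poly"
  define R where "R = (\<Sum>j<J. (r j + s j * g) * ?T ^ j)"
  have "u ^ M dvd R"
  proof -
    have "poly (P r s) u = (\<Sum>j<J. (f ^ M * r j + s j * Gu) * ?T ^ j)"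
      unfolding P_def poly_sum by (intro sum.cong refl) (simp add: Gu_def Xu Xu[unfolded add.commute[of _ u]] add.commute)
    moreover have "f ^ M * R = (\<Sum>j<J. (f ^ M * r j + s j * (f ^ M * g)) * ?T ^ j)"
      unfolding R_def sum_distrib_left by (intro sum.cong refl) (simp add: algebra_simps)
    ultimately have "f ^ M * R = poly (P r s) u + (f ^ M * g - Gu) * (\<Sum>j<J. s j * ?T ^ j)"
      by (simp add: sum_distrib_left sum.distrib[symmetric] algebra_simps)
    moreover have "u ^ M dvd poly (P r s) u" by (rule dvd_poly_of_low_zero[OF P0])
    ultimately have "u ^ M dvd f ^ M * R" using div by simp
    moreover have "coprime (u ^ M) (f ^ M)" unfolding u_def by (rule coprime_field_poly) (simp add: ft)
    ultimately show ?thesis by (simp add: coprime_dvd_mult_right_iff)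
  qed
  moreover have "deg R < q * M"
  proof -
    have "deg R \<le> (l + n * m) + q * n"
      unfolding R_def
    proof (rule degree_sum_le)
      fix j assume "j \<in> {..<J}"
      then have j: "j < J" by simp
      have d: "deg (r j) \<le> l" "deg (s j) \<le> l" using rs[OF j] by (auto simp: polys_below_def)
      have "deg g \<le> n * m" unfolding g_def by (rule order.trans[OF degree_smult_le]) (simp add: degree_power_le n_def)
      then have "deg (s j * g) \<le> l + n * m" by (intro order.trans[OF degree_mult_le add_mono[OF d(2)]])
      then have "deg (r j + s j * g) \<le> l + n * m" using d(1) by (intro degree_add_le) auto
      moreover have "deg (?T ^ j) \<le> q * n"
      proof -
        have "deg (?T ^ j) \<le> deg ?T * j" by (rule degree_power_le)
        also have "\<dots> \<le> q * n" using j degree_monom_le[of "1 :: 'a" q] by (intro mult_mono) (auto simp: J_def)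
        finally show ?thesis .
      qed
      ultimately show "deg ((r j + s j * g) * ?T ^ j) \<le> (l + n * m) + q * n"
        by (intro order.trans[OF degree_mult_le add_mono])
    qed simp
    also have "\<dots> < q * M"
    proof -
      have "2 * l \<le> q" by (simp add: l_def)
      moreover have "2 * (n * m) \<le> n * q" by (simp add: qm algebra_simps)
      ultimately have "2 * (l + n * m + q * n) \<le> q + n * q + 2 * (q * n)" unfolding distrib_left by linarith
      also have "\<dots> < 2 * (q * M)" using q_pos by (simp add: M_def algebra_simps)
      finally show ?thesis by simp
    qed
    finally show ?thesis .
  qed
  moreover have "deg (u ^ M) = q * M"
    using deg_field_poly q_ge_3 by (subst degree_power_eq) (auto simp: u_def mult.commute)
  ultimately have R0: "R = 0" using dvd_imp_degree_le[of "u ^ M" R] by fastforce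
  define j0 where "j0 = (LEAST j. j < J \<and> (r j \<noteq> 0 \<or> s j \<noteq> 0))"
  have j0: "j0 < J" "r j0 \<noteq> 0 \<or> s j0 \<noteq> 0" using LeastI_ex[OF nz] by (auto simp: j0_def)
  have jl: "r j = 0 \<and> s j = 0" if "j < j0" for j
    using not_less_Least[of j "\<lambda>j. j < J \<and> (r j \<noteq> 0 \<or> s j \<noteq> 0)"] that j0(1) unfolding j0_def[symmetric] by auto
  have T0: "?T ^ j \<noteq> 0" for j by (simp add: monom_eq_0_iff)
  \<comment> \<open>In R = 0 all terms after the first nonzero one carry a higher power of X^q, so
    X^q divides the coefficient of that first term.\<close>
  have Tdvd: "?T dvd r j0 + s j0 * g"
  proof -
    have split: "{..<J} = insert j0 ({..<j0} \<union> {j0<..<J})" using j0(1) by auto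
    have "(\<Sum>j<J. h j) = (\<Sum>j\<in>{..<j0}. h j) + h j0 + (\<Sum>j\<in>{j0<..<J}. h j)" for h :: "nat \<Rightarrow> 'a poly"
      unfolding split by (subst sum.insert) (auto simp: sum.union_disjoint disjoint_iff)
    then have "R = (\<Sum>j\<in>{..<j0}. (r j + s j * g) * ?T ^ j) + (r j0 + s j0 * g) * ?T ^ j0 + (\<Sum>j\<in>{j0<..<J}. (r j + s j * g) * ?T ^ j)"
      unfolding R_def .
    moreover have "(\<Sum>j\<in>{..<j0}. (r j + s j * g) * ?T ^ j) = 0" using jl by (intro sum.neutral) auto
    ultimately have e: "(r j0 + s j0 * g) * ?T ^ j0 = - (\<Sum>j\<in>{j0<..<J}. (r j + s j * g) * ?T ^ j)"
      using R0 by (simp add: eq_neg_iff_add_eq_0)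
    have "?T ^ Suc j0 dvd (\<Sum>j\<in>{j0<..<J}. (r j + s j * g) * ?T ^ j)"
      by (intro dvd_sum dvd_mult le_imp_power_dvd) auto
    then have "?T ^ Suc j0 dvd (r j0 + s j0 * g) * ?T ^ j0" unfolding e by (simp only: dvd_minus_iff)
    then have "?T * ?T ^ j0 dvd (r j0 + s j0 * g) * ?T ^ j0" by simp
    then show ?thesis using T0[of j0] by (simp only: dvd_mult_cancel_right) blast
  qed
  let ?r = "r j0" and ?s = "s j0"
  define c where "c = poly f 0"
  \<comment> \<open>Multiplying r + s g by (r - s g) f removes g except for f g^2 = f(X^q), which is
    the constant f(0) modulo X^q.\<close>
  have "?T dvd ?r\<^sup>2 * f - Polynomial.smult c (?s\<^sup>2)"
  proof -
    have 1: "?T dvd (?r + ?s * g) * ((?r - ?s * g) * f)" using Tdvd by (rule dvd_mult2)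
    have "?T dvd pcompose f ?T - [:c:]"
    proof -
      obtain a f' where ff: "f = pCons a f'" by (rule pCons_cases)
      show ?thesis unfolding c_def ff by (simp add: pcompose_pCons)
    qed
    then have "?T dvd ?s\<^sup>2 * (f * g\<^sup>2 - [:c:])" unfolding fg by (rule dvd_mult)
    then have "?T dvd (?r + ?s * g) * ((?r - ?s * g) * f) + ?s\<^sup>2 * (f * g\<^sup>2 - [:c:])" using 1 by (rule dvd_add[rotated])
    moreover have "(?r + ?s * g) * ((?r - ?s * g) * f) + ?s\<^sup>2 * (f * g\<^sup>2 - [:c:]) = ?r\<^sup>2 * f - Polynomial.smult c (?s\<^sup>2)"
      by (simp add: power2_eq_square algebra_simps)
    ultimately show ?thesis by simp
  qed
  moreover have "deg (?r\<^sup>2 * f - Polynomial.smult c (?s\<^sup>2)) < q"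
  proof -
    have d: "deg ?r \<le> l - 1" "deg ?s \<le> l - 1" using rs[OF j0(1)] l0 by (auto simp: polys_below_def)
    have lq: "2 * l + n \<le> q" using big by (simp add: l_def)
    have "deg (?r\<^sup>2 * f) \<le> 2 * (l - 1) + n"
      using d by (intro order.trans[OF degree_mult_le add_mono] order.trans[OF degree_power_le]) (auto simp: n_def)
    moreover have "deg (Polynomial.smult c (?s\<^sup>2)) \<le> 2 * (l - 1) + n"
      using d by (intro order.trans[OF degree_smult_le] order.trans[OF degree_power_le]) auto
    ultimately have "deg (?r\<^sup>2 * f - Polynomial.smult c (?s\<^sup>2)) \<le> 2 * (l - 1) + n" by (rule degree_diff_le)
    then show ?thesis using lq l0 by simp
  qed
  moreover have "deg ?T = q" by (simp add: degree_monom_eq)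
  ultimately have "?r\<^sup>2 * f - Polynomial.smult c (?s\<^sup>2) = 0" using dvd_imp_degree_le[of ?T] by fastforce
  then have e: "?r\<^sup>2 * f = Polynomial.smult c (?s\<^sup>2)" by simp
  moreover have c0: "c \<noteq> 0" using ft by (simp add: c_def)
  moreover have "?r \<noteq> 0" "?s \<noteq> 0" using e j0(2) f0 c0 by auto
  ultimately show ?thesis by blast
qed

text \<open>A relation r^2 f = c s^2 makes the multiplicity of every root of f a difference of even
  numbers.\<close>

lemma stepanov_order:
  fixes f :: "'a poly"
  assumes "\<epsilon> = 1 \<or> \<epsilon> = - 1" "\<And>t. poly f t ^ ((q - 1) div 2) = \<epsilon>"
    "q > deg f + 2 * ((2 * deg f + 1) * (deg f * (2 * deg f + 1) + deg f + 1)) + 2"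
    and f: "f \<noteq> 0"
  shows "even (Polynomial.order z (lift f))"
proof -
  obtain r s c where h: "c \<noteq> 0" "r \<noteq> 0" "s \<noteq> 0" "r\<^sup>2 * f = Polynomial.smult c (s\<^sup>2)"
    using stepanov[OF assms(1-3)] by blast
  have nz: "lift r \<noteq> 0" "lift s \<noteq> 0" "lift f \<noteq> 0" using h f by (metis lift_eq_iff map_poly_0)+
  have "lift (r\<^sup>2 * f) = lift ([:c:] * s\<^sup>2)" using h(4) by simp
  then have e: "lift r * lift r * lift f = [:to_ac c:] * (lift s * lift s)"
    by (simp only: lift_mult power2_eq_square lift_pCons map_poly_0)
  have "Polynomial.order z (lift r * lift r * lift f) = 2 * Polynomial.order z (lift r) + Polynomial.order z (lift f)"
    using nz by (simp add: order_mult)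
  moreover have "Polynomial.order z ([:to_ac c:] * (lift s * lift s)) = 2 * Polynomial.order z (lift s)"
    using nz h(1) by (simp add: order_mult order_smult)
  ultimately have "2 * Polynomial.order z (lift r) + Polynomial.order z (lift f) = 2 * Polynomial.order z (lift s)"
    using e by metis
  then show ?thesis by (metis even_add dvd_triv_left)
qed

text \<open>The derivative of X^(q^n) - X is -1, so its roots in the closure are simple.\<close>

lemma card_frob_fixed:
  assumes "n > 0"
  shows "card {x :: 'a alg_closure. x ^ (q ^ n) = x} = q ^ n"
proof -
  let ?f = "Polynomial.monom 1 (q ^ n) - [:0, 1:] :: 'a alg_closure poly"
  have d: "deg ?f = q ^ n" by (rule deg_frob_poly[OF assms])
  then have "?f \<noteq> 0" using q_ge_3 by (metis degree_0 not_numeral_le_zero power_eq_0_iff)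
  then obtain A where A: "size A = deg ?f" "?f = Polynomial.smult (Polynomial.lead_coeff ?f) (\<Prod>x\<in>#A. [:-x, 1:])"
    using alg_closed_imp_factorization by blast
  have "of_nat q = (0 :: 'a alg_closure)"
    using of_nat_q by (metis to_ac_0 to_ac_of_nat)
  then have pd: "pderiv ?f = - 1"
    using assms by (simp add: pderiv_diff pderiv_monom pderiv_pCons zero_power one_pCons)
  have "count A x \<le> 1" for x
  proof (rule ccontr)
    assume "\<not> count A x \<le> 1"
    then have "replicate_mset 2 x \<subseteq># A" by (simp add: count_le_replicate_mset_subset_eq[symmetric])
    then obtain B where "A = replicate_mset 2 x + B" by (metis subset_mset.le_iff_add)
    then have "(\<Prod>x\<in>#A. [:-x, 1:]) = [:- x, 1:] * ([:- x, 1:] * (\<Prod>x\<in>#B. [:-x, 1:]))"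
      by (simp add: numeral_2_eq_2 del: mult_pCons_left)
    then have "?f = [:- x, 1:] * ([:- x, 1:] * Polynomial.smult (Polynomial.lead_coeff ?f) (\<Prod>x\<in>#B. [:-x, 1:]))"
      using A(2) by (metis mult_smult_right)
    then have "pderiv ?f = pderiv ([:- x, 1:] * ([:- x, 1:] * Polynomial.smult (Polynomial.lead_coeff ?f) (\<Prod>x\<in>#B. [:-x, 1:])))"
      by (rule arg_cong)
    then have "poly (pderiv ?f) x = 0" unfolding pderiv_mult by (simp only: poly_add poly_mult) simp
    then show False unfolding pd by simp
  qed
  then have "card (set_mset A) = size A"
  proof -
    have "count A x = 1" if "x \<in># A" for x using that \<open>\<And>x. count A x \<le> 1\<close>[of x] by (metis One_nat_def le_antisym count_greater_eq_one_iff)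
    then show ?thesis unfolding size_multiset_overloaded_eq by simp
  qed
  moreover have sub: "set_mset A \<subseteq> {x :: 'a alg_closure. x ^ (q ^ n) = x}"
  proof
    fix x assume "x \<in># A"
    then have "poly ?f x = 0" by (subst A(2)) (auto simp: poly_prod_mset)
    then show "x \<in> {x. x ^ (q ^ n) = x}" by (simp add: poly_monom)
  qed
  ultimately show ?thesis
    using card_mono[OF card_fixed_le(1)[OF assms] sub] card_fixed_le(2)[OF assms] A(1) d by linarith
qed

text \<open>Every forbidden coincidence is a nonzero polynomial equation of degree at most q^(k-1):
  an exponent q^s with s in {a, b} but not in {c, d} keeps the coefficient 1. At most k^4 such
  equations cannot cover the q^k elements of the subfield.\<close>

lemma exists_sidon:
  assumes "k > 0" "q > k ^ 4"
  shows "\<exists>\<zeta> :: 'a alg_closure. \<zeta> ^ (q ^ k) = \<zeta> \<and> (\<forall>a b c d. a < k \<and> b < k \<and> c < k \<and> d < k \<and> a \<noteq> b \<and> c \<noteq> d \<and>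
    \<zeta> ^ (q ^ a) + \<zeta> ^ (q ^ b) = \<zeta> ^ (q ^ c) + \<zeta> ^ (q ^ d) \<longrightarrow> {a, b} = {c, d})"
proof (rule ccontr)
  assume neg: "\<not> ?thesis"
  define P :: "nat \<times> nat \<times> nat \<times> nat \<Rightarrow> 'a alg_closure poly" where "P = (\<lambda>(a, b, c, d). Polynomial.monom 1 (q ^ a) + Polynomial.monom 1 (q ^ b)
    - Polynomial.monom 1 (q ^ c) - Polynomial.monom 1 (q ^ d))"
  define N where "N = {..<k} \<times> {..<k} \<times> {..<k} \<times> {..<k}"
  define I where "I = {(a, b, c, d) \<in> N. a \<noteq> b \<and> c \<noteq> d \<and> {a, b} \<noteq> {c, d}}"
  have fN: "finite N" "card N = k ^ 4" by (simp_all add: N_def numeral_eq_Suc mult.assoc)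
  have IN: "I \<subseteq> N" by (auto simp: I_def)
  then have fI: "finite I" using fN(1) finite_subset by blast
  have roots: "finite {x. poly (P t) x = 0} \<and> card {x. poly (P t) x = 0} \<le> q ^ (k - 1)" if t: "t \<in> I" for t
  proof -
    obtain a b c d where abcd: "t = (a, b, c, d)" by (metis surj_pair)
    have h: "a < k" "b < k" "c < k" "d < k" "a \<noteq> b" "c \<noteq> d" "{a, b} \<noteq> {c, d}" using t by (auto simp: I_def N_def abcd)
    have qq: "q ^ i = q ^ j \<longleftrightarrow> i = j" for i j using q_ge_3 by (simp add: power_inject_exp)
    obtain s where s: "s \<in> {a, b}" "s \<notin> {c, d}" using h(5-7) by blast
    have "poly.coeff (P t) (q ^ s) = 1" using s h(5) by (auto simp: P_def abcd qq)
    then have nz: "P t \<noteq> 0" by auto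
    have "q ^ i \<le> q ^ (k - 1)" if "i < k" for i using that q_ge_3 by (intro power_increasing) auto
    then have "deg (P t) \<le> q ^ (k - 1)" unfolding P_def abcd prod.case using h
      by (intro degree_diff_le degree_add_le order.trans[OF degree_monom_le]) auto
    then show ?thesis using poly_roots_finite[OF nz] card_poly_roots_bound[OF nz] by auto
  qed
  have "{x. x ^ (q ^ k) = x} \<subseteq> (\<Union>t\<in>I. {x. poly (P t) x = 0})"
  proof
    fix x :: "'a alg_closure" assume "x \<in> {x. x ^ (q ^ k) = x}"
    then obtain a b c d where "a < k \<and> b < k \<and> c < k \<and> d < k \<and> a \<noteq> b \<and> c \<noteq> d \<and> x ^ (q ^ a) + x ^ (q ^ b) = x ^ (q ^ c) + x ^ (q ^ d)"
      "{a, b} \<noteq> {c, d}" using neg by blast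
    then have "(a, b, c, d) \<in> I" "poly (P (a, b, c, d)) x = 0" by (auto simp: I_def N_def P_def poly_monom)
    then show "x \<in> (\<Union>t\<in>I. {x. poly (P t) x = 0})" by blast
  qed
  then have "card {x :: 'a alg_closure. x ^ (q ^ k) = x} \<le> card (\<Union>t\<in>I. {x. poly (P t) x = 0})"
    by (rule card_mono[rotated]) (use fI roots in blast)
  then have "q ^ k \<le> card (\<Union>t\<in>I. {x. poly (P t) x = 0})" by (simp only: card_frob_fixed[OF assms(1)])
  also have "\<dots> \<le> (\<Sum>t\<in>I. card {x. poly (P t) x = 0})" by (rule card_UN_le[OF fI])
  also have "\<dots> \<le> (\<Sum>t\<in>I. q ^ (k - 1))" using roots by (intro sum_mono) auto
  also have "\<dots> \<le> k ^ 4 * q ^ (k - 1)" using card_mono[OF fN(1) IN] fN(2) by simp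
  also have "\<dots> < q * q ^ (k - 1)" using assms(2) by simp
  also have "\<dots> = q ^ k" using assms(1) by (metis power_Suc Suc_diff_1)
  finally show False by simp
qed

lemma poly_descent:
  assumes "map_poly (\<lambda>x. x ^ q) P = (P :: 'a alg_closure poly)"
  shows "\<exists>f. lift f = P"
proof -
  have "poly.coeff P i \<in> range to_ac" for i
    using arg_cong[OF assms, of "\<lambda>p. poly.coeff p i"] by (simp add: coeff_map_poly zero_power frob_fixed_iff)
  then have "to_ac (inv_into UNIV to_ac (poly.coeff P i)) = poly.coeff P i" for i by (simp add: f_inv_into_f)
  moreover have "inv_into UNIV to_ac (0 :: 'a alg_closure) = (0 :: 'a)" by (metis inj_to_ac inv_f_f to_ac_0)
  ultimately have "lift (map_poly (inv_into UNIV to_ac) P) = P" by (intro poly_eqI) (simp add: coeff_map_poly)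
  then show ?thesis by blast
qed

lemma frob_poly_prod_linear:
  "map_poly (\<lambda>x. x ^ q) (\<Prod>i\<in>I. [:c i, 1:]) = (\<Prod>i\<in>I. [:(c i :: 'a alg_closure) ^ q, 1:])"
proof -
  have pw: "(\<Sum>x\<in>A. g x) ^ q = (\<Sum>x\<in>A. g x ^ q)" for A and g :: "nat \<Rightarrow> 'a alg_closure"
    by (induction A rule: infinite_finite_induct) (use frob_add[of _ _ 1] in \<open>auto simp: zero_power\<close>)
  have m: "map_poly (\<lambda>x. x ^ q) (P * Q) = map_poly (\<lambda>x. x ^ q) P * map_poly (\<lambda>x. x ^ q) (Q :: 'a alg_closure poly)" for P Q
    by (rule poly_eqI) (simp add: coeff_map_poly coeff_mult zero_power pw power_mult_distrib)
  have l: "map_poly (\<lambda>x. x ^ q) [:c, 1:] = [:(c :: 'a alg_closure) ^ q, 1:]" for c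
    by (rule poly_eqI) (simp add: coeff_map_poly zero_power coeff_pCons split: nat.splits)
  have o: "map_poly (\<lambda>x. x ^ q) (1 :: 'a alg_closure poly) = 1"
    by (rule poly_eqI) (simp add: coeff_map_poly zero_power)
  show ?thesis by (induction I rule: infinite_finite_induct) (simp_all only: prod.infinite prod.empty prod.insert o m l not_False_eq_True)
qed

text \<open>The product over the conjugates descends to the base field. It is irreducible because a
  nonzero polynomial over the base field that vanishes at x vanishes at all k conjugates.\<close>

lemma exists_min_poly:
  assumes "x ^ (q ^ k) = x" "inj_on (\<lambda>i. x ^ (q ^ i)) {..<k}" "k > 0"
  shows "\<exists>p :: 'a poly. irreducible p \<and> Polynomial.lead_coeff p = 1 \<and> deg p = k \<and> ev p x = 0"
proof -
  define c where "c i = - (x ^ (q ^ i))" for i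
  have cS: "c i ^ q = c (Suc i)" for i using frob_minus[of _ 1] by (simp add: c_def flip: power_mult) (simp add: mult.commute)
  have "(\<Prod>i<k. [:c (Suc i), 1:]) = (\<Prod>i<k. [:c i, 1:])"
  proof -
    have "[:c 0, 1:] * (\<Prod>i<k. [:c (Suc i), 1:]) = (\<Prod>i<Suc k. [:c i, 1:])" by (simp only: prod.lessThan_Suc_shift)
    also have "\<dots> = [:c 0, 1:] * (\<Prod>i<k. [:c i, 1:])" using assms(1) by (simp add: c_def mult.commute)
    finally show ?thesis by (rule mult_left_cancel[THEN iffD1, rotated]) simp
  qed
  then have "map_poly (\<lambda>x. x ^ q) (\<Prod>i<k. [:c i, 1:]) = (\<Prod>i<k. [:c i, 1:])"
    by (simp only: frob_poly_prod_linear cS)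
  then obtain p where p: "lift p = (\<Prod>i<k. [:c i, 1:])"
    using poly_descent by blast
  have dp: "deg p = k" using deg_lift[of p] unfolding p by (simp add: degree_prod_eq_sum_degree)
  have "to_ac (Polynomial.lead_coeff p) = 1" unfolding lead_coeff_lift[symmetric] p by (simp add: lead_coeff_prod)
  then have lc: "Polynomial.lead_coeff p = 1" by simp
  have "poly (\<Prod>i<k. [:c i, 1:]) x = 0"
    unfolding poly_prod using assms(3) by (intro prod_zero bexI[of _ 0]) (auto simp: c_def)
  then have root: "ev p x = 0" by (simp add: ev_def p)
  have low: "k \<le> deg a" if a: "a \<noteq> 0" "ev a x = 0" for a :: "'a poly"
  proof -
    have nz: "lift a \<noteq> 0" using a(1) by (metis lift_eq_iff map_poly_0)
    have "(\<lambda>i. x ^ (q ^ i)) ` {..<k} \<subseteq> {y. poly (lift a) y = 0}"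
      using a(2) by (auto simp: ev_def[symmetric] ev_frob zero_power)
    then have "card ((\<lambda>i. x ^ (q ^ i)) ` {..<k}) \<le> card {y. poly (lift a) y = 0}"
      by (rule card_mono[OF poly_roots_finite[OF nz]])
    then have "k \<le> card {y. poly (lift a) y = 0}" by (simp only: card_image[OF assms(2)] card_lessThan)
    then show ?thesis using card_poly_roots_bound[OF nz] by simp
  qed
  have "irreducible p"
  proof (rule Factorial_Ring.irreducibleI)
    show p0: "p \<noteq> 0" using dp assms(3) by auto
    show "\<not> is_unit p" using dp assms(3) p0 by (simp add: is_unit_iff_degree)
    fix a b assume ab: "p = a * b"
    then have nz: "a \<noteq> 0" "b \<noteq> 0" using p0 by auto
    then have d: "deg a + deg b = k" using ab dp by (simp add: degree_mult_eq)
    have "ev a x = 0 \<or> ev b x = 0" using root ab by simp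
    then have "k \<le> deg a \<or> k \<le> deg b" using low[OF nz(1)] low[OF nz(2)] by blast
    then have "deg b = 0 \<or> deg a = 0" using d by linarith
    then show "is_unit a \<or> is_unit b" using is_unit_iff_degree[OF nz(1)] is_unit_iff_degree[OF nz(2)] by blast
  qed
  then show ?thesis using dp lc root by blast
qed

end

section \<open>Primes with different class numbers\<close>

lemma prod_shift:
  fixes g :: "nat \<Rightarrow> 'c::comm_monoid_mult"
  assumes "g k = g 0"
  shows "(\<Prod>r<k. g (Suc r)) = (\<Prod>r<k. g r)"
proof (cases k)
  case (Suc m)
  have "(\<Prod>r<k. g r) = g 0 * (\<Prod>r<m. g (Suc r))" unfolding Suc by (rule prod.lessThan_Suc_shift)
  moreover have "(\<Prod>r<k. g (Suc r)) = (\<Prod>r<m. g (Suc r)) * g k" unfolding Suc by (rule prod.lessThan_Suc)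
  ultimately show ?thesis using assms by (simp add: mult.commute)
qed simp

lemma order_linear: "Polynomial.order z [:c, 1:] = (if c = - z then 1 else 0)" for z :: "'c::idom"
  using order_power_n_n[of z 1] by (auto intro!: order_0I simp: add_eq_0_iff)

lemma order_prod_linear:
  fixes c :: "'b \<Rightarrow> 'c::idom"
  assumes "finite I"
  shows "Polynomial.order z (\<Prod>i\<in>I. [:c i, 1:]) = card {i \<in> I. c i = - z}"
proof -
  have "(\<Prod>i\<in>I. [:c i, 1:]) \<noteq> 0 \<and> Polynomial.order z (\<Prod>i\<in>I. [:c i, 1:]) = (\<Sum>i\<in>I. if c i = - z then 1 else 0)"
    using assms by (induction I rule: finite_induct) (auto simp only: prod.empty prod.insert sum.insert sum.empty order_mult
      mult_eq_0_iff pCons_eq_0_iff one_neq_zero order_linear order_1_eq_0 simp_thms)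
  then show ?thesis using assms by (simp add: sum.If_cases Int_def)
qed

lemma (in finite_base) ev_to_ac: "ev f (to_ac t) = to_ac (poly f t)"
  by (induction f) simp_all

locale sidon_element = finite_base F q
  for F :: "'a::{finite_field,field_gcd} itself" and q +
  fixes \<zeta> :: "'a alg_closure" and k :: nat
  assumes k4: "4 dvd k" "0 < k" and zeta_fixed: "\<zeta> ^ (q ^ k) = \<zeta>"
    and sidon: "\<lbrakk>a < k; b < k; c < k; d < k; a \<noteq> b; c \<noteq> d;
      \<zeta> ^ (q ^ a) + \<zeta> ^ (q ^ b) = \<zeta> ^ (q ^ c) + \<zeta> ^ (q ^ d)\<rbrakk> \<Longrightarrow> {a, b} = {c, d}"
begin

lemma k_ge: "k \<ge> 4" "even k"
  using k4 by (auto simp: dvd_imp_le)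

text \<open>The index is an arbitrary natural number, with period k by \<open>Z_mod\<close>, so that
  Frobenius acts by adding to the index.\<close>

definition Z :: "nat \<Rightarrow> 'a alg_closure" where "Z i = \<zeta> ^ (q ^ i)"

lemma Z_frob: "Z i ^ (q ^ r) = Z (i + r)"
  by (simp add: Z_def power_add flip: power_mult)

lemma Z_add_k: "Z (i + k) = Z i"
  using zeta_fixed by (simp add: Z_def power_add power_mult mult.commute[of "q ^ i"])

lemma Z_mod: "Z (i mod k) = Z i"
proof (induction i rule: less_induct)
  case (less i)
  show ?case
  proof (cases "i < k")
    case False
    then have "Z (i mod k) = Z (i - k)" using less[of "i - k"] k4 by (simp add: le_mod_geq)
    then show ?thesis using Z_add_k[of "i - k"] False by simp
  qed simp
qed

lemma Z_sum_eq:
  assumes "i mod k \<noteq> j mod k" "a mod k \<noteq> b mod k" "Z i + Z j = Z a + Z b"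
  shows "{i mod k, j mod k} = {a mod k, b mod k}"
  using assms(3) unfolding Z_mod[of i, symmetric] Z_mod[of j, symmetric] Z_mod[of a, symmetric] Z_mod[of b, symmetric]
  unfolding Z_def by (intro sidon assms(1,2)) (use k4 in auto)

text \<open>Adding the conjugate with a third index c turns an equality of conjugates into an
  equality of two sums.\<close>

lemma Z_neq:
  assumes "i < j" "j < k"
  shows "Z i \<noteq> Z j"
proof
  assume e: "Z i = Z j"
  obtain c where c: "c < k" "c \<noteq> i" "c \<noteq> j"
  proof -
    have "{0, 1, 2} - {i, j} \<noteq> {}" by auto
    then obtain c where "c \<in> {0, 1, 2} - {i, j}" by blast
    then show thesis using k_ge by (intro that[of c]) auto
  qed
  then have "{i, c} = {j, c}" using Z_sum_eq[of i c j c] assms e by simp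
  then show False using c assms by auto
qed

text \<open>A sum in the base field is fixed by Frobenius, so the index pair would be invariant
  under the cyclic shift by 1, which is impossible for k \<ge> 4.\<close>

lemma Z_sum_neq:
  assumes "i < j" "j < k"
  shows "Z j + Z i + to_ac t \<noteq> 0"
proof
  assume "Z j + Z i + to_ac t = 0"
  then have e: "Z j + Z i = - to_ac t" by (simp add: add_eq_0_iff2)
  have "Z (Suc j) + Z (Suc i) = (Z j + Z i) ^ (q ^ 1)" using Z_frob[of _ 1] frob_add[of _ _ 1] by simp
  also have "\<dots> = Z j + Z i" unfolding e frob_minus to_ac_frob ..
  finally have "{Suc j mod k, Suc i mod k} = {j mod k, i mod k}"
    using assms by (intro Z_sum_eq) (auto simp: mod_Suc)
  then show False using assms k_ge by (auto simp: mod_Suc doubleton_eq_iff split: if_splits)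
qed

text \<open>The conjugates of \<open>theta t\<close> are chosen so that their differences are products of a factor without \<open>t\<close> and a
  factor linear in \<open>t\<close>, see \<open>theta_frob_diff\<close>.\<close>

definition theta :: "'a \<Rightarrow> 'a alg_closure" where
  "theta t = \<zeta>\<^sup>2 + to_ac t * \<zeta>"

lemma theta_frob: "theta t ^ (q ^ i) = (Z i)\<^sup>2 + to_ac t * Z i"
  by (simp add: theta_def frob_add power_mult_distrib to_ac_frob Z_def) (simp add: mult.commute flip: power_mult)

lemma theta_frob_diff: "theta t ^ (q ^ j) - theta t ^ (q ^ i) = (Z j - Z i) * (Z j + Z i + to_ac t)"
  unfolding theta_frob by (simp add: power2_eq_square algebra_simps)

lemma theta_fixed: "theta t ^ (q ^ k) = theta t"
  unfolding theta_frob using Z_add_k[of 0] by (simp add: Z_def theta_def)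

lemma theta_inj: "inj_on (\<lambda>i. theta t ^ (q ^ i)) {..<k}"
proof -
  have "theta t ^ (q ^ j) \<noteq> theta t ^ (q ^ i)" if "i < j" "j < k" for i j
    using Z_neq[OF that] Z_sum_neq[OF that, of t] theta_frob_diff[of t j i] by (metis eq_iff_diff_eq_0 mult_eq_0_iff)
  then show ?thesis unfolding inj_on_def by (metis lessThan_iff linorder_neqE_nat)
qed

definition S :: "(nat \<times> nat) set" where
  "S = (SIGMA j:{j. j < k \<and> even j}. {..<j})"

lemma S_iff: "(j, i) \<in> S \<longleftrightarrow> j < k \<and> even j \<and> i < j"
  by (auto simp: S_def)

lemma finite_S [simp]: "finite S"
  by (simp add: S_def)

lemma card_S: "card S = (\<Sum>j\<in>{j. j < k \<and> even j}. j)"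
  by (simp add: S_def)

text \<open>The norm of the product of all Z j + Z i + X with (j, i) in S, over all Frobenius shifts
  r; it is the polynomial f of the overview.\<close>

definition sum_poly :: "'a alg_closure poly" where
  "sum_poly = (\<Prod>(r, j, i)\<in>{..<k} \<times> S. [:Z (j + r) + Z (i + r), 1:])"

text \<open>Frobenius on the coefficients raises r by 1, a cyclic shift because Z has period
  k.\<close>

lemma sum_poly_descent: "\<exists>f. lift f = sum_poly"
proof (rule poly_descent)
  define g where "g r = (\<Prod>(j, i)\<in>S. [:Z (j + r) + Z (i + r), 1:])" for r
  have "map_poly (\<lambda>x. x ^ q) sum_poly = (\<Prod>x\<in>{..<k} \<times> S. [:(case x of (r, j, i) \<Rightarrow> Z (j + r) + Z (i + r)) ^ q, 1:])"
    unfolding sum_poly_def case_prod_unfold by (rule frob_poly_prod_linear)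
  also have "\<dots> = (\<Prod>(r, j, i)\<in>{..<k} \<times> S. [:Z (j + Suc r) + Z (i + Suc r), 1:])"
  proof (rule prod.cong[OF refl])
    fix x :: "nat \<times> nat \<times> nat"
    obtain r j i where x: "x = (r, j, i)" by (metis surj_pair)
    show "[:(case x of (r, j, i) \<Rightarrow> Z (j + r) + Z (i + r)) ^ q, 1:] = (case x of (r, j, i) \<Rightarrow> [:Z (j + Suc r) + Z (i + Suc r), 1:])"
      unfolding x using frob_add[of "Z (j + r)" "Z (i + r)" 1] Z_frob[of _ 1] by simp
  qed
  also have "\<dots> = (\<Prod>r<k. g (Suc r))" unfolding g_def by (simp add: prod.cartesian_product)
  also have "\<dots> = (\<Prod>r<k. g r)" by (rule prod_shift) (simp add: g_def Z_add_k)
  also have "\<dots> = sum_poly" unfolding g_def sum_poly_def by (simp add: prod.cartesian_product)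
  finally show "map_poly (\<lambda>x. x ^ q) sum_poly = sum_poly" .
qed

text \<open>By the Sidon property the shifted pair is {0, 1} modulo k. If j falls on 1, then i = j -
  1; if j falls on 0, then j is k - 1 or k, which is excluded because j is even and below k.\<close>

lemma sum_poly_root_iff:
  assumes "r < k" "(j, i) \<in> S"
  shows "Z (j + r) + Z (i + r) = Z 0 + Z 1 \<longleftrightarrow> j = Suc i \<and> r = (k - i) mod k"
proof
  have ij: "i < j" "j < k" "even j" using assms(2) by (auto simp: S_iff)
  have md: "x mod k = (if x < k then x else x - k)" if "x < 2 * k" for x
    using that by (simp add: le_mod_geq)
  assume "Z (j + r) + Z (i + r) = Z 0 + Z 1"
  then have "{(j + r) mod k, (i + r) mod k} = {0 mod k, 1 mod k}"
    using ij assms(1) k_ge by (intro Z_sum_eq) (auto simp: md)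
  then have "(j + r) mod k = 0 \<and> (i + r) mod k = 1 \<or> (j + r) mod k = 1 \<and> (i + r) mod k = 0"
    using k_ge by (auto simp: doubleton_eq_iff)
  then show "j = Suc i \<and> r = (k - i) mod k"
  proof
    assume h: "(j + r) mod k = 0 \<and> (i + r) mod k = 1"
    then have "j + r = k" "i + r = 1" using ij assms(1) by (auto simp: md split: if_splits)
    then have "j + 1 = k \<or> j = k" using ij by auto
    then show ?thesis using ij k_ge by auto
  next
    assume h: "(j + r) mod k = 1 \<and> (i + r) mod k = 0"
    then have "i + r = 0 \<or> i + r = k" using ij assms(1) by (auto simp: md split: if_splits)
    then show ?thesis using h ij assms(1) by (auto simp: md split: if_splits)
  qed
next
  assume h: "j = Suc i \<and> r = (k - i) mod k"
  show "Z (j + r) + Z (i + r) = Z 0 + Z 1"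
  proof (cases "i = 0")
    case False
    then have "i + r = 0 + k" "j + r = 1 + k" using h assms by (auto simp: S_iff)
    then show ?thesis by (simp only: Z_add_k add.commute)
  qed (use h in simp)
qed

text \<open>With k = 4 m, the pairs are (2 n + 2, 2 n + 1) with j = 2 n + 2 < 4 m, each with exactly
  one shift, which makes 2 m - 1 linear factors.\<close>

lemma order_sum_poly: "odd (Polynomial.order (- (Z 0 + Z 1)) sum_poly)"
proof -
  obtain m where m: "k = 4 * m" "m > 0" using k4 by (auto elim: dvdE)
  have "Polynomial.order (- (Z 0 + Z 1)) sum_poly
      = card {x \<in> {..<k} \<times> S. (case x of (r, j, i) \<Rightarrow> Z (j + r) + Z (i + r)) = - (- (Z 0 + Z 1))}"
    unfolding sum_poly_def case_prod_unfold by (rule order_prod_linear) simp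
  also have "{x \<in> {..<k} \<times> S. (case x of (r, j, i) \<Rightarrow> Z (j + r) + Z (i + r)) = - (- (Z 0 + Z 1))}
      = (\<lambda>n. ((k - Suc (2 * n)) mod k, 2 * Suc n, Suc (2 * n))) ` {..<2 * m - 1}"
  proof (rule equalityI; rule subsetI)
    fix x assume x: "x \<in> {x \<in> {..<k} \<times> S. (case x of (r, j, i) \<Rightarrow> Z (j + r) + Z (i + r)) = - (- (Z 0 + Z 1))}"
    obtain r j i where rji: "x = (r, j, i)" by (metis surj_pair)
    have 1: "r < k" "(j, i) \<in> S" "Z (j + r) + Z (i + r) = Z 0 + Z 1" using x rji by auto
    then have 2: "j = Suc i" "r = (k - i) mod k" "even j" "j < k" using sum_poly_root_iff by (auto simp: S_iff)
    then obtain n where "i = Suc (2 * n)" by (metis even_Suc oddE Suc_eq_plus1)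
    then show "x \<in> (\<lambda>n. ((k - Suc (2 * n)) mod k, 2 * Suc n, Suc (2 * n))) ` {..<2 * m - 1}"
      using 2 m rji by (intro image_eqI[of _ _ n]) auto
  next
    fix x assume "x \<in> (\<lambda>n. ((k - Suc (2 * n)) mod k, 2 * Suc n, Suc (2 * n))) ` {..<2 * m - 1}"
    then obtain n where n: "n < 2 * m - 1" "x = ((k - Suc (2 * n)) mod k, 2 * Suc n, Suc (2 * n))" by auto
    have 1: "(2 * Suc n, Suc (2 * n)) \<in> S" unfolding S_iff using n m by auto
    have 2: "(k - Suc (2 * n)) mod k < k" using k4 by simp
    have "Z (2 * Suc n + (k - Suc (2 * n)) mod k) + Z (Suc (2 * n) + (k - Suc (2 * n)) mod k) = Z 0 + Z 1"
      using sum_poly_root_iff[OF 2 1] by simp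
    then show "x \<in> {x \<in> {..<k} \<times> S. (case x of (r, j, i) \<Rightarrow> Z (j + r) + Z (i + r)) = - (- (Z 0 + Z 1))}"
      using 1 2 n(2) by simp
  qed
  also have "card \<dots> = 2 * m - 1" by (subst card_image) (auto simp: inj_on_def)
  finally show ?thesis using m(2) by simp
qed

text \<open>The factors Z j - Z i do not involve t; the product of the other factors has norm f(t),
  and \<open>half_pow_eq_norm\<close> reduces its character to the base field.\<close>

lemma half_pow_theta:
  assumes f: "lift f = sum_poly"
  shows "half_pow k (\<Prod>j\<in>{j. j < k \<and> even j}. \<Prod>i<j. theta t ^ (q ^ j) - theta t ^ (q ^ i))
    = half_pow k (\<Prod>(j, i)\<in>S. Z j - Z i) * to_ac (poly f t ^ ((q - 1) div 2))"
proof -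
  have "(\<Prod>j\<in>{j. j < k \<and> even j}. \<Prod>i<j. theta t ^ (q ^ j) - theta t ^ (q ^ i)) = (\<Prod>(j, i)\<in>S. theta t ^ (q ^ j) - theta t ^ (q ^ i))"
    unfolding S_def by (rule prod.Sigma) auto
  also have "\<dots> = (\<Prod>(j, i)\<in>S. Z j - Z i) * (\<Prod>(j, i)\<in>S. Z j + Z i + to_ac t)"
    by (simp add: theta_frob_diff case_prod_unfold prod.distrib)
  finally have 1: "half_pow k (\<Prod>j\<in>{j. j < k \<and> even j}. \<Prod>i<j. theta t ^ (q ^ j) - theta t ^ (q ^ i))
    = half_pow k (\<Prod>(j, i)\<in>S. Z j - Z i) * half_pow k (\<Prod>(j, i)\<in>S. Z j + Z i + to_ac t)"
    by (simp only: half_pow_mult)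
  have "(\<Prod>r<k. (\<Prod>(j, i)\<in>S. Z j + Z i + to_ac t) ^ (q ^ r)) = (\<Prod>r<k. \<Prod>(j, i)\<in>S. Z (j + r) + Z (i + r) + to_ac t)"
    by (simp add: prod_power_distrib case_prod_unfold frob_add Z_frob to_ac_frob)
  also have "\<dots> = poly sum_poly (to_ac t)"
    unfolding sum_poly_def by (simp add: prod.cartesian_product poly_prod case_prod_unfold add_ac)
  also have "\<dots> = to_ac (poly f t)" unfolding f[symmetric] ev_def[symmetric] ev_to_ac ..
  finally show ?thesis unfolding 1 half_pow_eq_norm[of k "\<Prod>(j, i)\<in>S. Z j + Z i + to_ac t"] by simp
qed

text \<open>Here n is the degree of \<open>sum_poly\<close>. A constant sign would make the
  character of f constant on the base field, with a value 1 or -1 since f(0) is nonzero by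
  \<open>Z_sum_neq\<close>, and \<open>stepanov_order\<close> would contradict
  \<open>order_sum_poly\<close>.\<close>

lemma exists_theta_signs:
  defines "n \<equiv> k * (\<Sum>j\<in>{j. j < k \<and> even j}. j)"
  assumes big: "q > n + 2 * ((2 * n + 1) * (n * (2 * n + 1) + n + 1)) + 2"
  shows "\<exists>t u. half_pow k (\<Prod>j\<in>{j. j < k \<and> even j}. \<Prod>i<j. theta t ^ (q ^ j) - theta t ^ (q ^ i)) \<noteq>
    half_pow k (\<Prod>j\<in>{j. j < k \<and> even j}. \<Prod>i<j. theta u ^ (q ^ j) - theta u ^ (q ^ i))"
proof (rule ccontr)
  obtain f where f: "lift f = sum_poly" using sum_poly_descent by blast
  have "deg f = card ({..<k} \<times> S)"
    unfolding deg_lift[of f, symmetric] f sum_poly_def case_prod_unfold by (simp add: degree_prod_eq_sum_degree del: card_cartesian_product)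
  then have df: "deg f = n" by (simp add: n_def card_S card_cartesian_product)
  have "(\<Prod>(j, i)\<in>S. Z j - Z i) \<noteq> 0" by (auto simp: S_iff) (metis Z_neq)
  then have nz: "half_pow k (\<Prod>(j, i)\<in>S. Z j - Z i) \<noteq> 0" by (simp add: half_pow_def)
  assume "\<not> ?thesis"
  then have "to_ac (poly f t ^ ((q - 1) div 2)) = to_ac (poly f 0 ^ ((q - 1) div 2))" for t
    unfolding half_pow_theta[OF f] using nz by (simp del: to_ac_power)
  then have const: "poly f t ^ ((q - 1) div 2) = poly f 0 ^ ((q - 1) div 2)" for t
    by (simp only: to_ac_eq_iff)
  have "sum_poly \<noteq> 0" unfolding sum_poly_def by auto
  then have f0: "f \<noteq> 0" using f by auto
  have "poly f 0 \<noteq> 0"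
  proof
    assume "poly f 0 = 0"
    then have "poly sum_poly (to_ac 0) = 0" using ev_to_ac[of f 0] by (simp add: ev_def f)
    then obtain x where x: "x \<in> {..<k} \<times> S" "poly (case x of (r, j, i) \<Rightarrow> [:Z (j + r) + Z (i + r), 1:]) (to_ac 0) = 0"
      unfolding sum_poly_def poly_prod by (auto simp del: to_ac_0)
    obtain r j i where rji: "x = (r, j, i)" by (metis surj_pair)
    then have "(j, i) \<in> S" "Z (j + r) + Z (i + r) = 0" using x by auto
    then have "(Z j + Z i + to_ac 0) ^ (q ^ r) = 0" by (simp add: frob_add Z_frob)
    then have "Z j + Z i + to_ac 0 = 0" by simp
    then show False using Z_sum_neq \<open>(j, i) \<in> S\<close> by (auto simp only: S_iff)
  qed
  then have "half_pow 1 (to_ac (poly f 0)) = 1 \<or> half_pow 1 (to_ac (poly f 0)) = - 1"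
    using to_ac_frob[of _ 1] by (intro half_pow_cases(2)) auto
  then have "to_ac (poly f 0 ^ ((q - 1) div 2)) = to_ac 1 \<or> to_ac (poly f 0 ^ ((q - 1) div 2)) = to_ac (- 1)"
    by (simp add: half_pow_def)
  then have "poly f 0 ^ ((q - 1) div 2) = 1 \<or> poly f 0 ^ ((q - 1) div 2) = - 1" by (simp only: to_ac_eq_iff)
  then have "even (Polynomial.order (- (Z 0 + Z 1)) (lift f))"
    by (rule stepanov_order[OF _ const _ f0]) (use big in \<open>simp add: df\<close>)
  then show False using order_sum_poly f by simp
qed

end

hide_const (open) Polynomial.order Polynomial.degree Polynomial.lead_coeff

text \<open>The number of ideal classes is measured by an arbitrary complete invariant \<open>f\<close> of ideal classes.\<close>

definition has_classes :: "'c itself \<Rightarrow> 'a::comm_ring_1 \<Rightarrow> int \<Rightarrow> bool" where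
  "has_classes _ D N \<longleftrightarrow> (\<forall>f :: ('a \<times> 'a) set \<Rightarrow> 'c.
    (\<forall>J J'. qideal D J \<longrightarrow> qideal D J' \<longrightarrow> (f J = f J' \<longleftrightarrow> qequiv D J J')) \<longrightarrow> int (card (f ` {J. qideal D J})) = N)"

lemma (in prime_discriminant) has_classes_class_sum: "has_classes TYPE('c) D class_sum"
  unfolding has_classes_def
proof (intro allI impI)
  fix f :: "('a poly \<times> 'a poly) set \<Rightarrow> 'c"
  assume "\<forall>J J'. qideal D J \<longrightarrow> qideal D J' \<longrightarrow> (f J = f J' \<longleftrightarrow> qequiv D J J')"
  then show "int (card (f ` {J. qideal D J})) = class_sum" by (intro class_number_formula) blast
qed

lemma (in sidon_element) exists_prime:
  fixes e t :: 'a
  assumes e: "\<And>x. x\<^sup>2 \<noteq> e"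
  shows "\<exists>p m. irreducible p \<and> Polynomial.lead_coeff p = 1 \<and> deg p = k \<and> quadratic_order (Polynomial.smult e p) \<and>
    has_classes TYPE('c) (Polynomial.smult e p) (2 * (\<Sum>j\<in>{j. j < k \<and> even j}. int q ^ j) - 4 * int m) \<and>
    (- 1) ^ m = half_pow k (\<Prod>j\<in>{j. j < k \<and> even j}. \<Prod>i<j. theta t ^ (q ^ j) - theta t ^ (q ^ i))"
proof -
  obtain p :: "'a poly" where p: "irreducible p" "Polynomial.lead_coeff p = 1" "deg p = k" "ev p (theta t) = 0"
    using exists_min_poly[OF theta_fixed theta_inj k4(2)] by blast
  interpret P: prime_discriminant F q p e "theta t"
    by unfold_locales (use p e k_ge in auto)
  show ?thesis
  proof (intro exI conjI)
    show "quadratic_order (Polynomial.smult e p)" using P.quadratic_order_axioms unfolding P.D_def .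
    show "has_classes TYPE('c) (Polynomial.smult e p) (2 * (\<Sum>j\<in>{j. j < k \<and> even j}. int q ^ j) - 4 * int P.nonresidues)"
      using P.has_classes_class_sum unfolding P.D_def P.class_sum_nonresidues p(3) .
    have "(- 1) ^ P.nonresidues = (of_int ((- 1) ^ P.nonresidues) :: 'a alg_closure)" by simp
    then show "(- 1) ^ P.nonresidues = half_pow k (\<Prod>j\<in>{j. j < k \<and> even j}. \<Prod>i<j. theta t ^ (q ^ j) - theta t ^ (q ^ i))"
      unfolding P.parity_sign_eq[symmetric] P.parity_sign_theta p(3) .
  qed (use p in auto)
qed

lemma ring_rep_irreducible:
  fixes \<psi> :: "'r::{comm_ring_1,algebraic_semidom} \<Rightarrow> 'x"
  assumes "ring_rep \<psi> R" "irreducible x"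
  shows "ring_irreducible\<^bsub>R\<^esub> (\<psi> x)"
proof -
  note r = ring_repD[OF assms(1)]
  have dv: "\<psi> a divides\<^bsub>R\<^esub> \<psi> b \<longleftrightarrow> a dvd b" for a b
    unfolding factor_def dvd_def Bex_def r(8) by (auto simp: r(5)[symmetric] r(6))
  have un: "\<psi> a \<in> Units R \<longleftrightarrow> is_unit a" for a
  proof
    assume "\<psi> a \<in> Units R"
    then obtain b where "b \<in> carrier R" "\<psi> a \<otimes>\<^bsub>R\<^esub> b = \<one>\<^bsub>R\<^esub>" by (auto simp: Units_def)
    then obtain c where "\<psi> (a * c) = \<psi> 1" unfolding r(3,5,8) by blast
    then have "1 = a * c" by (simp add: r(6))
    then show "is_unit a" by (rule dvdI)
  next
    assume "is_unit a"
    then obtain c where "1 = a * c" by (rule dvdE)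
    then have "\<psi> a \<otimes>\<^bsub>R\<^esub> \<psi> c = \<one>\<^bsub>R\<^esub>" "\<psi> c \<otimes>\<^bsub>R\<^esub> \<psi> a = \<one>\<^bsub>R\<^esub>"
      unfolding r(5)[symmetric] r(3)[symmetric] by (simp_all add: mult.commute)
    then show "\<psi> a \<in> Units R" using r(1) by (auto simp: Units_def)
  qed
  show ?thesis
    unfolding ring_irreducible_def Divisibility.irreducible_def
  proof (intro conjI ballI impI)
    show "\<psi> x \<noteq> \<zero>\<^bsub>R\<^esub>" using assms(2) unfolding r(7) Factorial_Ring.irreducible_def by blast
    show "\<psi> x \<notin> Units R" using assms(2) unfolding un Factorial_Ring.irreducible_def by blast
    fix b assume b: "b \<in> carrier R" "properfactor R b (\<psi> x)"
    then obtain a where a: "b = \<psi> a" by (auto simp: r(8))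
    have "a dvd x" "\<not> x dvd a" using b(2) by (auto simp: a properfactor_def dv)
    then show "b \<in> Units R" unfolding a un using irreducibleD'[OF assms(2)] by blast
  qed
qed

text \<open>The long type is that of orbits of subsets of the quadratic field, the codomain of the
  invariant in \<open>class_number_qideals\<close>.\<close>

lemma card_classes_transfer:
  fixes \<phi> :: "'a::{finite_field,field_gcd} \<Rightarrow> 'x" and D :: "'a poly"
  assumes "ring_rep \<phi> F" "quadratic_order D"
    and classes: "has_classes TYPE(('x list \<times> 'x list) set list set set set) D N"
  shows "int (quadratic_class_number F (list_rep \<phi> D)) = N"
proof -
  let ?L = "quadratic_field F (list_rep \<phi> D)"
  obtain \<Psi> where Psi: "quadratic_embedding ?L \<Psi> D" "\<And>a. poly_embed F (list_rep \<phi> D) (list_rep \<phi> a) = \<Psi> (a, 0)"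
    using quadratic_field_embedding[OF assms(1)] by blast
  interpret quadratic_order_embedding ?L \<Psi> D
    using Psi(1) assms(2) by (simp add: quadratic_order_embedding_def)
  have "carrier (poly_ring F) = range (list_rep \<phi>)"
    using ring_repD(10)[OF ring_rep_poly[OF assms(1)]] by simp
  then have "poly_embed F (list_rep \<phi> D) ` carrier (poly_ring F) = range (\<lambda>a. \<Psi> (a, 0))"
    by (simp add: image_image Psi(2))
  then have "quadratic_ring F (list_rep \<phi> D) = range \<Psi>"
    unfolding quadratic_ring_def by (simp only: quadratic_integral_closure)
  then have "quadratic_class_number F (list_rep \<phi> D) = class_number ?L (range \<Psi>)"
    by (simp add: quadratic_class_number_def)
  then show ?thesis using class_number_qideals classes unfolding has_classes_def by metis
qed

text \<open>The term k^4 serves \<open>exists_sidon\<close>; the rest is the bound of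
  \<open>stepanov\<close> for degree n, the degree of \<open>sum_poly\<close>.\<close>

definition order_bound :: "nat \<Rightarrow> nat" where
  "order_bound k = (let n = k * (\<Sum>j\<in>{j. j < k \<and> even j}. j) in
     k ^ 4 + n + 2 * ((2 * n + 1) * (n * (2 * n + 1) + n + 1)) + 2)"

definition distinct_class_numbers :: "'x ring \<Rightarrow> nat \<Rightarrow> bool" where
  "distinct_class_numbers F k \<longleftrightarrow> (\<exists>p p' e e'.
     monic_irreducible F p \<and> length p - 1 = k \<and>
     monic_irreducible F p' \<and> length p' - 1 = k \<and> p \<noteq> p' \<and>
     nonsquare F e \<and> nonsquare F e' \<and>
     quadratic_class_number F (scale_poly F e p) mod 8 \<noteq>
     quadratic_class_number F (scale_poly F e' p') mod 8)"

lemma mod_8_neq: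
  assumes "int N = c - 4 * int m" "int N' = c - 4 * int m'" "even m \<noteq> even m'"
  shows "N mod 8 \<noteq> N' mod 8"
proof
  assume "N mod 8 = N' mod 8"
  then have "int N mod 8 = int N' mod 8" by (metis of_nat_mod of_nat_numeral)
  then have "8 dvd int N - int N'" by (simp add: mod_eq_dvd_iff)
  moreover have "int N - int N' = 4 * (int m' - int m)" using assms(1,2) by simp
  ultimately have "4 * 2 dvd 4 * (int m' - int m)" by simp
  then have "even (int m' - int m)" by (simp only: dvd_mult_cancel_left) simp
  then show False using assms(3) by simp
qed

text \<open>The two primes come from two parameters t and u with the same e, so the term common to
  both class numbers drops out and \<open>mod_8_neq\<close> needs only different parities.\<close>

lemma distinct_class_numbers_transfer:
  fixes \<phi> :: "'a::{finite_field,field_gcd} \<Rightarrow> 'x" and F :: "'x ring"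
  assumes rep: "ring_rep \<phi> F" and q: "primepow (order F)" "odd (order F)" and k: "4 dvd k" "0 < k"
    and big: "order F > order_bound k"
  shows "distinct_class_numbers F k"
proof -
  define q where "q = order F"
  note r = ring_repD[OF rep] and pr = ring_rep_poly[OF rep]
  have qc: "q = card (UNIV :: 'a set)"
    unfolding q_def Coset.order_def using rep by (auto simp: ring_rep_def dest: bij_betw_same_card)
  interpret finite_base "TYPE('a)" q
    by unfold_locales (use qc q q_def in auto)
  obtain e :: 'a where e: "x\<^sup>2 \<noteq> e" for x
  proof -
    \<comment> \<open>Squaring identifies 1 and -1, so on a finite field it is not surjective
      either; this yields a nonsquare.\<close>
    have "\<not> inj (\<lambda>x :: 'a. x\<^sup>2)"
    proof
      assume "inj (\<lambda>x :: 'a. x\<^sup>2)"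
      then have "1 = (- 1 :: 'a)" by (rule injD) simp
      then have "(2 :: 'a) = 0" by (simp add: eq_neg_iff_add_eq_0)
      then show False using two_nonzero by simp
    qed
    then have "\<not> surj (\<lambda>x :: 'a. x\<^sup>2)" by (meson finite finite_UNIV_surj_inj)
    then show thesis using that by (metis surj_def)
  qed
  obtain \<zeta> :: "'a alg_closure" where zeta: "\<zeta> ^ (q ^ k) = \<zeta>" "\<forall>a b c d. a < k \<and> b < k \<and> c < k \<and> d < k \<and> a \<noteq> b \<and> c \<noteq> d \<and>
      \<zeta> ^ (q ^ a) + \<zeta> ^ (q ^ b) = \<zeta> ^ (q ^ c) + \<zeta> ^ (q ^ d) \<longrightarrow> {a, b} = {c, d}"
    using exists_sidon[OF k(2)] big unfolding order_bound_def Let_def q_def by force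
  interpret sidon_element "TYPE('a)" q \<zeta> k
    by unfold_locales (use k zeta in blast)+
  let ?s = "\<lambda>t. half_pow k (\<Prod>j\<in>{j. j < k \<and> even j}. \<Prod>i<j. theta t ^ (q ^ j) - theta t ^ (q ^ i))"
  obtain t u where tu: "?s t \<noteq> ?s u"
    using exists_theta_signs big unfolding order_bound_def Let_def q_def by auto
  let ?c = "2 * (\<Sum>j\<in>{j. j < k \<and> even j}. int q ^ j)"
  have prime: "\<exists>p m. monic_irreducible F p \<and> length p - 1 = k \<and>
      int (quadratic_class_number F (scale_poly F (\<phi> e) p)) = ?c - 4 * int m \<and> (- 1) ^ m = ?s t" for t
  proof -
    obtain p m where p: "irreducible p" "Polynomial.lead_coeff p = 1" "deg p = k" "quadratic_order (Polynomial.smult e p)"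
      "has_classes TYPE(('x list \<times> 'x list) set list set set set) (Polynomial.smult e p) (?c - 4 * int m)" "(- 1) ^ m = ?s t"
      using exists_prime[OF e, of t, where ?'c = "('x list \<times> 'x list) set list set set set"] by blast
    have "p \<noteq> 0" using p(1) by auto
    then have "hd (list_rep \<phi> p) = \<one>\<^bsub>F\<^esub>"
      using p(2) r(3) by (simp add: list_rep_def hd_map hd_rev last_coeffs_eq_coeff_degree)
    then have 1: "monic_irreducible F (list_rep \<phi> p)"
      using ring_rep_irreducible[OF pr p(1)] ring_repD(1)[OF pr] by (simp add: monic_irreducible_def)
    have 2: "length (list_rep \<phi> p) - 1 = k" using \<open>p \<noteq> 0\<close> p(3) by (simp add: list_rep_length)
    have "scale_poly F (\<phi> e) (list_rep \<phi> p) = list_rep \<phi> (Polynomial.smult e p)"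
      using ring_repD(5)[OF pr, of "[:e:]" p] by (simp add: list_rep_const[OF rep])
    then show ?thesis using card_classes_transfer[OF rep p(4,5)] 1 2 p(6) by auto
  qed
  obtain p m where p: "monic_irreducible F p" "length p - 1 = k"
    "int (quadratic_class_number F (scale_poly F (\<phi> e) p)) = ?c - 4 * int m" "(- 1) ^ m = ?s t" using prime by blast
  obtain p' m' where p': "monic_irreducible F p'" "length p' - 1 = k"
    "int (quadratic_class_number F (scale_poly F (\<phi> e) p')) = ?c - 4 * int m'" "(- 1) ^ m' = ?s u" using prime by blast
  have "even m \<noteq> even m'"
    using p(4) p'(4) tu by (auto simp: minus_one_power_iff split: if_splits)
  then have ne: "quadratic_class_number F (scale_poly F (\<phi> e) p) mod 8 \<noteq> quadratic_class_number F (scale_poly F (\<phi> e) p') mod 8"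
    using mod_8_neq[OF p(3) p'(3)] by simp
  have ns: "nonsquare F (\<phi> e)"
    using e by (auto simp: nonsquare_def r(1) r(8) r(5)[symmetric] r(6) power2_eq_square)
  have "p \<noteq> p'" using ne by blast
  with ne show ?thesis unfolding distinct_class_numbers_def
    using p(1,2) p'(1,2) ns ne by blast
qed

section \<open>Descent from types to arbitrary finite fields\<close>

text \<open>The arguments above use a type of class \<open>field\<close>, but the order of a type cannot depend on a variable. So
  a single type is modelled on a field that is a counterexample whenever there is one at all.\<close>

definition is_counterexample :: "nat ring \<Rightarrow> bool" where
  "is_counterexample F \<longleftrightarrow> (\<exists>k. 4 dvd k \<and> 0 < k \<and> field F \<and> primepow (order F) \<and> odd (order F) \<and>
     order F > order_bound k \<and> \<not> distinct_class_numbers F k)"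

lemma exists_critical_field:
  "\<exists>F :: nat ring. field F \<and> finite (carrier F) \<and> ((\<exists>F'. is_counterexample F') \<longrightarrow> is_counterexample F)"
proof (cases "\<exists>F'. is_counterexample F'")
  case True
  then obtain F where F: "is_counterexample F" by blast
  then have "field F" "order F > 0" by (auto simp: is_counterexample_def)
  then show ?thesis using F by (auto simp: Coset.order_def card_gt_0_iff)
next
  case False
  \<comment> \<open>Without a counterexample any finite field serves; this is the field with two
    elements.\<close>
  let ?F = "\<lparr>carrier = {0, 1}, monoid.mult = (*), one = 1, ring.zero = 0, ring.add = (\<lambda>x y. (x + y) mod 2)\<rparr> :: nat ring"
  have "cring ?F"
    by (intro cringI abelian_groupI Group.comm_monoidI) auto
  moreover have "Units ?F = carrier ?F - {\<zero>\<^bsub>?F\<^esub>}" by (auto simp: Units_def)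
  ultimately have "field ?F" by (rule cring.cring_fieldI)
  then show ?thesis using False by (intro exI[of _ ?F]) auto
qed

definition critical_field :: "nat ring" where
  "critical_field = (SOME F. field F \<and> finite (carrier F) \<and> ((\<exists>F'. is_counterexample F') \<longrightarrow> is_counterexample F))"

lemma critical_field: "field critical_field" "finite (carrier critical_field)"
  "is_counterexample F' \<Longrightarrow> is_counterexample critical_field"
  using someI_ex[OF exists_critical_field] unfolding critical_field_def[symmetric] by blast+

typedef critical = "carrier critical_field" morphisms of_critical to_critical
proof -
  interpret field critical_field by (rule critical_field)
  show ?thesis using zero_closed by blast
qed

instantiation critical :: Fields.field
begin

definition "0 = to_critical \<zero>\<^bsub>critical_field\<^esub>"
definition "1 = to_critical \<one>\<^bsub>critical_field\<^esub>"
definition "x + y = to_critical (of_critical x \<oplus>\<^bsub>critical_field\<^esub> of_critical y)"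
definition "x * y = to_critical (of_critical x \<otimes>\<^bsub>critical_field\<^esub> of_critical y)"
definition "- x = to_critical (\<ominus>\<^bsub>critical_field\<^esub> of_critical x)"
definition "x - y = x + - (y :: critical)"
definition "inverse x = (if x = 0 then 0 else to_critical (inv\<^bsub>critical_field\<^esub> of_critical x))"
definition "x div y = x * inverse (y :: critical)"

lemma of_critical_simps:
  "of_critical x \<in> carrier critical_field"
  "of_critical 0 = \<zero>\<^bsub>critical_field\<^esub>" "of_critical 1 = \<one>\<^bsub>critical_field\<^esub>"
  "of_critical (x + y) = of_critical x \<oplus>\<^bsub>critical_field\<^esub> of_critical y"
  "of_critical (x * y) = of_critical x \<otimes>\<^bsub>critical_field\<^esub> of_critical y"
  "of_critical (- x) = \<ominus>\<^bsub>critical_field\<^esub> of_critical x"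
proof -
  interpret field critical_field by (rule critical_field)
  show "of_critical x \<in> carrier critical_field" for x by (rule of_critical)
  then show "of_critical 0 = \<zero>\<^bsub>critical_field\<^esub>" "of_critical 1 = \<one>\<^bsub>critical_field\<^esub>"
    "of_critical (x + y) = of_critical x \<oplus>\<^bsub>critical_field\<^esub> of_critical y"
    "of_critical (x * y) = of_critical x \<otimes>\<^bsub>critical_field\<^esub> of_critical y"
    "of_critical (- x) = \<ominus>\<^bsub>critical_field\<^esub> of_critical x"
    by (simp_all add: zero_critical_def one_critical_def plus_critical_def times_critical_def
        uminus_critical_def to_critical_inverse)
qed

instance
proof
  interpret field critical_field by (rule critical_field)
  note [simp] = of_critical_simps and [simp] = of_critical_inject[symmetric]
  fix x y z :: critical
  show "x + y + z = x + (y + z)" "x + y = y + x" "0 + x = x" "x * y * z = x * (y * z)" "x * y = y * x"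
    "1 * x = x" "(x + y) * z = x * z + y * z" "- x + x = 0" "0 \<noteq> (1 :: critical)"
    by (simp_all add: a_assoc a_comm m_assoc m_comm a_lcomm m_lcomm l_distr r_distr l_neg r_neg)
  show "x - y = x + - y" by (simp only: minus_critical_def)
  show "x div y = x * inverse y" by (simp only: divide_critical_def)
  show "inverse (0 :: critical) = 0" by (simp add: inverse_critical_def)
  assume "x \<noteq> 0"
  then have u: "of_critical x \<in> Units critical_field" by (simp add: field_Units)
  then have "of_critical (inverse x) = inv\<^bsub>critical_field\<^esub> of_critical x"
    using \<open>x \<noteq> 0\<close> by (simp only: inverse_critical_def if_False to_critical_inverse Units_inv_closed)
  then show "inverse x * x = 1" using u by simp
qed

end

lemma finite_critical: "finite (UNIV :: critical set)"
  using critical_field(2) type_definition.Abs_image[OF type_definition_critical] by (metis finite_imageI)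

instance critical :: finite_field
  by (rule finite_fieldI) (rule finite_critical)

text \<open>The sort \<open>field_gcd\<close> provides gcds and factorization of polynomials over
  the type; on the field itself its operations are the trivial ones.\<close>

instantiation critical ::
  "{unique_euclidean_ring, normalization_euclidean_semiring, normalization_semidom_multiplicative}"
begin

definition [simp]: "normalize_critical = (normalize_field :: critical \<Rightarrow> _)"
definition [simp]: "unit_factor_critical = (unit_factor_field :: critical \<Rightarrow> _)"
definition [simp]: "modulo_critical = (mod_field :: critical \<Rightarrow> _)"
definition [simp]: "euclidean_size_critical = (euclidean_size_field :: critical \<Rightarrow> _)"
definition [simp]: "division_segment (x :: critical) = 1"

instance
  by standard (simp_all add: dvd_field_iff field_split_simps split: if_splits)

end

instantiation critical :: euclidean_ring_gcd
begin

definition gcd_critical :: "critical \<Rightarrow> critical \<Rightarrow> critical" where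
  "gcd_critical = Euclidean_Algorithm.gcd"
definition lcm_critical :: "critical \<Rightarrow> critical \<Rightarrow> critical" where
  "lcm_critical = Euclidean_Algorithm.lcm"
definition Gcd_critical :: "critical set \<Rightarrow> critical" where
  "Gcd_critical = Euclidean_Algorithm.Gcd"
definition Lcm_critical :: "critical set \<Rightarrow> critical" where
  "Lcm_critical = Euclidean_Algorithm.Lcm"

instance
  by standard (simp_all add: gcd_critical_def lcm_critical_def Gcd_critical_def Lcm_critical_def)

end

instance critical :: field_gcd ..

lemma ring_rep_critical: "ring_rep of_critical critical_field"
  unfolding ring_rep_def bij_betw_def
  using type_definition.Rep_range[OF type_definition_critical]
  by (auto simp: of_critical_simps inj_def of_critical_inject)

lemma not_is_counterexample: "\<not> is_counterexample F"
proof
  assume "is_counterexample F"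
  then have "is_counterexample critical_field" by (rule critical_field)
  then show False
    unfolding is_counterexample_def using distinct_class_numbers_transfer[OF ring_rep_critical] by blast
qed

theorem theorem2:
  fixes k :: nat
  assumes "k > 0" and "4 dvd k"
  shows "\<exists>C::nat. \<forall>(q::nat) (F :: nat ring).
           primepow q \<and> odd q \<and> q > C \<and> coprime q (k - 4) \<and> field F \<and> order F = q \<longrightarrow>
           (\<exists>p p' e e'.
              monic_irreducible F p \<and> degree p = k \<and>
              monic_irreducible F p' \<and> degree p' = k \<and> p \<noteq> p' \<and>
              nonsquare F e \<and> nonsquare F e' \<and>
              quadratic_class_number F (scale_poly F e p) mod 8 \<noteq>
              quadratic_class_number F (scale_poly F e' p') mod 8)"
proof (intro exI[of _ "order_bound k"] allI impI)
  fix q and F :: "nat ring"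
  assume F: "primepow q \<and> odd q \<and> q > order_bound k \<and> coprime q (k - 4) \<and> field F \<and> order F = q"
  have "distinct_class_numbers F k"
    using not_is_counterexample[of F] F assms unfolding is_counterexample_def by blast
  then show "\<exists>p p' e e'.
              monic_irreducible F p \<and> degree p = k \<and>
              monic_irreducible F p' \<and> degree p' = k \<and> p \<noteq> p' \<and>
              nonsquare F e \<and> nonsquare F e' \<and>
              quadratic_class_number F (scale_poly F e p) mod 8 \<noteq>
              quadratic_class_number F (scale_poly F e' p') mod 8"
    unfolding distinct_class_numbers_def .
qed

end
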